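(* Let $(G,P,\theta)$ be an algebraic dynamical system. The associated product system $M=\bigsqcup_{p\in P}M_p$ of right-Hilbert $C^*(G)$-bimodules over $P$ is compactly aligned.
   Context: A semigroup $P$ with identity $1$ is right LCM if it is left cancellative and, for all $p,q\in P$, $pP\cap qP$ is either empty or equal to $rP$ for some $r\in P$. An algebraic dynamical system is a triple $(G,P,\theta)$ consisting of a countable discrete group $G$, a countable right LCM semigroup $P$ with identity, and an action $\theta$ of $P$ by injective group endomorphisms of $G$ (so $\theta_1=\mathrm{id}$, $\theta_{pq}=\theta_p\theta_q$) such that $\theta_p(G)\cap\theta_q(G)=\theta_r(G)$ whenever $pP\cap qP=rP$. Let $\delta_g$, $g\in G$, be the canonical unitaries generating the full group $C^*$-algebra $C^*(G)$. For $p\in P$ let $\alpha_p$ be the injective unital $*$-endomorphism of $C^*(G)$ with $\alpha_p(\delta_g)=\delta_{\theta_p(g)}$ and $L_p:C^*(G)\to C^*(G)$ the unital positive linear map with $L_p(\delta_g)=\delta_{\theta_p^{-1}(g)}$ if $g\in\theta_p(G)$ and $L_p(\delta_g)=0$ otherwise. $M_p$ is obtained from the vector space $C^*(G)$ with right action $a\cdot b=a\alpha_p(b)$ and pre-inner product $\langle a,b\rangle_p=L_p(a^*b)$ by dividing out $N_p=\{a\mid L_p(a^*a)=0\}$ and completing; the left action is induced by left multiplication, and $\pi_p:C^*(G)\to M_p$ is the quotient map. The disjoint union $M=\bigsqcup_{p\in P}M_p$ is a product system of right-Hilbert $C^*(G)$-bimodules over $P$ with multiplication characterised by $\pi_p(\delta_g)\pi_q(\delta_h)=\pi_{pq}(\delta_{g\theta_p(h)})$;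 in particular $M_p\otimes_{C^*(G)}M_q\cong M_{pq}$ via multiplication. For $\xi,\eta\in M_p$ let $\Theta_{\xi,\eta}(\mu)=\xi\cdot\langle\eta,\mu\rangle_p$; $\mathcal L(M_p)$ denotes the adjointable operators and $\mathcal K(M_p)=\overline{\mathrm{span}}\{\Theta_{\xi,\eta}\mid\xi,\eta\in M_p\}$ the generalised compact operators. For $p,q\in P$ the homomorphism $\iota_p^{pq}:\mathcal L(M_p)\to\mathcal L(M_{pq})$ is characterised by $\iota_p^{pq}(T)(\xi\eta)=(T\xi)\eta$ for $\xi\in M_p$, $\eta\in M_q$. A product system $M$ over a right LCM semigroup $S$ is compactly aligned if for all $p,q,r\in S$ with $pS\cap qS=rS$ and all $T_p\in\mathcal K(M_p)$, $T_q\in\mathcal K(M_q)$ one has $\iota_p^r(T_p)\iota_q^r(T_q)\in\mathcal K(M_r)$. *)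

theory Defs
  imports "HOL-Analysis.Analysis" "HOL-Library.Poly_Mapping" "HOL-Library.Countable"
    "HOL-Library.FuncSet"
begin

section \<open>Complex normed spaces and unital C*-algebras\<close>

class complex_normed_vector = real_normed_vector +
  fixes scaleC :: "complex \<Rightarrow> 'a \<Rightarrow> 'a"  (infixr \<open>*\<^sub>C\<close> 75)
  assumes scaleC_add_right: "c *\<^sub>C (x + y) = c *\<^sub>C x + c *\<^sub>C y"
    and scaleC_add_left: "(c + d) *\<^sub>C x = c *\<^sub>C x + d *\<^sub>C x"
    and scaleC_scaleC: "c *\<^sub>C d *\<^sub>C x = (c * d) *\<^sub>C x"
    and scaleR_scaleC: "r *\<^sub>R x = complex_of_real r *\<^sub>C x"
    and norm_scaleC: "norm (c *\<^sub>C x) = cmod c * norm x"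

class cstar_algebra = complex_normed_vector + real_normed_algebra_1 + banach +
  fixes star :: "'a \<Rightarrow> 'a"
  assumes mult_scaleC_left: "(c *\<^sub>C x) * y = c *\<^sub>C (x * y)"
    and mult_scaleC_right: "x * (c *\<^sub>C y) = c *\<^sub>C (x * y)"
    and star_add: "star (x + y) = star x + star y"
    and star_scaleC: "star (c *\<^sub>C x) = cnj c *\<^sub>C star x"
    and star_mult: "star (x * y) = star y * star x"
    and star_star: "star (star x) = x"
    and cstar_identity: "norm (star x * x) = (norm x)\<^sup>2"

definition bounded_clinear ::
  "('a::complex_normed_vector \<Rightarrow> 'b::complex_normed_vector) \<Rightarrow> bool" where
  "bounded_clinear f \<longleftrightarrow> bounded_linear f \<and> (\<forall>c x. f (c *\<^sub>C x) = c *\<^sub>C f x)"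

lemma bounded_linear_scaleC: "bounded_linear (\<lambda>x::'a::complex_normed_vector. c *\<^sub>C x)"
  by (rule bounded_linear_intro[of _ "cmod c"])
     (simp_all add: scaleC_add_right scaleR_scaleC scaleC_scaleC norm_scaleC mult.commute)

lemma scaleC_zero_right: "c *\<^sub>C 0 = (0::'a::complex_normed_vector)"
  using norm_scaleC[of c "0::'a"] by simp

lemma scaleC_zero_left: "0 *\<^sub>C x = (0::'a::complex_normed_vector)"
  using norm_scaleC[of 0 x] by simp

section \<open>The Hilbert space of square-summable sequences\<close>

typedef ell2 = "{x :: nat \<Rightarrow> complex. summable (\<lambda>n. (cmod (x n))\<^sup>2)}"
  morphisms ell2_nth Abs_ell2
  by (rule exI[of _ "\<lambda>_. 0"]) simp

setup_lifting type_definition_ell2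

lemma ell2_summable_inner:
  fixes x y :: "nat \<Rightarrow> complex"
  assumes "summable (\<lambda>n. (cmod (x n))\<^sup>2)" "summable (\<lambda>n. (cmod (y n))\<^sup>2)"
  shows "summable (\<lambda>n. x n \<bullet> y n)"
proof (rule summable_comparison_test')
  show "summable (\<lambda>n. (cmod (x n))\<^sup>2 + (cmod (y n))\<^sup>2)"
    by (intro summable_add assms)
  fix n
  have "norm (x n \<bullet> y n) \<le> cmod (x n) * cmod (y n)"
    using Cauchy_Schwarz_ineq2[of "x n" "y n"] by simp
  also have "\<dots> \<le> (cmod (x n))\<^sup>2 + (cmod (y n))\<^sup>2"
    using sum_squares_bound[of "cmod (x n)" "cmod (y n)"]
      mult_nonneg_nonneg[of "cmod (x n)" "cmod (y n)"]
    unfolding mult.assoc by (smt (verit) norm_ge_zero)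
  finally show "norm (x n \<bullet> y n) \<le> (cmod (x n))\<^sup>2 + (cmod (y n))\<^sup>2" .
qed

lemma ell2_summable_add:
  fixes x y :: "nat \<Rightarrow> complex"
  assumes "summable (\<lambda>n. (cmod (x n))\<^sup>2)" "summable (\<lambda>n. (cmod (y n))\<^sup>2)"
  shows "summable (\<lambda>n. (cmod (x n + y n))\<^sup>2)"
proof -
  have "(cmod (x n + y n))\<^sup>2 = (cmod (x n))\<^sup>2 + 2 * (x n \<bullet> y n) + (cmod (y n))\<^sup>2" for n
    by (simp add: power2_norm_eq_inner inner_add inner_commute)
  then show ?thesis
    using assms by (simp add: summable_add summable_mult ell2_summable_inner)
qed

lemma ell2_summable_scale:
  "summable (\<lambda>n. (cmod (x n))\<^sup>2) \<Longrightarrow> summable (\<lambda>n. (cmod (c * x n))\<^sup>2)"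
  by (simp add: norm_mult power_mult_distrib summable_mult)

instantiation ell2 :: real_inner
begin

lift_definition zero_ell2 :: ell2 is "\<lambda>_. 0" by simp

lift_definition plus_ell2 :: "ell2 \<Rightarrow> ell2 \<Rightarrow> ell2" is "\<lambda>x y n. x n + y n"
  by (rule ell2_summable_add)

lift_definition uminus_ell2 :: "ell2 \<Rightarrow> ell2" is "\<lambda>x n. - x n" by simp

definition minus_ell2 :: "ell2 \<Rightarrow> ell2 \<Rightarrow> ell2" where "minus_ell2 x y = x + - y"

lift_definition scaleR_ell2 :: "real \<Rightarrow> ell2 \<Rightarrow> ell2" is "\<lambda>r x n. complex_of_real r * x n"
  by (rule ell2_summable_scale)

lift_definition inner_ell2 :: "ell2 \<Rightarrow> ell2 \<Rightarrow> real" is "\<lambda>x y. suminf (\<lambda>n. x n \<bullet> y n)" .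

definition norm_ell2 :: "ell2 \<Rightarrow> real" where "norm_ell2 x = sqrt (x \<bullet> x)"
definition sgn_ell2 :: "ell2 \<Rightarrow> ell2" where "sgn_ell2 x = inverse (norm x) *\<^sub>R x"
definition dist_ell2 :: "ell2 \<Rightarrow> ell2 \<Rightarrow> real" where "dist_ell2 x y = norm (x - y)"
definition [code del]:
  "(uniformity :: (ell2 \<times> ell2) filter) = (INF e\<in>{0<..}. principal {(x, y). dist x y < e})"
definition [code del]:
  "open (U :: ell2 set) \<longleftrightarrow> (\<forall>x\<in>U. \<forall>\<^sub>F (x', y) in uniformity. x' = x \<longrightarrow> y \<in> U)"

instance
proof
  fix x y z :: ell2 and r s :: real
  show "x + y + z = x + (y + z)" by transfer (simp add: add.assoc)
  show "x + y = y + x" by transfer (simp add: add.commute)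
  show "0 + x = x" by transfer simp
  show "- x + x = 0" by transfer simp
  show "x - y = x + - y" by (simp add: minus_ell2_def)
  show "r *\<^sub>R (x + y) = r *\<^sub>R x + r *\<^sub>R y" by transfer (simp add: distrib_left)
  show "(r + s) *\<^sub>R x = r *\<^sub>R x + s *\<^sub>R x" by transfer (simp add: distrib_right)
  show "r *\<^sub>R s *\<^sub>R x = (r * s) *\<^sub>R x" by transfer (simp add: mult.assoc)
  show "1 *\<^sub>R x = x" by transfer simp
  show "dist x y = norm (x - y)" by (simp add: dist_ell2_def)
  show "sgn x = inverse (norm x) *\<^sub>R x" by (simp add: sgn_ell2_def)
  show "(uniformity :: (ell2 \<times> ell2) filter) = (INF e\<in>{0<..}. principal {(x, y). dist x y < e})"
    by (rule uniformity_ell2_def)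
  show "open U \<longleftrightarrow> (\<forall>x\<in>U. \<forall>\<^sub>F (x', y) in uniformity. x' = x \<longrightarrow> y \<in> U)" for U :: "ell2 set"
    by (rule open_ell2_def)
  show "x \<bullet> y = y \<bullet> x" by transfer (simp add: inner_commute)
  show "(x + y) \<bullet> z = x \<bullet> z + y \<bullet> z"
    by transfer (simp add: inner_add_left suminf_add ell2_summable_inner)
  show "r *\<^sub>R x \<bullet> y = r * (x \<bullet> y)"
  proof transfer
    fix r :: real and x y :: "nat \<Rightarrow> complex"
    assume "summable (\<lambda>n. (cmod (x n))\<^sup>2)" "summable (\<lambda>n. (cmod (y n))\<^sup>2)"
    then have "summable (\<lambda>n. x n \<bullet> y n)" by (rule ell2_summable_inner)
    then have "suminf (\<lambda>n. r * (x n \<bullet> y n)) = r * suminf (\<lambda>n. x n \<bullet> y n)" by (rule suminf_mult)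
    then show "suminf (\<lambda>n. (complex_of_real r * x n) \<bullet> y n) = r * suminf (\<lambda>n. x n \<bullet> y n)"
      by (simp add: scaleR_conv_of_real[symmetric])
  qed
  show "0 \<le> x \<bullet> x"
    by transfer (simp add: suminf_nonneg ell2_summable_inner)
  show "x \<bullet> x = 0 \<longleftrightarrow> x = 0"
  proof transfer
    fix x :: "nat \<Rightarrow> complex"
    assume "summable (\<lambda>n. (cmod (x n))\<^sup>2)"
    then have "summable (\<lambda>n. x n \<bullet> x n)" using ell2_summable_inner by blast
    then have "suminf (\<lambda>n. x n \<bullet> x n) = 0 \<longleftrightarrow> (\<forall>n. x n \<bullet> x n = 0)"
      by (rule suminf_eq_zero_iff) simp
    then show "suminf (\<lambda>n. x n \<bullet> x n) = 0 \<longleftrightarrow> x = (\<lambda>_. 0)" by auto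
  qed
  show "norm x = sqrt (x \<bullet> x)" by (rule norm_ell2_def)
qed

end

instantiation ell2 :: complex_normed_vector
begin

lift_definition scaleC_ell2 :: "complex \<Rightarrow> ell2 \<Rightarrow> ell2" is "\<lambda>c x n. c * x n"
  by (rule ell2_summable_scale)

instance
proof
  fix x y :: ell2 and c d :: complex and r :: real
  show "c *\<^sub>C (x + y) = c *\<^sub>C x + c *\<^sub>C y" by transfer (simp add: distrib_left)
  show "(c + d) *\<^sub>C x = c *\<^sub>C x + d *\<^sub>C x" by transfer (simp add: distrib_right)
  show "c *\<^sub>C d *\<^sub>C x = (c * d) *\<^sub>C x" by transfer (simp add: mult.assoc)
  show "r *\<^sub>R x = complex_of_real r *\<^sub>C x" by transfer simp
  have "(c *\<^sub>C x) \<bullet> (c *\<^sub>C x) = (cmod c)\<^sup>2 * (x \<bullet> x)"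
  proof transfer
    fix c :: complex and x :: "nat \<Rightarrow> complex"
    assume "summable (\<lambda>n. (cmod (x n))\<^sup>2)"
    then have "summable (\<lambda>n. x n \<bullet> x n)" using ell2_summable_inner by blast
    then have "suminf (\<lambda>n. (cmod c)\<^sup>2 * (x n \<bullet> x n)) = (cmod c)\<^sup>2 * suminf (\<lambda>n. x n \<bullet> x n)"
      by (rule suminf_mult)
    then show "suminf (\<lambda>n. (c * x n) \<bullet> (c * x n)) = (cmod c)\<^sup>2 * suminf (\<lambda>n. x n \<bullet> x n)"
      by (simp add: power2_norm_eq_inner[symmetric] norm_mult power_mult_distrib)
  qed
  then show "norm (c *\<^sub>C x) = cmod c * norm x"
    by (simp add: norm_ell2_def real_sqrt_mult)
qed

end

lemma inner_scaleC_ell2: "(c *\<^sub>C x) \<bullet> y = x \<bullet> (cnj c *\<^sub>C y)" for x y :: ell2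
  by transfer (simp add: inner_complex_def algebra_simps)

section \<open>The full group C*-algebra\<close>

text \<open>
  Groups are written additively (the class \<^class>\<open>group_add\<close> is not assumed commutative), so
  that the group algebra is the convolution ring \<open>'g \<Rightarrow>\<^sub>0 complex\<close> with
  \<open>Poly_Mapping.single g 1\<close> in the role of \<open>\<delta>\<^sub>g\<close>.
\<close>

definition unitary_rep :: "('g::group_add \<Rightarrow> ell2 \<Rightarrow> ell2) \<Rightarrow> bool" where
  "unitary_rep u \<longleftrightarrow>
     (\<forall>g. bounded_clinear (u g) \<and> (\<forall>x. norm (u g x) = norm x)) \<and>
     (\<forall>x. u 0 x = x) \<and> (\<forall>g h x. u (g + h) x = u g (u h x))"

definition galg_rep ::
  "('g \<Rightarrow> ell2 \<Rightarrow> ell2) \<Rightarrow> ('g \<Rightarrow>\<^sub>0 complex) \<Rightarrow> ell2 \<Rightarrow> ell2" where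
  "galg_rep u f x = (\<Sum>g\<in>Poly_Mapping.keys f. Poly_Mapping.lookup f g *\<^sub>C u g x)"

definition galg_star :: "('g::group_add \<Rightarrow>\<^sub>0 complex) \<Rightarrow> ('g \<Rightarrow>\<^sub>0 complex)" where
  "galg_star f = Poly_Mapping.map_key uminus (Poly_Mapping.map cnj f)"

text \<open>
  The universal norm is the supremum over all unitary representations.  For countable \<open>'g\<close>
  it suffices to let these act on \<open>\<ell>\<^sup>2(\<nat>)\<close>: cyclic representations are separable, and a
  representation on a smaller space becomes one on \<open>\<ell>\<^sup>2(\<nat>)\<close> by adding a trivial summand.
\<close>

definition full_norm :: "('g::group_add \<Rightarrow>\<^sub>0 complex) \<Rightarrow> real" where
  "full_norm f = (SUP u\<in>Collect unitary_rep. onorm (galg_rep u f))"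

definition seq_cauchy :: "('v \<Rightarrow> real) \<Rightarrow> (nat \<Rightarrow> 'v::ab_group_add) \<Rightarrow> bool" where
  "seq_cauchy \<nu> X \<longleftrightarrow> (\<forall>e>0. \<exists>N. \<forall>m\<ge>N. \<forall>n\<ge>N. \<nu> (X m - X n) < e)"

definition seq_equiv :: "('v \<Rightarrow> real) \<Rightarrow> (nat \<Rightarrow> 'v::ab_group_add) \<Rightarrow> (nat \<Rightarrow> 'v) \<Rightarrow> bool" where
  "seq_equiv \<nu> X Y \<longleftrightarrow>
     seq_cauchy \<nu> X \<and> seq_cauchy \<nu> Y \<and> (\<lambda>n. \<nu> (X n - Y n)) \<longlonglongrightarrow> 0"

subsection \<open>The universal norm is a C*-seminorm\<close>

lemma galg_rep_superset:
  assumes "finite A" "Poly_Mapping.keys f \<subseteq> A"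
  shows "galg_rep u f x = (\<Sum>g\<in>A. Poly_Mapping.lookup f g *\<^sub>C u g x)"
  unfolding galg_rep_def
  by (rule sum.mono_neutral_left)
     (use assms in \<open>auto simp: in_keys_iff scaleC_zero_left\<close>)

lemma galg_rep_add: "galg_rep u (f + h) x = galg_rep u f x + galg_rep u h x"
proof -
  let ?A = "Poly_Mapping.keys f \<union> Poly_Mapping.keys h"
  have "galg_rep u (f + h) x = (\<Sum>g\<in>?A. Poly_Mapping.lookup (f + h) g *\<^sub>C u g x)"
    using Poly_Mapping.keys_add[of f h] by (intro galg_rep_superset) auto
  then show ?thesis
    by (simp add: galg_rep_superset[where A = ?A] lookup_add scaleC_add_left sum.distrib)
qed

lemma galg_rep_zero: "galg_rep u 0 x = 0"
  by (simp add: galg_rep_def)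

lemma galg_rep_uminus: "galg_rep u (- f) x = - galg_rep u f x"
  using galg_rep_add[of u "- f" f x] by (simp add: galg_rep_zero eq_neg_iff_add_eq_0)

lemma galg_rep_single: "galg_rep u (Poly_Mapping.single k v) x = v *\<^sub>C u k x"
  by (cases "v = 0") (simp_all add: galg_rep_def scaleC_zero_left)

lemma galg_induct [case_names zero single]:
  assumes "P 0" "\<And>k v f. P f \<Longrightarrow> P (Poly_Mapping.single k v + f)"
  shows "P (f :: 'g \<Rightarrow>\<^sub>0 complex)"
proof (induction f rule: Poly_Mapping.update_induct)
  case const
  show ?case by (rule assms)
next
  case (update f a b)
  have "Poly_Mapping.update a b f = Poly_Mapping.single a b + f"
    using update(1) by (intro poly_mapping_eqI)
      (auto simp: lookup_update lookup_add lookup_single when_def in_keys_iff)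
  then show ?case using assms(2)[OF update(3)] by simp
qed

lemma unitary_rep_bounded_clinear: "unitary_rep u \<Longrightarrow> bounded_clinear (u g)"
  and unitary_rep_norm: "unitary_rep u \<Longrightarrow> norm (u g x) = norm x"
  and unitary_rep_zero: "unitary_rep u \<Longrightarrow> u 0 x = x"
  and unitary_rep_add: "unitary_rep u \<Longrightarrow> u (g + h) x = u g (u h x)"
  by (auto simp: unitary_rep_def)

lemma unitary_rep_linear: "unitary_rep u \<Longrightarrow> linear (u g)"
  and unitary_rep_scaleC: "unitary_rep u \<Longrightarrow> u g (c *\<^sub>C x) = c *\<^sub>C u g x"
  using unitary_rep_bounded_clinear by (auto simp: bounded_clinear_def intro: bounded_linear.linear)

lemma bounded_linear_galg_rep:
  assumes "unitary_rep u" shows "bounded_linear (galg_rep u f)"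
  unfolding galg_rep_def
  by (intro bounded_linear_sum bounded_linear_compose[OF bounded_linear_scaleC])
     (use assms unitary_rep_bounded_clinear bounded_clinear_def in auto)

lemma galg_rep_mult:
  assumes u: "unitary_rep u"
  shows "galg_rep u (f * h) x = galg_rep u f (galg_rep u h x)"
proof (induction f rule: galg_induct)
  case zero
  show ?case by (simp add: galg_rep_zero)
next
  case (single k v f)
  have "galg_rep u (Poly_Mapping.single k v * h) x = v *\<^sub>C u k (galg_rep u h x)"
  proof (induction h rule: galg_induct)
    case zero
    show ?case
      using linear_0[OF unitary_rep_linear[OF u]] by (simp add: galg_rep_zero scaleC_zero_right)
  next
    case (single l w h)
    then show ?case
      by (simp add: distrib_left mult_single galg_rep_add galg_rep_single
          linear_add[OF unitary_rep_linear[OF u]] unitary_rep_scaleC[OF u]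
          unitary_rep_add[OF u] scaleC_add_right scaleC_scaleC)
  qed
  with single show ?case by (simp add: distrib_right galg_rep_add galg_rep_single)
qed

lemma inj_uminus_group: "inj (uminus :: 'g::group_add \<Rightarrow> 'g)"
  by (rule injI) simp

lemma lookup_galg_star: "Poly_Mapping.lookup (galg_star f) g = cnj (Poly_Mapping.lookup f (- g))"
  by (simp add: galg_star_def map_key.rep_eq[OF inj_uminus_group] map.rep_eq when_def)

lemma galg_star_add: "galg_star (f + h) = galg_star f + galg_star h"
  by (rule poly_mapping_eqI) (simp add: lookup_galg_star lookup_add)

lemma galg_star_zero: "galg_star 0 = 0"
  by (rule poly_mapping_eqI) (simp add: lookup_galg_star)

lemma galg_star_single:
  "galg_star (Poly_Mapping.single k v) = Poly_Mapping.single (- k) (cnj v)"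
  by (rule poly_mapping_eqI) (auto simp: lookup_galg_star lookup_single when_def)

lemma galg_star_star: "galg_star (galg_star f) = f"
  by (rule poly_mapping_eqI) (simp add: lookup_galg_star)

lemma galg_star_uminus: "galg_star (- f) = - galg_star f"
  by (rule poly_mapping_eqI) (simp add: lookup_galg_star)

lemma galg_star_mult: "galg_star (f * h) = galg_star h * galg_star f"
proof (induction f rule: galg_induct)
  case zero
  show ?case by (simp add: galg_star_zero)
next
  case (single k v f)
  have "galg_star (Poly_Mapping.single k v * h) = galg_star h * galg_star (Poly_Mapping.single k v)"
    by (induction h rule: galg_induct)
       (simp_all add: galg_star_zero distrib_left distrib_right galg_star_add galg_star_single
         mult_single minus_add mult.commute)
  with single show ?case by (simp add: distrib_right distrib_left galg_star_add)
qed

lemma unitary_rep_inner: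
  assumes u: "unitary_rep u"
  shows "u g x \<bullet> y = x \<bullet> u (- g) y"
proof -
  have iso: "u g a \<bullet> u g b = a \<bullet> b" for a b
  proof -
    have "(norm (u g (a + b)))\<^sup>2 = (norm (a + b))\<^sup>2" by (simp add: unitary_rep_norm[OF u])
    moreover have "(norm (u g a))\<^sup>2 = (norm a)\<^sup>2" "(norm (u g b))\<^sup>2 = (norm b)\<^sup>2"
      by (simp_all add: unitary_rep_norm[OF u])
    ultimately show ?thesis
      by (simp add: linear_add[OF unitary_rep_linear[OF u]] power2_norm_eq_inner
          inner_add inner_commute)
  qed
  have "y = u g (u (- g) y)"
    using unitary_rep_add[OF u, of g "- g" y] by (simp add: unitary_rep_zero[OF u])
  then show ?thesis using iso[of x "u (- g) y"] by simp
qed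

lemma galg_rep_inner:
  assumes u: "unitary_rep u"
  shows "galg_rep u f x \<bullet> y = x \<bullet> galg_rep u (galg_star f) y"
  by (induction f rule: galg_induct)
     (simp_all add: galg_rep_zero galg_star_zero galg_rep_add galg_star_add inner_add
       galg_rep_single galg_star_single inner_scaleC_ell2 unitary_rep_inner[OF u]
       unitary_rep_scaleC[OF u])

lemma unitary_rep_trivial: "unitary_rep (\<lambda>g x. x)"
  by (simp add: unitary_rep_def bounded_clinear_def bounded_linear_ident)

lemma onorm_galg_rep_le:
  assumes u: "unitary_rep u"
  shows "onorm (galg_rep u f) \<le> (\<Sum>g\<in>Poly_Mapping.keys f. cmod (Poly_Mapping.lookup f g))"
proof (rule onorm_bound)
  fix x
  have "norm (galg_rep u f x) \<le> (\<Sum>g\<in>Poly_Mapping.keys f. cmod (Poly_Mapping.lookup f g) * norm x)"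
    unfolding galg_rep_def
    by (rule sum_norm_le) (simp add: norm_scaleC unitary_rep_norm[OF u])
  then show "norm (galg_rep u f x) \<le>
      (\<Sum>g\<in>Poly_Mapping.keys f. cmod (Poly_Mapping.lookup f g)) * norm x"
    by (simp add: sum_distrib_right)
qed (simp add: sum_nonneg)

lemma full_norm_upper:
  assumes "unitary_rep u"
  shows "onorm (galg_rep u f) \<le> full_norm f"
  unfolding full_norm_def
  by (rule cSUP_upper)
     (use assms onorm_galg_rep_le in \<open>auto intro!: bdd_aboveI2\<close>)

lemma full_norm_least:
  assumes "\<And>u. unitary_rep u \<Longrightarrow> onorm (galg_rep u f) \<le> c"
  shows "full_norm f \<le> c"
  unfolding full_norm_def
  by (rule cSUP_least) (use assms unitary_rep_trivial in auto)

lemma full_norm_nonneg: "0 \<le> full_norm f"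
  using onorm_pos_le[OF bounded_linear_galg_rep[OF unitary_rep_trivial]]
    full_norm_upper[OF unitary_rep_trivial, of f] by (rule order_trans)

lemma full_norm_zero [simp]: "full_norm 0 = 0"
proof (rule antisym)
  have "galg_rep u 0 = (\<lambda>x. 0)" for u :: "'a \<Rightarrow> ell2 \<Rightarrow> ell2"
    by (rule ext) (rule galg_rep_zero)
  then show "full_norm (0 :: 'a \<Rightarrow>\<^sub>0 complex) \<le> 0"
    by (intro full_norm_least) (simp add: onorm_zero)
qed (rule full_norm_nonneg)

lemma full_norm_uminus: "full_norm (- f) = full_norm f"
proof -
  have "galg_rep u (- f) = (\<lambda>x. - galg_rep u f x)" for u
    by (rule ext) (rule galg_rep_uminus)
  then show ?thesis by (simp add: full_norm_def onorm_neg)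
qed

lemma full_norm_triangle: "full_norm (f + h) \<le> full_norm f + full_norm h"
proof (rule full_norm_least)
  fix u :: "'a \<Rightarrow> ell2 \<Rightarrow> ell2" assume u: "unitary_rep u"
  have "galg_rep u (f + h) = (\<lambda>x. galg_rep u f x + galg_rep u h x)"
    by (rule ext) (rule galg_rep_add)
  then have "onorm (galg_rep u (f + h)) \<le> onorm (galg_rep u f) + onorm (galg_rep u h)"
    using onorm_triangle bounded_linear_galg_rep[OF u] by metis
  then show "onorm (galg_rep u (f + h)) \<le> full_norm f + full_norm h"
    using full_norm_upper[OF u, of f] full_norm_upper[OF u, of h] by linarith
qed

lemma full_norm_mult: "full_norm (f * h) \<le> full_norm f * full_norm h"
proof (rule full_norm_least)
  fix u :: "'a \<Rightarrow> ell2 \<Rightarrow> ell2" assume u: "unitary_rep u"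
  have "galg_rep u (f * h) = galg_rep u f \<circ> galg_rep u h"
    by (rule ext) (simp add: galg_rep_mult[OF u])
  then have "onorm (galg_rep u (f * h)) \<le> onorm (galg_rep u f) * onorm (galg_rep u h)"
    using onorm_compose bounded_linear_galg_rep[OF u] by metis
  also have "\<dots> \<le> full_norm f * full_norm h"
    by (intro mult_mono full_norm_upper[OF u] full_norm_nonneg onorm_pos_le
        bounded_linear_galg_rep[OF u])
  finally show "onorm (galg_rep u (f * h)) \<le> full_norm f * full_norm h" .
qed

lemma full_norm_single: "full_norm (Poly_Mapping.single g c) = cmod c"
proof (rule antisym)
  show "full_norm (Poly_Mapping.single g c) \<le> cmod c"
  proof (rule full_norm_least)
    fix u :: "'a \<Rightarrow> ell2 \<Rightarrow> ell2" assume u: "unitary_rep u"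
    show "onorm (galg_rep u (Poly_Mapping.single g c)) \<le> cmod c"
      by (rule onorm_bound) (simp_all add: galg_rep_single norm_scaleC unitary_rep_norm[OF u])
  qed
  let ?u = "\<lambda>(g::'a) (x::ell2). x"
  define e where "e = Abs_ell2 (\<lambda>n. if n = 0 then 1 else 0)"
  have "ell2_nth e = (\<lambda>n. if n = 0 then 1 else 0)"
    unfolding e_def by (rule Abs_ell2_inverse) (auto intro!: summable_finite[of "{0}"] split: if_splits)
  then have "e \<noteq> 0" by (metis zero_ell2.rep_eq zero_neq_one)
  have "norm (galg_rep ?u (Poly_Mapping.single g c) e) \<le>
      onorm (galg_rep ?u (Poly_Mapping.single g c)) * norm e"
    by (rule onorm[OF bounded_linear_galg_rep[OF unitary_rep_trivial]])
  then have "cmod c \<le> onorm (galg_rep ?u (Poly_Mapping.single g c))"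
    using \<open>e \<noteq> 0\<close> by (simp add: galg_rep_single norm_scaleC)
  then show "cmod c \<le> full_norm (Poly_Mapping.single g c)"
    using full_norm_upper[OF unitary_rep_trivial] order_trans by blast
qed

lemma full_norm_scale: "full_norm (Poly_Mapping.single 0 c * f) = cmod c * full_norm f"
proof (cases "c = 0")
  case False
  show ?thesis
  proof (rule antisym)
    show "full_norm (Poly_Mapping.single 0 c * f) \<le> cmod c * full_norm f"
      using full_norm_mult[of "Poly_Mapping.single 0 c" f] by (simp add: full_norm_single)
    have "f = Poly_Mapping.single 0 (inverse c) * (Poly_Mapping.single 0 c * f)"
      using False by (simp add: mult.assoc[symmetric] mult_single single_one)
    then have "full_norm f \<le> cmod (inverse c) * full_norm (Poly_Mapping.single 0 c * f)"
      using full_norm_mult[of "Poly_Mapping.single 0 (inverse c)" "Poly_Mapping.single 0 c * f"]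
      by (simp add: full_norm_single)
    then show "cmod c * full_norm f \<le> full_norm (Poly_Mapping.single 0 c * f)"
      using False by (simp add: norm_divide field_simps)
  qed
qed simp

lemma full_norm_cstar_le: "(full_norm f)\<^sup>2 \<le> full_norm (galg_star f * f)"
proof -
  have "full_norm f \<le> sqrt (full_norm (galg_star f * f))"
  proof (rule full_norm_least, rule onorm_bound)
    fix u :: "'a \<Rightarrow> ell2 \<Rightarrow> ell2" and x assume u: "unitary_rep u"
    have "(norm (galg_rep u f x))\<^sup>2 = x \<bullet> galg_rep u (galg_star f * f) x"
      by (simp add: power2_norm_eq_inner galg_rep_inner[OF u] galg_rep_mult[OF u])
    also have "\<dots> \<le> norm x * norm (galg_rep u (galg_star f * f) x)"
      by (rule norm_cauchy_schwarz)
    also have "\<dots> \<le> norm x * (onorm (galg_rep u (galg_star f * f)) * norm x)"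
      by (intro mult_left_mono onorm[OF bounded_linear_galg_rep[OF u]] norm_ge_zero)
    also have "\<dots> \<le> norm x * (full_norm (galg_star f * f) * norm x)"
      by (intro mult_left_mono mult_right_mono full_norm_upper[OF u] norm_ge_zero)
    also have "\<dots> = (sqrt (full_norm (galg_star f * f)) * norm x)\<^sup>2"
      by (simp add: power_mult_distrib full_norm_nonneg power2_eq_square)
    finally show "norm (galg_rep u f x) \<le> sqrt (full_norm (galg_star f * f)) * norm x"
      by (rule power2_le_imp_le) (simp add: full_norm_nonneg)
  qed (simp add: full_norm_nonneg)
  then have "(full_norm f)\<^sup>2 \<le> (sqrt (full_norm (galg_star f * f)))\<^sup>2"
    by (intro power_mono full_norm_nonneg)
  then show ?thesis by (simp add: full_norm_nonneg)
qed

lemma full_norm_star: "full_norm (galg_star f) = full_norm f"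
proof -
  have le: "full_norm h \<le> full_norm (galg_star h)" for h :: "'a \<Rightarrow>\<^sub>0 complex"
  proof (cases "full_norm h = 0")
    case True
    then show ?thesis by (simp add: full_norm_nonneg)
  next
    case False
    then have "full_norm h > 0" using full_norm_nonneg[of h] by simp
    moreover have "full_norm h * full_norm h \<le> full_norm (galg_star h) * full_norm h"
      using full_norm_cstar_le[of h] full_norm_mult[of "galg_star h" h]
      by (simp add: power2_eq_square)
    ultimately show ?thesis by simp
  qed
  show ?thesis using le[of f] le[of "galg_star f"] by (simp add: galg_star_star)
qed

lemma full_norm_cstar: "full_norm (galg_star f * f) = (full_norm f)\<^sup>2"
  using full_norm_cstar_le[of f] full_norm_mult[of "galg_star f" f]
  by (simp add: full_norm_star power2_eq_square)

lemma full_norm_minus_commute: "full_norm (f - h) = full_norm (h - f)"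
  using full_norm_uminus[of "f - h"] by simp

lemma full_norm_triangle_minus: "full_norm (f - h) \<le> full_norm (f - k) + full_norm (k - h)"
  using full_norm_triangle[of "f - k" "k - h"] by simp

lemma full_norm_triangle_abs: "\<bar>full_norm f - full_norm h\<bar> \<le> full_norm (f - h)"
  using full_norm_triangle[of "f - h" h] full_norm_triangle[of "h - f" f]
    full_norm_minus_commute[of f h] by simp

subsection \<open>Completion\<close>

text \<open>\<open>C*(G)\<close> is the completion of the group algebra, built from Cauchy sequences.\<close>

lemma seq_equiv_transp: "transp (seq_equiv full_norm)"
proof (rule transpI)
  fix X Y Z :: "nat \<Rightarrow> 'a \<Rightarrow>\<^sub>0 complex"
  assume XY: "seq_equiv full_norm X Y" and YZ: "seq_equiv full_norm Y Z"
  have "(\<lambda>n. full_norm (X n - Y n) + full_norm (Y n - Z n)) \<longlonglongrightarrow> 0 + 0"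
    using XY YZ by (intro tendsto_add) (auto simp: seq_equiv_def)
  then have lim: "(\<lambda>n. full_norm (X n - Y n) + full_norm (Y n - Z n)) \<longlonglongrightarrow> 0" by simp
  have "(\<lambda>n. full_norm (X n - Z n)) \<longlonglongrightarrow> 0"
    by (rule tendsto_sandwich[OF _ _ tendsto_const lim])
       (auto simp: full_norm_nonneg full_norm_triangle_minus intro!: always_eventually)
  then show "seq_equiv full_norm X Z" using XY YZ by (simp add: seq_equiv_def)
qed

quotient_type (overloaded) 'g cstar =
  "nat \<Rightarrow> ('g::group_add \<Rightarrow>\<^sub>0 complex)" / partial: "seq_equiv full_norm"
proof (rule part_equivpI)
  show "\<exists>X :: nat \<Rightarrow> 'g \<Rightarrow>\<^sub>0 complex. seq_equiv full_norm X X"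
    by (rule exI[of _ "\<lambda>_. 0"]) (simp add: seq_equiv_def seq_cauchy_def)
  show "symp (seq_equiv (full_norm :: ('g \<Rightarrow>\<^sub>0 complex) \<Rightarrow> real))"
    by (rule sympI) (simp add: seq_equiv_def full_norm_minus_commute)
qed (rule seq_equiv_transp)

lemma seq_equiv_refl: "seq_equiv full_norm X X \<longleftrightarrow> seq_cauchy full_norm X"
  by (simp add: seq_equiv_def)

lemma seq_cauchyD:
  assumes "seq_cauchy \<nu> X" "e > 0"
  obtains N where "\<And>m n. m \<ge> N \<Longrightarrow> n \<ge> N \<Longrightarrow> \<nu> (X m - X n) < e"
  using assms unfolding seq_cauchy_def by blast

lemma seq_cauchy_norm_convergent:
  assumes "seq_cauchy full_norm X"
  shows "convergent (\<lambda>n. full_norm (X n))"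
proof (rule Cauchy_convergent, rule metric_CauchyI)
  fix e :: real assume "e > 0"
  with assms obtain N where "\<And>m n. m \<ge> N \<Longrightarrow> n \<ge> N \<Longrightarrow> full_norm (X m - X n) < e"
    using seq_cauchyD by blast
  then have "\<forall>m\<ge>N. \<forall>n\<ge>N. dist (full_norm (X m)) (full_norm (X n)) < e"
    unfolding dist_real_def using full_norm_triangle_abs order_le_less_trans by blast
  then show "\<exists>N. \<forall>m\<ge>N. \<forall>n\<ge>N. dist (full_norm (X m)) (full_norm (X n)) < e" ..
qed

lemma seq_cauchy_bounded:
  assumes "seq_cauchy full_norm X"
  shows "\<exists>K>0. \<forall>n. full_norm (X n) \<le> K"
proof -
  have "Bseq (\<lambda>n. full_norm (X n))"
    using seq_cauchy_norm_convergent[OF assms] by (rule convergent_imp_Bseq)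
  then show ?thesis by (simp add: Bseq_def full_norm_nonneg)
qed

lemma seq_cauchy_const: "seq_cauchy full_norm (\<lambda>n. f)"
  by (simp add: seq_cauchy_def)

lemma seq_cauchy_add:
  assumes "seq_cauchy full_norm X" "seq_cauchy full_norm Y"
  shows "seq_cauchy full_norm (\<lambda>n. X n + Y n)"
  unfolding seq_cauchy_def
proof (intro allI impI)
  fix e :: real assume "e > 0"
  then have "e / 2 > 0" by simp
  obtain N where N: "\<And>m n. m \<ge> N \<Longrightarrow> n \<ge> N \<Longrightarrow> full_norm (X m - X n) < e / 2"
    using seq_cauchyD[OF assms(1) \<open>e / 2 > 0\<close>] by blast
  obtain N' where N': "\<And>m n. m \<ge> N' \<Longrightarrow> n \<ge> N' \<Longrightarrow> full_norm (Y m - Y n) < e / 2"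
    using seq_cauchyD[OF assms(2) \<open>e / 2 > 0\<close>] by blast
  have "full_norm (X m + Y m - (X n + Y n)) < e" if "m \<ge> max N N'" "n \<ge> max N N'" for m n
  proof -
    have "full_norm (X m + Y m - (X n + Y n)) \<le> full_norm (X m - X n) + full_norm (Y m - Y n)"
      using full_norm_triangle[of "X m - X n" "Y m - Y n"] by (simp add: algebra_simps)
    then show ?thesis using N[of m n] N'[of m n] that by simp
  qed
  then show "\<exists>N. \<forall>m\<ge>N. \<forall>n\<ge>N. full_norm (X m + Y m - (X n + Y n)) < e" by blast
qed

lemma seq_cauchy_mult:
  assumes "seq_cauchy full_norm X" "seq_cauchy full_norm Y"
  shows "seq_cauchy full_norm (\<lambda>n. X n * Y n)"
  unfolding seq_cauchy_def
proof (intro allI impI)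
  fix e :: real assume "e > 0"
  obtain K where K: "K > 0" "\<And>n. full_norm (X n) \<le> K"
    using seq_cauchy_bounded[OF assms(1)] by blast
  obtain L where L: "L > 0" "\<And>n. full_norm (Y n) \<le> L"
    using seq_cauchy_bounded[OF assms(2)] by blast
  have pos: "e / (2 * K) > 0" "e / (2 * L) > 0" using \<open>e > 0\<close> K(1) L(1) by simp_all
  obtain N where N: "\<And>m n. m \<ge> N \<Longrightarrow> n \<ge> N \<Longrightarrow> full_norm (X m - X n) < e / (2 * L)"
    using seq_cauchyD[OF assms(1) pos(2)] by blast
  obtain N' where N': "\<And>m n. m \<ge> N' \<Longrightarrow> n \<ge> N' \<Longrightarrow> full_norm (Y m - Y n) < e / (2 * K)"
    using seq_cauchyD[OF assms(2) pos(1)] by blast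
  have "full_norm (X m * Y m - X n * Y n) < e" if "m \<ge> max N N'" "n \<ge> max N N'" for m n
  proof -
    have eq: "X m * Y m - X n * Y n = X m * (Y m - Y n) + (X m - X n) * Y n"
      by (simp add: right_diff_distrib left_diff_distrib)
    have "full_norm (X m * Y m - X n * Y n) \<le>
        full_norm (X m) * full_norm (Y m - Y n) + full_norm (X m - X n) * full_norm (Y n)"
      unfolding eq
      using full_norm_triangle[of "X m * (Y m - Y n)" "(X m - X n) * Y n"]
        full_norm_mult[of "X m" "Y m - Y n"] full_norm_mult[of "X m - X n" "Y n"] by linarith
    also have "\<dots> \<le> K * full_norm (Y m - Y n) + full_norm (X m - X n) * L"
      by (intro add_mono mult_mono K(2) L(2) less_imp_le[OF K(1)] less_imp_le[OF L(1)]
          full_norm_nonneg order_refl)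
    also have "\<dots> < K * (e / (2 * K)) + e / (2 * L) * L"
      using N[of m n] N'[of m n] that K(1) L(1)
      by (intro add_strict_mono mult_strict_left_mono mult_strict_right_mono) simp_all
    also have "\<dots> = e" using K(1) L(1) by simp
    finally show ?thesis .
  qed
  then show "\<exists>N. \<forall>m\<ge>N. \<forall>n\<ge>N. full_norm (X m * Y m - X n * Y n) < e" by blast
qed

lemma seq_equiv_add:
  assumes "seq_equiv full_norm X X'" "seq_equiv full_norm Y Y'"
  shows "seq_equiv full_norm (\<lambda>n. X n + Y n) (\<lambda>n. X' n + Y' n)"
proof -
  have "(\<lambda>n. full_norm (X n - X' n) + full_norm (Y n - Y' n)) \<longlonglongrightarrow> 0 + 0"
    using assms by (intro tendsto_add) (auto simp: seq_equiv_def)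
  then have lim: "(\<lambda>n. full_norm (X n - X' n) + full_norm (Y n - Y' n)) \<longlonglongrightarrow> 0" by simp
  have le: "full_norm (X n + Y n - (X' n + Y' n)) \<le> full_norm (X n - X' n) + full_norm (Y n - Y' n)"
    for n using full_norm_triangle[of "X n - X' n" "Y n - Y' n"] by (simp add: algebra_simps)
  have "(\<lambda>n. full_norm (X n + Y n - (X' n + Y' n))) \<longlonglongrightarrow> 0"
    by (rule tendsto_sandwich[OF _ _ tendsto_const lim])
       (auto simp: full_norm_nonneg le intro!: always_eventually)
  then show ?thesis using assms by (simp add: seq_equiv_def seq_cauchy_add)
qed

lemma seq_equiv_mult:
  assumes "seq_equiv full_norm X X'" "seq_equiv full_norm Y Y'"
  shows "seq_equiv full_norm (\<lambda>n. X n * Y n) (\<lambda>n. X' n * Y' n)"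
proof -
  have c: "seq_cauchy full_norm X" "seq_cauchy full_norm X'" "seq_cauchy full_norm Y"
    "seq_cauchy full_norm Y'" using assms by (auto simp: seq_equiv_def)
  obtain K where K: "K > 0" "\<And>n. full_norm (X n) \<le> K"
    using seq_cauchy_bounded[OF c(1)] by blast
  obtain L where L: "L > 0" "\<And>n. full_norm (Y' n) \<le> L"
    using seq_cauchy_bounded[OF c(4)] by blast
  have "(\<lambda>n. K * full_norm (Y n - Y' n) + full_norm (X n - X' n) * L) \<longlonglongrightarrow> K * 0 + 0 * L"
    using assms by (intro tendsto_add tendsto_mult_left tendsto_mult_right) (auto simp: seq_equiv_def)
  then have lim: "(\<lambda>n. K * full_norm (Y n - Y' n) + full_norm (X n - X' n) * L) \<longlonglongrightarrow> 0" by simp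
  have le: "full_norm (X n * Y n - X' n * Y' n) \<le>
      K * full_norm (Y n - Y' n) + full_norm (X n - X' n) * L" for n
  proof -
    have eq: "X n * Y n - X' n * Y' n = X n * (Y n - Y' n) + (X n - X' n) * Y' n"
      by (simp add: right_diff_distrib left_diff_distrib)
    have "full_norm (X n * Y n - X' n * Y' n) \<le>
        full_norm (X n) * full_norm (Y n - Y' n) + full_norm (X n - X' n) * full_norm (Y' n)"
      unfolding eq
      using full_norm_triangle[of "X n * (Y n - Y' n)" "(X n - X' n) * Y' n"]
        full_norm_mult[of "X n" "Y n - Y' n"] full_norm_mult[of "X n - X' n" "Y' n"] by linarith
    also have "\<dots> \<le> K * full_norm (Y n - Y' n) + full_norm (X n - X' n) * L"
      by (intro add_mono mult_mono K(2) L(2) less_imp_le[OF K(1)] less_imp_le[OF L(1)]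
          full_norm_nonneg order_refl)
    finally show ?thesis .
  qed
  have "(\<lambda>n. full_norm (X n * Y n - X' n * Y' n)) \<longlonglongrightarrow> 0"
    by (rule tendsto_sandwich[OF _ _ tendsto_const lim])
       (auto simp: full_norm_nonneg le intro!: always_eventually)
  then show ?thesis using c by (simp add: seq_equiv_def seq_cauchy_mult)
qed

lemma seq_equiv_const: "seq_equiv full_norm (\<lambda>n. f) (\<lambda>n. f)"
  by (simp add: seq_equiv_refl seq_cauchy_const)

lemma seq_equiv_uminus:
  assumes "seq_equiv full_norm X Y"
  shows "seq_equiv full_norm (\<lambda>n. - X n) (\<lambda>n. - Y n)"
  using seq_equiv_mult[OF seq_equiv_const[of "- 1"] assms] by simp

lemma seq_equiv_norm:
  assumes "seq_equiv full_norm X Y"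
  shows "lim (\<lambda>n. full_norm (X n)) = lim (\<lambda>n. full_norm (Y n))"
proof -
  have "(\<lambda>n. full_norm (X n - Y n)) \<longlonglongrightarrow> 0" using assms by (simp add: seq_equiv_def)
  then have 0: "(\<lambda>n. full_norm (X n) - full_norm (Y n)) \<longlonglongrightarrow> 0"
    by (rule Lim_null_comparison[rotated])
       (simp add: full_norm_triangle_abs always_eventually)
  obtain l where l: "(\<lambda>n. full_norm (Y n)) \<longlonglongrightarrow> l"
    using assms seq_cauchy_norm_convergent[of Y] by (auto simp: seq_equiv_def convergent_def)
  have "(\<lambda>n. full_norm (X n)) \<longlonglongrightarrow> l" using tendsto_add[OF 0 l] by simp
  then show ?thesis using l by (simp add: limI)
qed

lemma full_norm_star_diff: "full_norm (galg_star f - galg_star h) = full_norm (f - h)"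
  using full_norm_star[of "f - h"] galg_star_add[of f "- h"] by (simp add: galg_star_uminus)

instantiation cstar :: (group_add) ring_1
begin

lift_definition zero_cstar :: "'a cstar" is "\<lambda>n. 0" by (rule seq_equiv_const)
lift_definition one_cstar :: "'a cstar" is "\<lambda>n. 1" by (rule seq_equiv_const)
lift_definition plus_cstar :: "'a cstar \<Rightarrow> 'a cstar \<Rightarrow> 'a cstar" is "\<lambda>X Y n. X n + Y n"
  by (rule seq_equiv_add)
lift_definition times_cstar :: "'a cstar \<Rightarrow> 'a cstar \<Rightarrow> 'a cstar" is "\<lambda>X Y n. X n * Y n"
  by (rule seq_equiv_mult)
lift_definition uminus_cstar :: "'a cstar \<Rightarrow> 'a cstar" is "\<lambda>X n. - X n"
  by (rule seq_equiv_uminus)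
definition minus_cstar :: "'a cstar \<Rightarrow> 'a cstar \<Rightarrow> 'a cstar" where "minus_cstar x y = x + - y"

instance
proof
  fix x y z :: "'a cstar"
  note eq = seq_equiv_refl seq_cauchy_add seq_cauchy_mult seq_cauchy_const
  show "x + y + z = x + (y + z)" by transfer (simp add: eq add.assoc)
  show "x + y = y + x" by transfer (simp add: eq add.commute)
  show "0 + x = x" by transfer (simp add: eq)
  show "- x + x = 0" by transfer (simp add: eq)
  show "x - y = x + - y" by (simp add: minus_cstar_def)
  show "x * y * z = x * (y * z)" by transfer (simp add: eq mult.assoc)
  show "1 * x = x" by transfer (simp add: eq)
  show "x * 1 = x" by transfer (simp add: eq)
  show "(x + y) * z = x * z + y * z" by transfer (simp add: eq distrib_right)
  show "x * (y + z) = x * y + x * z" by transfer (simp add: eq distrib_left)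
  show "(0 :: 'a cstar) \<noteq> 1"
  proof transfer
    show "\<not> seq_equiv full_norm (\<lambda>n. 0 :: 'a \<Rightarrow>\<^sub>0 complex) (\<lambda>n. 1)"
      using full_norm_single[of "0::'a" 1]
      by (auto simp: seq_equiv_def full_norm_uminus LIMSEQ_const_iff)
  qed
qed

end

lift_definition cstar_scale :: "complex \<Rightarrow> 'g::group_add cstar \<Rightarrow> 'g cstar"
  is "\<lambda>c X n. Poly_Mapping.single 0 c * X n"
  by (rule seq_equiv_mult[OF seq_equiv_const])

lift_definition cstar_norm :: "'g::group_add cstar \<Rightarrow> real" is "\<lambda>X. lim (\<lambda>n. full_norm (X n))"
  by (rule seq_equiv_norm)

lift_definition cstar_star :: "'g::group_add cstar \<Rightarrow> 'g cstar" is "\<lambda>X n. galg_star (X n)"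
proof -
  fix X Y :: "nat \<Rightarrow> 'g \<Rightarrow>\<^sub>0 complex"
  assume a: "seq_equiv full_norm X Y"
  have "seq_cauchy full_norm (\<lambda>n. galg_star (Z n))" if "seq_cauchy full_norm Z"
    for Z :: "nat \<Rightarrow> 'g \<Rightarrow>\<^sub>0 complex"
    using that by (simp add: seq_cauchy_def full_norm_star_diff)
  with a show "seq_equiv full_norm (\<lambda>n. galg_star (X n)) (\<lambda>n. galg_star (Y n))"
    by (simp add: seq_equiv_def full_norm_star_diff)
qed

lemma cstar_cases:
  obtains X where "seq_cauchy full_norm X" "x = abs_cstar X"
proof
  show "seq_cauchy full_norm (rep_cstar x)"
    using Quotient3_rep_reflp[OF Quotient3_cstar, of x] by (simp only: seq_equiv_refl)
  show "x = abs_cstar (rep_cstar x)"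
    by (rule Quotient3_abs_rep[OF Quotient3_cstar, symmetric])
qed

lemma abs_cstar_eq_iff:
  assumes "seq_cauchy full_norm X" "seq_cauchy full_norm Y"
  shows "abs_cstar X = abs_cstar Y \<longleftrightarrow> (\<lambda>n. full_norm (X n - Y n)) \<longlonglongrightarrow> 0"
  using assms Quotient3_rel[OF Quotient3_cstar, of X Y] by (simp add: seq_equiv_def)

lemma abs_cstar_zero: "0 = abs_cstar (\<lambda>n. 0)"
  and abs_cstar_one: "1 = abs_cstar (\<lambda>n. 1)"
  by (simp_all add: zero_cstar_def one_cstar_def)

lemma
  assumes "seq_cauchy full_norm X"
  shows abs_cstar_uminus: "- abs_cstar X = abs_cstar (\<lambda>n. - X n)"
    and abs_cstar_scale: "cstar_scale c (abs_cstar X) = abs_cstar (\<lambda>n. Poly_Mapping.single 0 c * X n)"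
    and abs_cstar_star: "cstar_star (abs_cstar X) = abs_cstar (\<lambda>n. galg_star (X n))"
  using assms
  by (auto simp: uminus_cstar.abs_eq cstar_scale.abs_eq cstar_star.abs_eq eq_onp_def seq_equiv_refl)

lemma
  assumes "seq_cauchy full_norm X" "seq_cauchy full_norm Y"
  shows abs_cstar_add: "abs_cstar X + abs_cstar Y = abs_cstar (\<lambda>n. X n + Y n)"
    and abs_cstar_mult: "abs_cstar X * abs_cstar Y = abs_cstar (\<lambda>n. X n * Y n)"
  using assms
  by (auto simp: plus_cstar.abs_eq times_cstar.abs_eq eq_onp_def seq_equiv_refl)

lemma seq_cauchy_scale:
  "seq_cauchy full_norm X \<Longrightarrow> seq_cauchy full_norm (\<lambda>n. Poly_Mapping.single 0 c * X n)"
  by (rule seq_cauchy_mult[OF seq_cauchy_const])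

lemma seq_cauchy_star:
  "seq_cauchy full_norm X \<Longrightarrow> seq_cauchy full_norm (\<lambda>n. galg_star (X n))"
  by (simp add: seq_cauchy_def full_norm_star_diff)

lemma cstar_norm_LIMSEQ:
  assumes "seq_cauchy full_norm X"
  shows "(\<lambda>n. full_norm (X n)) \<longlonglongrightarrow> cstar_norm (abs_cstar X)"
proof -
  have "cstar_norm (abs_cstar X) = lim (\<lambda>n. full_norm (X n))"
    by (rule cstar_norm.abs_eq) (simp add: seq_equiv_refl assms)
  then show ?thesis using seq_cauchy_norm_convergent[OF assms] by (simp add: convergent_LIMSEQ_iff)
qed

lemma cstar_norm_triangle: "cstar_norm (x + y) \<le> cstar_norm x + cstar_norm y"
proof -
  obtain X where X: "seq_cauchy full_norm X" "x = abs_cstar X" by (rule cstar_cases)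
  obtain Y where Y: "seq_cauchy full_norm Y" "y = abs_cstar Y" by (rule cstar_cases)
  show ?thesis
    unfolding X(2) Y(2) abs_cstar_add[OF X(1) Y(1)]
    by (rule LIMSEQ_le[OF cstar_norm_LIMSEQ[OF seq_cauchy_add[OF X(1) Y(1)]]
        tendsto_add[OF cstar_norm_LIMSEQ[OF X(1)] cstar_norm_LIMSEQ[OF Y(1)]]])
       (auto intro: full_norm_triangle)
qed

lemma cstar_norm_mult: "cstar_norm (x * y) \<le> cstar_norm x * cstar_norm y"
proof -
  obtain X where X: "seq_cauchy full_norm X" "x = abs_cstar X" by (rule cstar_cases)
  obtain Y where Y: "seq_cauchy full_norm Y" "y = abs_cstar Y" by (rule cstar_cases)
  show ?thesis
    unfolding X(2) Y(2) abs_cstar_mult[OF X(1) Y(1)]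
    by (rule LIMSEQ_le[OF cstar_norm_LIMSEQ[OF seq_cauchy_mult[OF X(1) Y(1)]]
        tendsto_mult[OF cstar_norm_LIMSEQ[OF X(1)] cstar_norm_LIMSEQ[OF Y(1)]]])
       (auto intro: full_norm_mult)
qed

lemma cstar_norm_scale: "cstar_norm (cstar_scale c x) = cmod c * cstar_norm x"
proof -
  obtain X where X: "seq_cauchy full_norm X" "x = abs_cstar X" by (rule cstar_cases)
  have "(\<lambda>n. cmod c * full_norm (X n)) \<longlonglongrightarrow> cstar_norm (cstar_scale c x)"
    using cstar_norm_LIMSEQ[OF seq_cauchy_scale[OF X(1)], of c]
    unfolding X(2) abs_cstar_scale[OF X(1)] by (simp add: full_norm_scale)
  moreover have "(\<lambda>n. cmod c * full_norm (X n)) \<longlonglongrightarrow> cmod c * cstar_norm x"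
    unfolding X(2) by (intro tendsto_mult_left cstar_norm_LIMSEQ X)
  ultimately show ?thesis by (rule LIMSEQ_unique)
qed

lemma cstar_norm_cstar: "cstar_norm (cstar_star x * x) = (cstar_norm x)\<^sup>2"
proof -
  obtain X where X: "seq_cauchy full_norm X" "x = abs_cstar X" by (rule cstar_cases)
  have "(\<lambda>n. (full_norm (X n))\<^sup>2) \<longlonglongrightarrow> cstar_norm (cstar_star x * x)"
    using cstar_norm_LIMSEQ[OF seq_cauchy_mult[OF seq_cauchy_star[OF X(1)] X(1)]]
    unfolding X(2) abs_cstar_star[OF X(1)] abs_cstar_mult[OF seq_cauchy_star[OF X(1)] X(1)]
    by (simp add: full_norm_cstar)
  moreover have "(\<lambda>n. (full_norm (X n))\<^sup>2) \<longlonglongrightarrow> (cstar_norm x)\<^sup>2"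
    unfolding X(2) by (intro tendsto_power cstar_norm_LIMSEQ X)
  ultimately show ?thesis by (rule LIMSEQ_unique)
qed

lemma cstar_norm_eq_0: "cstar_norm x = 0 \<longleftrightarrow> x = 0"
proof -
  obtain X where X: "seq_cauchy full_norm X" "x = abs_cstar X" by (rule cstar_cases)
  have "x = 0 \<longleftrightarrow> (\<lambda>n. full_norm (X n)) \<longlonglongrightarrow> 0"
    unfolding X(2) abs_cstar_zero abs_cstar_eq_iff[OF X(1) seq_cauchy_const] by simp
  then show ?thesis
    using cstar_norm_LIMSEQ[OF X(1)] LIMSEQ_unique unfolding X(2) by auto
qed

lemma cstar_norm_one: "cstar_norm (1 :: 'g::group_add cstar) = 1"
proof -
  have "(\<lambda>n. full_norm (1 :: 'g \<Rightarrow>\<^sub>0 complex)) \<longlonglongrightarrow> cstar_norm (1 :: 'g cstar)"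
    unfolding abs_cstar_one by (rule cstar_norm_LIMSEQ[OF seq_cauchy_const])
  then show ?thesis
    using full_norm_single[of "0 :: 'g" 1] by (simp add: LIMSEQ_const_iff)
qed

lemma cstar_scale_add_right: "cstar_scale c (x + y) = cstar_scale c x + cstar_scale c y"
  by transfer (simp add: seq_equiv_refl distrib_left seq_cauchy_scale seq_cauchy_add)

lemma cstar_scale_add_left: "cstar_scale (c + d) x = cstar_scale c x + cstar_scale d x"
  by transfer (simp add: seq_equiv_refl single_add distrib_right seq_cauchy_scale seq_cauchy_add)

lemma cstar_scale_scale: "cstar_scale c (cstar_scale d x) = cstar_scale (c * d) x"
  by transfer (simp add: seq_equiv_refl mult.assoc[symmetric] mult_single seq_cauchy_scale)

lemma cstar_scale_one: "cstar_scale 1 x = x"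
  by transfer (simp add: seq_equiv_refl)

lemma cstar_scale_mult_left: "cstar_scale c x * y = cstar_scale c (x * y)"
  by transfer (simp add: seq_equiv_refl mult.assoc seq_cauchy_scale seq_cauchy_mult)

lemma single_0_commute: "f * Poly_Mapping.single 0 c = Poly_Mapping.single 0 c * f"
  for f :: "'g::group_add \<Rightarrow>\<^sub>0 complex"
  by (induction f rule: galg_induct) (simp_all add: distrib_left distrib_right mult_single mult.commute)

lemma cstar_scale_mult_right: "x * cstar_scale c y = cstar_scale c (x * y)"
proof transfer
  fix X Y :: "nat \<Rightarrow> 'a \<Rightarrow>\<^sub>0 complex" and c
  assume "seq_equiv full_norm X X" "seq_equiv full_norm Y Y"
  moreover have "X n * (Poly_Mapping.single 0 c * Y n) = Poly_Mapping.single 0 c * (X n * Y n)" for n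
    by (simp add: mult.assoc[symmetric] single_0_commute)
  ultimately show "seq_equiv full_norm (\<lambda>n. X n * (Poly_Mapping.single 0 c * Y n))
      (\<lambda>n. Poly_Mapping.single 0 c * (X n * Y n))"
    by (simp add: seq_equiv_refl seq_cauchy_scale seq_cauchy_mult)
qed

instantiation cstar :: (group_add) real_normed_algebra_1
begin

definition scaleR_cstar :: "real \<Rightarrow> 'a cstar \<Rightarrow> 'a cstar" where
  "scaleR_cstar r = cstar_scale (complex_of_real r)"
definition norm_cstar :: "'a cstar \<Rightarrow> real" where "norm_cstar = cstar_norm"
definition sgn_cstar :: "'a cstar \<Rightarrow> 'a cstar" where "sgn_cstar x = inverse (norm x) *\<^sub>R x"
definition dist_cstar :: "'a cstar \<Rightarrow> 'a cstar \<Rightarrow> real" where "dist_cstar x y = norm (x - y)"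
definition [code del]:
  "(uniformity :: ('a cstar \<times> 'a cstar) filter) = (INF e\<in>{0<..}. principal {(x, y). dist x y < e})"
definition [code del]:
  "open (U :: 'a cstar set) \<longleftrightarrow> (\<forall>x\<in>U. \<forall>\<^sub>F (x', y) in uniformity. x' = x \<longrightarrow> y \<in> U)"

instance
proof
  fix x y z :: "'a cstar" and r s :: real
  show "r *\<^sub>R (x + y) = r *\<^sub>R x + r *\<^sub>R y"
    by (simp add: scaleR_cstar_def cstar_scale_add_right)
  show "(r + s) *\<^sub>R x = r *\<^sub>R x + s *\<^sub>R x"
    by (simp add: scaleR_cstar_def cstar_scale_add_left)
  show "r *\<^sub>R s *\<^sub>R x = (r * s) *\<^sub>R x" by (simp add: scaleR_cstar_def cstar_scale_scale)
  show "1 *\<^sub>R x = x" by (simp add: scaleR_cstar_def cstar_scale_one)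
  show "r *\<^sub>R x * y = r *\<^sub>R (x * y)" by (simp add: scaleR_cstar_def cstar_scale_mult_left)
  show "x * r *\<^sub>R y = r *\<^sub>R (x * y)" by (simp add: scaleR_cstar_def cstar_scale_mult_right)
  show "dist x y = norm (x - y)" by (simp add: dist_cstar_def)
  show "sgn x = inverse (norm x) *\<^sub>R x" by (simp add: sgn_cstar_def)
  show "(uniformity :: ('a cstar \<times> 'a cstar) filter) =
      (INF e\<in>{0<..}. principal {(x, y). dist x y < e})"
    by (rule uniformity_cstar_def)
  show "open U \<longleftrightarrow> (\<forall>x\<in>U. \<forall>\<^sub>F (x', y) in uniformity. x' = x \<longrightarrow> y \<in> U)"
    for U :: "'a cstar set" by (rule open_cstar_def)
  show "norm x = 0 \<longleftrightarrow> x = 0" by (simp add: norm_cstar_def cstar_norm_eq_0)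
  show "norm (x + y) \<le> norm x + norm y" by (simp add: norm_cstar_def cstar_norm_triangle)
  show "norm (r *\<^sub>R x) = \<bar>r\<bar> * norm x"
    by (simp add: norm_cstar_def scaleR_cstar_def cstar_norm_scale)
  show "norm (x * y) \<le> norm x * norm y" by (simp add: norm_cstar_def cstar_norm_mult)
  show "norm (1 :: 'a cstar) = 1" by (simp add: norm_cstar_def cstar_norm_one)
qed

end

definition cstar_of :: "('g::group_add \<Rightarrow>\<^sub>0 complex) \<Rightarrow> 'g cstar" where
  "cstar_of f = abs_cstar (\<lambda>n. f)"

lemma norm_abs_cstar:
  "seq_cauchy full_norm X \<Longrightarrow> (\<lambda>n. full_norm (X n)) \<longlonglongrightarrow> norm (abs_cstar X)"
  by (simp add: norm_cstar_def cstar_norm_LIMSEQ)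

lemma abs_cstar_minus:
  assumes "seq_cauchy full_norm X" "seq_cauchy full_norm Y"
  shows "abs_cstar X - abs_cstar Y = abs_cstar (\<lambda>n. X n - Y n)"
proof -
  have "seq_cauchy full_norm (\<lambda>n. - Y n)"
    using seq_cauchy_scale[OF assms(2), of "- 1"] by (simp add: single_uminus)
  then show ?thesis
    using assms abs_cstar_add[of X "\<lambda>n. - Y n"]
    by (simp add: minus_cstar_def abs_cstar_uminus)
qed

lemma seq_cauchy_minus_const:
  "seq_cauchy full_norm X \<Longrightarrow> seq_cauchy full_norm (\<lambda>n. X n - f)"
  by (simp add: seq_cauchy_def)

lemma norm_cstar_of_minus: "norm (cstar_of f - cstar_of h) = full_norm (f - h)"
  using norm_abs_cstar[OF seq_cauchy_const, of "f - h"]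
  by (simp add: cstar_of_def abs_cstar_minus[OF seq_cauchy_const seq_cauchy_const] LIMSEQ_const_iff)

lemma cstar_of_LIMSEQ:
  assumes X: "seq_cauchy full_norm X"
  shows "(\<lambda>n. cstar_of (X n)) \<longlonglongrightarrow> abs_cstar X"
proof (rule LIMSEQ_I)
  fix e :: real assume "e > 0"
  then obtain N where N: "\<And>m n. m \<ge> N \<Longrightarrow> n \<ge> N \<Longrightarrow> full_norm (X m - X n) < e / 2"
    using seq_cauchyD[OF X, of "e / 2"] by auto
  have "norm (cstar_of (X n) - abs_cstar X) < e" if "n \<ge> N" for n
  proof -
    have "(\<lambda>m. full_norm (X m - X n)) \<longlonglongrightarrow> norm (abs_cstar X - cstar_of (X n))"
      using norm_abs_cstar[OF seq_cauchy_minus_const[OF X]]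
      by (simp add: cstar_of_def abs_cstar_minus[OF X seq_cauchy_const])
    then have "norm (abs_cstar X - cstar_of (X n)) \<le> e / 2"
      by (rule LIMSEQ_le_const2) (use N[OF _ that] less_imp_le in blast)
    then show ?thesis using \<open>e > 0\<close> by (simp add: norm_minus_commute)
  qed
  then show "\<exists>N. \<forall>n\<ge>N. norm (cstar_of (X n) - abs_cstar X) < e" by blast
qed

instance cstar :: (group_add) banach
proof
  fix x :: "nat \<Rightarrow> 'a cstar"
  assume x: "Cauchy x"
  have "\<exists>f. norm (x n - cstar_of f) < 1 / Suc n" for n
  proof -
    obtain X where X: "seq_cauchy full_norm X" "x n = abs_cstar X" by (rule cstar_cases)
    have "\<exists>N. \<forall>k\<ge>N. norm (cstar_of (X k) - x n) < 1 / Suc n"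
      unfolding X(2) by (rule LIMSEQ_D[OF cstar_of_LIMSEQ[OF X(1)]]) simp
    then obtain k where "norm (cstar_of (X k) - x n) < 1 / Suc n" by blast
    then have "norm (x n - cstar_of (X k)) < 1 / Suc n"
      by (subst norm_minus_commute)
    then show ?thesis ..
  qed
  then obtain F where F: "\<And>n. norm (x n - cstar_of (F n)) < 1 / Suc n" by metis
  have d: "(\<lambda>n. x n - cstar_of (F n)) \<longlonglongrightarrow> 0"
    by (rule Lim_null_comparison[OF _ LIMSEQ_inverse_real_of_nat])
       (use F less_imp_le in \<open>auto simp: inverse_eq_divide intro!: always_eventually\<close>)
  have "seq_cauchy full_norm F"
    unfolding seq_cauchy_def
  proof (intro allI impI)
    fix e :: real assume "e > 0"
    then have e: "e / 3 > 0" by simp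
    obtain N where N: "\<And>m n. m \<ge> N \<Longrightarrow> n \<ge> N \<Longrightarrow> norm (x m - x n) < e / 3"
      using CauchyD[OF x e] by blast
    obtain N' where N': "\<And>n. n \<ge> N' \<Longrightarrow> norm (x n - cstar_of (F n)) < e / 3"
      using LIMSEQ_D[OF d e] by auto
    have "full_norm (F m - F n) < e" if mn: "m \<ge> max N N'" "n \<ge> max N N'" for m n
    proof -
      have eq: "cstar_of (F m) - cstar_of (F n) =
          (x m - x n) + (x n - cstar_of (F n)) - (x m - cstar_of (F m))" by simp
      have "norm (cstar_of (F m) - cstar_of (F n)) \<le>
          norm (x m - x n) + norm (x n - cstar_of (F n)) + norm (x m - cstar_of (F m))"
        unfolding eq
        using norm_triangle_ineq[of "x m - x n" "x n - cstar_of (F n)"]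
          norm_triangle_ineq4[of "(x m - x n) + (x n - cstar_of (F n))" "x m - cstar_of (F m)"]
        by linarith
      then show ?thesis
        using N[of m n] N'[of m] N'[of n] mn by (simp add: norm_cstar_of_minus)
    qed
    then show "\<exists>N. \<forall>m\<ge>N. \<forall>n\<ge>N. full_norm (F m - F n) < e" by blast
  qed
  then have "(\<lambda>n. (x n - cstar_of (F n)) + cstar_of (F n)) \<longlonglongrightarrow> 0 + abs_cstar F"
    by (intro tendsto_add d cstar_of_LIMSEQ)
  then show "convergent x" by (auto simp: convergent_def)
qed

instantiation cstar :: (group_add) cstar_algebra
begin

definition scaleC_cstar :: "complex \<Rightarrow> 'a cstar \<Rightarrow> 'a cstar" where "scaleC_cstar = cstar_scale"
definition star_cstar :: "'a cstar \<Rightarrow> 'a cstar" where "star_cstar = cstar_star"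

instance
proof
  fix x y :: "'a cstar" and c d :: complex and r :: real
  note eq = seq_equiv_refl seq_cauchy_add seq_cauchy_mult seq_cauchy_scale seq_cauchy_star
  show "c *\<^sub>C (x + y) = c *\<^sub>C x + c *\<^sub>C y"
    by (simp add: scaleC_cstar_def cstar_scale_add_right)
  show "(c + d) *\<^sub>C x = c *\<^sub>C x + d *\<^sub>C x"
    by (simp add: scaleC_cstar_def cstar_scale_add_left)
  show "c *\<^sub>C d *\<^sub>C x = (c * d) *\<^sub>C x" by (simp add: scaleC_cstar_def cstar_scale_scale)
  show "r *\<^sub>R x = complex_of_real r *\<^sub>C x" by (simp add: scaleC_cstar_def scaleR_cstar_def)
  show "norm (c *\<^sub>C x) = cmod c * norm x"
    by (simp add: scaleC_cstar_def norm_cstar_def cstar_norm_scale)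
  show "c *\<^sub>C x * y = c *\<^sub>C (x * y)" by (simp add: scaleC_cstar_def cstar_scale_mult_left)
  show "x * c *\<^sub>C y = c *\<^sub>C (x * y)" by (simp add: scaleC_cstar_def cstar_scale_mult_right)
  show "star (x + y) = star x + star y"
    unfolding star_cstar_def by transfer (simp add: eq galg_star_add)
  show "star (c *\<^sub>C x) = cnj c *\<^sub>C star x"
    unfolding star_cstar_def scaleC_cstar_def
    by transfer (simp add: eq galg_star_mult galg_star_single single_0_commute)
  show "star (x * y) = star y * star x"
    unfolding star_cstar_def by transfer (simp add: eq galg_star_mult)
  show "star (star x) = x"
    unfolding star_cstar_def by transfer (simp add: eq galg_star_star)
  show "norm (star x * x) = (norm x)\<^sup>2"
    by (simp add: norm_cstar_def star_cstar_def cstar_norm_cstar)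
qed

end

definition delta :: "'g::group_add \<Rightarrow> 'g cstar" where
  "delta g = cstar_of (Poly_Mapping.single g 1)"

section \<open>Algebraic dynamical systems\<close>

class right_LCM_monoid = monoid_mult +
  assumes left_cancel: "p * q = p * r \<Longrightarrow> q = r"
    and right_LCM: "range ((*) p) \<inter> range ((*) q) = {} \<or>
      (\<exists>r. range ((*) p) \<inter> range ((*) q) = range ((*) r))"

locale algebraic_dynamical_system =
  fixes \<theta> :: "'p::{right_LCM_monoid, countable} \<Rightarrow> 'g::{group_add, countable} \<Rightarrow> 'g"
  assumes theta_hom: "\<theta> p (g + h) = \<theta> p g + \<theta> p h"
    and theta_inj: "inj (\<theta> p)"
    and theta_one: "\<theta> 1 = id"
    and theta_mult: "\<theta> (p * q) = \<theta> p \<circ> \<theta> q"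
    and theta_inter: "range ((*) p) \<inter> range ((*) q) = range ((*) r) \<Longrightarrow>
      range (\<theta> p) \<inter> range (\<theta> q) = range (\<theta> r)"

section \<open>Hilbert bimodules and compact alignment\<close>

record ('a, 'm) hilbert_bimodule =
  mcarrier :: "'m set"
  mzero :: 'm
  madd :: "'m \<Rightarrow> 'm \<Rightarrow> 'm"
  mscale :: "complex \<Rightarrow> 'm \<Rightarrow> 'm"
  lact :: "'a \<Rightarrow> 'm \<Rightarrow> 'm"
  ract :: "'m \<Rightarrow> 'a \<Rightarrow> 'm"
  ip :: "'m \<Rightarrow> 'm \<Rightarrow> 'a"

definition mnorm :: "('a::cstar_algebra, 'm) hilbert_bimodule \<Rightarrow> 'm \<Rightarrow> real" where
  "mnorm M x = sqrt (norm (ip M x x))"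

definition mdist :: "('a::cstar_algebra, 'm) hilbert_bimodule \<Rightarrow> 'm \<Rightarrow> 'm \<Rightarrow> real" where
  "mdist M x y = mnorm M (madd M x (mscale M (- 1) y))"

text \<open>Operators on a module are extensional functions on its carrier.\<close>

definition adjointable :: "('a::cstar_algebra, 'm) hilbert_bimodule \<Rightarrow> ('m \<Rightarrow> 'm) set" where
  "adjointable M = {T \<in> mcarrier M \<rightarrow>\<^sub>E mcarrier M. \<exists>T' \<in> mcarrier M \<rightarrow>\<^sub>E mcarrier M.
     \<forall>x\<in>mcarrier M. \<forall>y\<in>mcarrier M. ip M (T x) y = ip M x (T' y)}"

definition rank_one :: "('a::cstar_algebra, 'm) hilbert_bimodule \<Rightarrow> 'm \<Rightarrow> 'm \<Rightarrow> 'm \<Rightarrow> 'm" where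
  "rank_one M \<xi> \<eta> = (\<lambda>\<mu>\<in>mcarrier M. ract M \<xi> (ip M \<eta> \<mu>))"

inductive_set rank_one_span :: "('a::cstar_algebra, 'm) hilbert_bimodule \<Rightarrow> ('m \<Rightarrow> 'm) set"
  for M where
  zero: "(\<lambda>\<mu>\<in>mcarrier M. mzero M) \<in> rank_one_span M"
| rank_one: "\<xi> \<in> mcarrier M \<Longrightarrow> \<eta> \<in> mcarrier M \<Longrightarrow> rank_one M \<xi> \<eta> \<in> rank_one_span M"
| add: "S \<in> rank_one_span M \<Longrightarrow> T \<in> rank_one_span M \<Longrightarrow>
    (\<lambda>\<mu>\<in>mcarrier M. madd M (S \<mu>) (T \<mu>)) \<in> rank_one_span M"
| scale: "T \<in> rank_one_span M \<Longrightarrow> (\<lambda>\<mu>\<in>mcarrier M. mscale M c (T \<mu>)) \<in> rank_one_span M"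

text \<open>The closure is with respect to the operator norm: the inequality below is \<open>\<parallel>T - S\<parallel> \<le> e\<close>.\<close>

definition compacts :: "('a::cstar_algebra, 'm) hilbert_bimodule \<Rightarrow> ('m \<Rightarrow> 'm) set" where
  "compacts M = {T \<in> adjointable M. \<forall>e>0. \<exists>S\<in>rank_one_span M.
     \<forall>\<mu>\<in>mcarrier M. mdist M (T \<mu>) (S \<mu>) \<le> e * mnorm M \<mu>}"

text \<open>
  A product system consists of its fibres \<open>fib p\<close> (the disjoint union is encoded by the index)
  and the multiplications \<open>mul p q\<close> from \<open>fib p \<times> fib q\<close> to \<open>fib (p * q)\<close>.
\<close>

record ('p, 'a, 'm) product_system =
  fib :: "'p \<Rightarrow> ('a, 'm) hilbert_bimodule"
  mul :: "'p \<Rightarrow> 'p \<Rightarrow> 'm \<Rightarrow> 'm \<Rightarrow> 'm"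

text \<open>
  \<open>iota M p r\<close> is \<open>\<iota>\<^sub>p\<^sup>r\<close>.  It is meaningful for \<open>r\<close> in \<open>pP\<close>, where left cancellation makes the
  \<open>s\<close> with \<open>r = p * s\<close> unique.
\<close>

definition iota :: "('p::right_LCM_monoid, 'a::cstar_algebra, 'm) product_system \<Rightarrow>
    'p \<Rightarrow> 'p \<Rightarrow> ('m \<Rightarrow> 'm) \<Rightarrow> ('m \<Rightarrow> 'm)" where
  "iota M p r T = (THE S. S \<in> adjointable (fib M r) \<and>
     (\<forall>s. r = p * s \<longrightarrow> (\<forall>\<xi>\<in>mcarrier (fib M p). \<forall>\<eta>\<in>mcarrier (fib M s).
        S (mul M p s \<xi> \<eta>) = mul M p s (T \<xi>) \<eta>)))"

definition compactly_aligned ::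
  "('p::right_LCM_monoid, 'a::cstar_algebra, 'm) product_system \<Rightarrow> bool" where
  "compactly_aligned M \<longleftrightarrow>
     (\<forall>p q r. range ((*) p) \<inter> range ((*) q) = range ((*) r) \<longrightarrow>
       (\<forall>S\<in>compacts (fib M p). \<forall>T\<in>compacts (fib M q).
          compose (mcarrier (fib M r)) (iota M p r S) (iota M q r T) \<in> compacts (fib M r)))"

section \<open>The product system of an algebraic dynamical system\<close>

text \<open>
  The next two maps are determined by their values on the \<open>\<delta>\<^sub>g\<close> and continuity, which is automatic
  for star homomorphisms and for positive linear maps.  Here \<open>t\<close> is some \<open>\<theta>\<^sub>p\<close>.
\<close>

definition alpha :: "('g::group_add \<Rightarrow> 'g) \<Rightarrow> 'g cstar \<Rightarrow> 'g cstar" where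
  "alpha t = (THE \<phi>. bounded_clinear \<phi> \<and> \<phi> 1 = 1 \<and> (\<forall>a b. \<phi> (a * b) = \<phi> a * \<phi> b) \<and>
     (\<forall>a. \<phi> (star a) = star (\<phi> a)) \<and> (\<forall>g. \<phi> (delta g) = delta (t g)))"

definition transfer_op :: "('g::group_add \<Rightarrow> 'g) \<Rightarrow> 'g cstar \<Rightarrow> 'g cstar" where
  "transfer_op t = (THE L. bounded_clinear L \<and>
     (\<forall>g. L (delta g) = (if g \<in> range t then delta (inv t g) else 0)))"

definition pre_norm :: "('g::group_add \<Rightarrow> 'g) \<Rightarrow> 'g cstar \<Rightarrow> real" where
  "pre_norm t a = sqrt (norm (transfer_op t (star a * a)))"

text \<open>
  \<open>M\<^sub>p\<close> is the Hausdorff completion of \<open>C*(G)\<close> in the seminorm \<open>\<parallel>a\<parallel>\<^sub>p = \<parallel>L\<^sub>p(a* a)\<parallel>\<^bsup>1/2\<^esup>\<close>, i.e. the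
  quotient by \<open>N\<^sub>p\<close> and the completion are taken in one step.  Its elements are the
  equivalence classes \<open>fibre_class t X\<close> of Cauchy sequences \<open>X\<close>; the quotient map \<open>\<pi>\<^sub>p\<close> sends \<open>a\<close>
  to the class of the constant sequence \<open>a\<close>.
\<close>

type_synonym 'g fibre_elem = "(nat \<Rightarrow> 'g cstar) set"

definition fibre_class :: "('g::group_add \<Rightarrow> 'g) \<Rightarrow> (nat \<Rightarrow> 'g cstar) \<Rightarrow> 'g fibre_elem" where
  "fibre_class t X = {Y. seq_equiv (pre_norm t) X Y}"

definition fibre_rep :: "'g::group_add fibre_elem \<Rightarrow> nat \<Rightarrow> 'g cstar" where
  "fibre_rep \<xi> = (SOME X. X \<in> \<xi>)"

definition fibre :: "('g::group_add \<Rightarrow> 'g) \<Rightarrow> ('g cstar, 'g fibre_elem) hilbert_bimodule" where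
  "fibre t = \<lparr>
     mcarrier = fibre_class t ` {X. seq_cauchy (pre_norm t) X},
     mzero = fibre_class t (\<lambda>n. 0),
     madd = (\<lambda>\<xi> \<eta>. fibre_class t (\<lambda>n. fibre_rep \<xi> n + fibre_rep \<eta> n)),
     mscale = (\<lambda>c \<xi>. fibre_class t (\<lambda>n. c *\<^sub>C fibre_rep \<xi> n)),
     lact = (\<lambda>a \<xi>. fibre_class t (\<lambda>n. a * fibre_rep \<xi> n)),
     ract = (\<lambda>\<xi> b. fibre_class t (\<lambda>n. fibre_rep \<xi> n * alpha t b)),
     ip = (\<lambda>\<xi> \<eta>. lim (\<lambda>n. transfer_op t (star (fibre_rep \<xi> n) * fibre_rep \<eta> n))) \<rparr>"

text \<open>
  The multiplication is the continuous extension of \<open>\<pi>\<^sub>p(a) \<pi>\<^sub>q(b) = \<pi>\<^bsub>pq\<^esub>(a \<alpha>\<^sub>p(b))\<close>, which for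
  \<open>a = \<delta>\<^sub>g\<close> and \<open>b = \<delta>\<^sub>h\<close> reads \<open>\<pi>\<^bsub>pq\<^esub>(\<delta>\<^bsub>g + \<theta>\<^sub>p(h)\<^esub>)\<close>.
\<close>

definition ads_product_system ::
  "('p::monoid_mult \<Rightarrow> 'g::group_add \<Rightarrow> 'g) \<Rightarrow> ('p, 'g cstar, 'g fibre_elem) product_system" where
  "ads_product_system \<theta> = \<lparr>
     fib = (\<lambda>p. fibre (\<theta> p)),
     mul = (\<lambda>p q \<xi> \<eta>. fibre_class (\<theta> (p * q))
       (\<lambda>n. fibre_rep \<xi> n * alpha (\<theta> p) (fibre_rep \<eta> n))) \<rparr>"

end

theory Submission
  imports Defs
begin

text \<open>
  For \<open>p\<close> in \<open>P\<close> let \<open>\<alpha>\<^sub>p\<close> and \<open>L\<^sub>p\<close> be the endomorphism and the transfer operator of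
  \<open>C*(G)\<close>.  On \<open>M\<^sub>p\<close>, the rank-one operator with entries \<open>\<pi>\<^sub>p(\<delta>\<^sub>g)\<close> and \<open>\<pi>\<^sub>p(\<delta>\<^sub>h)\<close> is induced by
  the map \<open>x \<mapsto> \<delta>\<^sub>g \<alpha>\<^sub>p(L\<^sub>p(\<delta>\<^sub>h* x))\<close> of \<open>C*(G)\<close>, which sends \<open>\<delta>\<^sub>k\<close> to \<open>\<delta>\<close> at \<open>g - h + k\<close> if \<open>k\<close>
  lies in the coset \<open>h + \<theta>\<^sub>p(G)\<close>, and to \<open>0\<close> otherwise.  So the product of such a map for \<open>p\<close> and
  such a map for \<open>q\<close> translates the \<open>\<delta>\<^sub>k\<close> with \<open>k\<close> in the intersection of a coset of \<open>\<theta>\<^sub>p(G)\<close> with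
  a coset of \<open>\<theta>\<^sub>q(G)\<close> and kills the others.  If \<open>pP \<inter> qP = rP\<close>, the intersection is empty or a
  coset of \<open>\<theta>\<^sub>p(G) \<inter> \<theta>\<^sub>q(G) = \<theta>\<^sub>r(G)\<close>, and the product is zero or a map of the same kind for \<open>r\<close>
  (\<open>elem_op_composition\<close>).  This is where the hypothesis on the ranges of \<open>\<theta>\<close> enters.

  The rest is continuity.  These elementary maps span a dense subspace of the compact operators
  (\<open>compact_ext_op\<close>), and \<open>\<iota>\<close> should be given by the same maps of \<open>C*(G)\<close>: for \<open>r = ps\<close> the
  modules \<open>M\<^sub>p\<close> and \<open>M\<^sub>r\<close> are completions of the same space \<open>C*(G)\<close>, for the forms \<open>L\<^sub>p(a* b)\<close> and
  \<open>L\<^sub>r(a* b) = L\<^sub>s(L\<^sub>p(a* b))\<close>.  What has to be shown is that a map with an adjoint for the first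
  form that is bounded by \<open>C\<close> on \<open>M\<^sub>p\<close> is also bounded by \<open>C\<close> on \<open>M\<^sub>r\<close> (\<open>op_bound_comp\<close>).  This is
  usually deduced from positivity in matrix algebras over \<open>C*(G)\<close>; here it follows from the
  Cauchy-Schwarz inequality alone, applied to the powers \<open>R\<^sup>1, R\<^sup>2, R\<^sup>4, \<dots>\<close> of \<open>R = F* F\<close>
  (\<open>doubling_bound\<close>).  A compact operator on \<open>M\<^sub>p\<close> is thus represented by a sequence of elementary
  combinations that is Cauchy in the operator norm, its image under \<open>\<iota>\<close> by the same sequence read on
  \<open>M\<^sub>r\<close> (\<open>iota_ext_op\<close>), and products are formed term by term.

  That \<open>L\<^sub>p\<close> is bounded and satisfies \<open>\<parallel>L\<^sub>p(a* b)\<parallel>\<^sup>2 \<le> \<parallel>L\<^sub>p(a* a)\<parallel> \<parallel>L\<^sub>p(b* b)\<parallel>\<close> comes from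
  induced representations: a unitary representation of \<open>G\<close>, transported to the subgroup \<open>\<theta>\<^sub>p(G)\<close> and
  induced up to \<open>G\<close>, has the original representation of \<open>L\<^sub>p(f)\<close> as a corner of that of \<open>f\<close>
  (\<open>induced_rep\<close>, \<open>compress_induced\<close>).
\<close>

section \<open>Block decompositions of the Hilbert space\<close>

lemma ell2_eqI: "(\<And>n. ell2_nth x n = ell2_nth y n) \<Longrightarrow> x = y"
  by (simp add: ell2_nth_inject[symmetric] fun_eq_iff)

lemma ell2_norm_has_sum: "((\<lambda>n. (cmod (ell2_nth x n))\<^sup>2) has_sum (norm x)\<^sup>2) UNIV"
proof -
  have s: "summable (\<lambda>n. (cmod (ell2_nth x n))\<^sup>2)"
    using ell2_nth[of x] by simp
  have "(norm x)\<^sup>2 = x \<bullet> x" by (simp add: power2_norm_eq_inner)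
  also have "\<dots> = suminf (\<lambda>n. (cmod (ell2_nth x n))\<^sup>2)"
    by (simp add: inner_ell2.rep_eq power2_norm_eq_inner[symmetric])
  finally show ?thesis
    using sums_nonneg_imp_has_sum[OF summable_sums[OF s]] by simp
qed

text \<open>
  Splitting the index set as \<open>'k \<times> \<nat>\<close> exhibits \<open>\<ell>\<^sup>2(\<nat>)\<close> as the Hilbert sum of copies of itself
  indexed by \<open>'k\<close>.  The induced representation can then act on the same space as the given one, as
  the definition of the universal norm demands.
\<close>

definition flat :: "'k::countable \<times> nat \<Rightarrow> nat" where
  "flat = to_nat_on UNIV"

lemma bij_flat: "bij (flat :: 'k::countable \<times> nat \<Rightarrow> nat)"
proof -
  have "infinite (UNIV :: ('k \<times> nat) set)"
    by (simp add: finite_prod)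
  then show ?thesis
    unfolding flat_def by (intro to_nat_on_infinite) auto
qed

definition block :: "'k::countable \<Rightarrow> ell2 \<Rightarrow> ell2" where
  "block k x = Abs_ell2 (\<lambda>n. ell2_nth x (flat (k, n)))"

definition glue :: "('k::countable \<Rightarrow> ell2) \<Rightarrow> ell2" where
  "glue y = Abs_ell2 (\<lambda>m. case inv flat m of (k, n) \<Rightarrow> ell2_nth (y k) n)"

lemma flat_has_sum:
  "((\<lambda>(k::'k::countable, n). (cmod (ell2_nth x (flat (k, n))))\<^sup>2) has_sum (norm x)\<^sup>2) UNIV"
  using has_sum_reindex_bij_betw[OF bij_flat[where 'k = 'k], of "\<lambda>n. (cmod (ell2_nth x n))\<^sup>2"]
    ell2_norm_has_sum by (simp add: case_prod_unfold)

lemma ell2_nth_block: "ell2_nth (block k x) n = ell2_nth x (flat (k, n))"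
proof -
  have "(\<lambda>(k, n). (cmod (ell2_nth x (flat (k, n))))\<^sup>2) summable_on Pair k ` UNIV"
    by (rule summable_on_subset_banach[OF has_sum_imp_summable[OF flat_has_sum]]) simp
  then have "(\<lambda>n. (cmod (ell2_nth x (flat (k, n))))\<^sup>2) summable_on UNIV"
    by (subst (asm) summable_on_reindex) (auto simp: inj_on_def o_def)
  then have "summable (\<lambda>n. (cmod (ell2_nth x (flat (k, n))))\<^sup>2)"
    by (rule summable_on_imp_summable)
  then show ?thesis
    unfolding block_def by (subst Abs_ell2_inverse) auto
qed

lemma norm_blocks_has_sum: "((\<lambda>k::'k::countable. (norm (block k x))\<^sup>2) has_sum (norm x)\<^sup>2) UNIV"
proof (rule has_sum_SigmaD[where B = "\<lambda>_. UNIV"])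
  show "((\<lambda>(k::'k, n). (cmod (ell2_nth x (flat (k, n))))\<^sup>2) has_sum (norm x)\<^sup>2) (Sigma UNIV (\<lambda>_. UNIV))"
    using flat_has_sum by simp
next
  fix k :: 'k
  show "((\<lambda>n. case (k, n) of (k, n) \<Rightarrow> (cmod (ell2_nth x (flat (k, n))))\<^sup>2) has_sum
      (norm (block k x))\<^sup>2) UNIV"
    using ell2_norm_has_sum[of "block k x"] by (simp add: ell2_nth_block)
qed

lemma ell2_blocks_eqI:
  assumes "\<And>k::'k::countable. block k x = block k y"
  shows "x = y"
proof (rule ell2_eqI)
  fix m
  obtain k :: 'k and n where "m = flat (k, n)"
    using bij_flat by (metis bij_pointE surj_pair)
  then show "ell2_nth x m = ell2_nth y m"
    using assms[of k] by (metis ell2_nth_block)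
qed

lemma block_add: "block k (x + y) = block k x + block k y"
  by (rule ell2_eqI) (simp add: ell2_nth_block plus_ell2.rep_eq)

lemma block_scaleC: "block k (c *\<^sub>C x) = c *\<^sub>C block k x"
  by (rule ell2_eqI) (simp add: ell2_nth_block scaleC_ell2.rep_eq)

lemma block_glue:
  fixes y :: "'k::countable \<Rightarrow> ell2"
  assumes "(\<lambda>k. (norm (y k))\<^sup>2) summable_on UNIV"
  shows "block k (glue y) = y k"
proof -
  have "(\<lambda>(k, n). (cmod (ell2_nth (y k) n))\<^sup>2) summable_on Sigma UNIV (\<lambda>_. UNIV)"
    by (rule summable_on_SigmaI[OF _ assms]) (auto simp: ell2_norm_has_sum)
  then have "(\<lambda>z::'k \<times> nat. (cmod (case inv flat (flat z) of (k, n) \<Rightarrow> ell2_nth (y k) n))\<^sup>2)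
      summable_on UNIV"
    using bij_flat[where 'k = 'k] by (simp add: bij_is_inj case_prod_unfold)
  then have "(\<lambda>m. (cmod (case inv (flat :: 'k \<times> nat \<Rightarrow> nat) m of (k, n) \<Rightarrow> ell2_nth (y k) n))\<^sup>2)
      summable_on UNIV"
    using has_sum_reindex_bij_betw[OF bij_flat[where 'k = 'k],
        of "\<lambda>m. (cmod (case inv (flat :: 'k \<times> nat \<Rightarrow> nat) m of (k, n) \<Rightarrow> ell2_nth (y k) n))\<^sup>2"]
    unfolding summable_on_def by simp
  then have "summable (\<lambda>m. (cmod (case inv (flat :: 'k \<times> nat \<Rightarrow> nat) m of (k, n) \<Rightarrow> ell2_nth (y k) n))\<^sup>2)"
    by (rule summable_on_imp_summable)
  then have nth: "ell2_nth (glue y) = (\<lambda>m. case inv flat m of (k, n) \<Rightarrow> ell2_nth (y k) n)"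
    unfolding glue_def by (subst Abs_ell2_inverse) auto
  show ?thesis
    by (rule ell2_eqI) (simp add: ell2_nth_block nth bij_is_inj[OF bij_flat])
qed

lemma inner_blocks_has_sum:
  "((\<lambda>k::'k::countable. block k x \<bullet> block k y) has_sum (x \<bullet> y)) UNIV"
proof -
  have pol: "a \<bullet> b = 1/2 * ((norm (a + b))\<^sup>2 - (norm a)\<^sup>2 - (norm b)\<^sup>2)" for a b :: ell2
    by (simp add: power2_norm_eq_inner inner_add inner_commute)
  show ?thesis
    unfolding pol block_add[symmetric]
    unfolding diff_conv_add_uminus
    by (intro has_sum_cmult_right has_sum_add has_sum_uminusI norm_blocks_has_sum)
qed

definition single_block :: "'k::countable \<Rightarrow> ell2 \<Rightarrow> ell2" where
  "single_block j x = glue (\<lambda>k. if k = j then x else 0)"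

lemma block_single_block: "block k (single_block j x) = (if k = j then x else 0)"
  unfolding single_block_def
proof (rule block_glue)
  show "(\<lambda>k. (norm (if k = j then x else 0))\<^sup>2) summable_on UNIV"
    by (subst summable_on_cong_neutral[where T = "{j}" and g = "\<lambda>_. (norm x)\<^sup>2"]) auto
qed

lemma inner_single_block: "y \<bullet> single_block j x = block (j :: 'k::countable) y \<bullet> x"
proof -
  have "((\<lambda>k :: 'k. block k y \<bullet> block k (single_block j x)) has_sum (block j y \<bullet> x)) UNIV"
    by (rule has_sum_cong_neutral[where S = "{j}" and f = "\<lambda>_. block j y \<bullet> x", THEN iffD1])
       (auto simp: block_single_block intro!: has_sum_finiteI)
  then show ?thesis using has_sum_unique[OF inner_blocks_has_sum] by blast
qed

lemma norm_single_block: "norm (single_block j x) = norm x"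
proof -
  have "single_block j x \<bullet> single_block j x = x \<bullet> x"
    by (simp add: inner_single_block block_single_block)
  then show ?thesis by (simp add: norm_eq_sqrt_inner)
qed

lemma single_block_scaleC: "single_block (j :: 'k::countable) (c *\<^sub>C x) = c *\<^sub>C single_block j x"
  by (rule ell2_blocks_eqI[where 'k = 'k]) (simp add: block_scaleC block_single_block scaleC_zero_right)

text \<open>
  A monomial representation: \<open>\<sigma>\<close> permutes the blocks, and the cocycle \<open>c\<close> tells by which operator of
  \<open>v\<close> each block is twisted on the way.  As \<open>\<sigma> g k\<close> is the block that is moved to \<open>k\<close>, it is a
  right action.
\<close>

lemma unitary_rep_glue:
  fixes v :: "'h::group_add \<Rightarrow> ell2 \<Rightarrow> ell2" and \<sigma> :: "'g::group_add \<Rightarrow> 'k::countable \<Rightarrow> 'k"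
    and c :: "'g \<Rightarrow> 'k \<Rightarrow> 'h"
  assumes v: "unitary_rep v"
    and \<sigma>0: "\<And>k. \<sigma> 0 k = k" and \<sigma>add: "\<And>g h k. \<sigma> (g + h) k = \<sigma> h (\<sigma> g k)"
    and c0: "\<And>k. c 0 k = 0" and cadd: "\<And>g h k. c (g + h) k = c g k + c h (\<sigma> g k)"
  defines "u \<equiv> \<lambda>g x. glue (\<lambda>k. v (c g k) (block (\<sigma> g k) x))"
  shows "unitary_rep u" and "block k (u g x) = v (c g k) (block (\<sigma> g k) x)"
proof -
  have bij: "bij (\<sigma> g)" for g
  proof (rule o_bij)
    show "\<sigma> (- g) \<circ> \<sigma> g = id" "\<sigma> g \<circ> \<sigma> (- g) = id"
      using \<sigma>add[of g "- g"] \<sigma>add[of "- g" g] \<sigma>0 by (auto simp: fun_eq_iff)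
  qed
  have sum: "((\<lambda>k. (norm (v (c g k) (block (\<sigma> g k) x)))\<^sup>2) has_sum (norm x)\<^sup>2) UNIV" for g x
    using has_sum_reindex_bij_betw[OF bij[of g], of "\<lambda>k. (norm (block k x))\<^sup>2"] norm_blocks_has_sum
    by (simp add: unitary_rep_norm[OF v])
  have block_u: "block k (u g x) = v (c g k) (block (\<sigma> g k) x)" for k g x
    unfolding u_def by (rule block_glue) (rule has_sum_imp_summable[OF sum])
  then show "block k (u g x) = v (c g k) (block (\<sigma> g k) x)" .
  have norm: "norm (u g x) = norm x" for g x
  proof -
    have "(norm (u g x))\<^sup>2 = (norm x)\<^sup>2"
      using has_sum_unique[OF norm_blocks_has_sum[of "u g x"] sum[of g x, folded block_u]] .
    then show ?thesis by simp
  qed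
  have add: "u g (x + y) = u g x + u g y" for g x y
    by (rule ell2_blocks_eqI[where 'k = 'k])
       (simp add: block_u block_add linear_add[OF unitary_rep_linear[OF v]])
  have scale: "u g (a *\<^sub>C x) = a *\<^sub>C u g x" for g a x
    by (rule ell2_blocks_eqI[where 'k = 'k]) (simp add: block_u block_scaleC unitary_rep_scaleC[OF v])
  have "bounded_clinear (u g)" for g
    unfolding bounded_clinear_def
    by (auto intro!: bounded_linear_intro[of _ 1] simp: add scale scaleR_scaleC norm)
  moreover have "u 0 x = x" for x
    by (rule ell2_blocks_eqI[where 'k = 'k]) (simp add: block_u c0 \<sigma>0 unitary_rep_zero[OF v])
  moreover have "u (g + h) x = u g (u h x)" for g h x
    by (rule ell2_blocks_eqI[where 'k = 'k])
       (simp add: block_u cadd \<sigma>add unitary_rep_add[OF v])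
  ultimately show "unitary_rep u" by (simp add: unitary_rep_def norm)
qed

section \<open>Induced representations\<close>

locale inj_endo =
  fixes t :: "'g::{group_add, countable} \<Rightarrow> 'g"
  assumes hom: "t (g + h) = t g + t h"
    and inj: "inj t"
begin

lemma hom_zero [simp]: "t 0 = 0"
  using hom[of 0 0] add_left_imp_eq[of "t 0" "t 0" 0] by simp

lemma hom_uminus: "t (- g) = - t g"
  using hom[of "- g" g] by (simp add: eq_neg_iff_add_eq_0)

lemma inv_t [simp]: "inv t (t g) = g"
  by (simp add: inj)

lemma range_add: "a \<in> range t \<Longrightarrow> b \<in> range t \<Longrightarrow> a + b \<in> range t"
  by (auto simp: image_iff hom[symmetric])

lemma range_uminus: "a \<in> range t \<Longrightarrow> - a \<in> range t"
  by (auto simp: image_iff hom_uminus[symmetric])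

lemma uminus_range_iff: "- a \<in> range t \<longleftrightarrow> a \<in> range t"
  using range_uminus[of a] range_uminus[of "- a"] unfolding minus_minus by blast

lemma inv_add: "a \<in> range t \<Longrightarrow> b \<in> range t \<Longrightarrow> inv t (a + b) = inv t a + inv t b"
  by (auto simp: hom[symmetric])

lemma inv_zero: "inv t 0 = 0"
  using inv_t[of 0] by simp

text \<open>
  The coset \<open>t(G)\<close> itself is represented by \<open>0\<close>, so that block \<open>0\<close> of the induced representation
  carries the original one without conjugation.
\<close>

definition coset_rep :: "'g \<Rightarrow> 'g" where
  "coset_rep g = (if g \<in> range t then 0 else SOME x. - g + x \<in> range t)"

lemma coset_rep: "- g + coset_rep g \<in> range t"
proof (cases "g \<in> range t")
  case True
  then show ?thesis by (simp add: coset_rep_def range_uminus)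
next
  case False
  have "- g + (SOME x. - g + x \<in> range t) \<in> range t"
    by (rule someI[of _ g]) (use rangeI[of t 0] in simp)
  with False show ?thesis by (simp add: coset_rep_def)
qed

lemma coset_rep_cong:
  assumes "- g + h \<in> range t"
  shows "coset_rep g = coset_rep h"
proof -
  have 1: "- g + x \<in> range t \<longleftrightarrow> - h + x \<in> range t" for x
  proof
    assume "- g + x \<in> range t"
    from range_add[OF range_uminus[OF assms] this] show "- h + x \<in> range t"
      by (simp add: minus_add add.assoc del: add_uminus_conv_diff)
  next
    assume "- h + x \<in> range t"
    from range_add[OF assms this] show "- g + x \<in> range t" by (simp add: add.assoc)
  qed
  have "g \<in> range t \<longleftrightarrow> h \<in> range t"
    using 1[of 0] by (simp add: uminus_range_iff)
  then show ?thesis by (simp add: coset_rep_def 1)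
qed

lemma coset_rep_idem: "coset_rep (coset_rep g) = coset_rep g"
  using coset_rep_cong[OF coset_rep[of g]] by simp

lemma coset_rep_translate: "coset_rep (a + coset_rep g) = coset_rep (a + g)"
proof (rule sym, rule coset_rep_cong)
  show "- (a + g) + (a + coset_rep g) \<in> range t"
    using coset_rep[of g] by (simp add: minus_add add.assoc del: add_uminus_conv_diff)
qed

text \<open>
  The representation of \<open>G\<close> induced from the representation \<open>v \<circ> t\<^sup>-\<^sup>1\<close> of the subgroup \<open>t(G)\<close>, with
  \<open>\<iota>\<close> the inclusion of the block of the trivial coset.  Only its diagonal coefficients at that block
  matter: \<open>u g\<close> returns the block to itself exactly if \<open>g\<close> lies in \<open>t(G)\<close>.
\<close>

lemma induced_rep:
  assumes v: "unitary_rep v"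
  obtains u :: "'g \<Rightarrow> ell2 \<Rightarrow> ell2" and \<iota> :: "ell2 \<Rightarrow> ell2"
  where "unitary_rep u" "\<And>x. norm (\<iota> x) = norm x" "\<And>c x. \<iota> (c *\<^sub>C x) = c *\<^sub>C \<iota> x"
    "\<And>g x y. u g (\<iota> x) \<bullet> \<iota> y = (if g \<in> range t then v (inv t g) x \<bullet> y else 0)"
proof -
  \<comment> \<open>Blocks are indexed by all of \<open>G\<close>; those that do not belong to a representative are left alone.\<close>
  define \<sigma> where "\<sigma> g k = (if coset_rep k = k then coset_rep (- g + k) else k)" for g k
  define c where "c g k = (if coset_rep k = k then inv t (- k + g + coset_rep (- g + k)) else 0)" for g k
  have \<sigma>0: "\<sigma> 0 k = k" for k by (simp add: \<sigma>_def)
  have \<sigma>add: "\<sigma> (g + h) k = \<sigma> h (\<sigma> g k)" for g h k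
    by (simp add: \<sigma>_def coset_rep_idem coset_rep_translate minus_add add.assoc
      del: add_uminus_conv_diff)
  have c0: "c 0 k = 0" for k by (simp add: c_def inv_zero)
  have mem: "- k + g + coset_rep (- g + k) \<in> range t" for g k
    using coset_rep[of "- g + k"] by (simp add: minus_add add.assoc del: add_uminus_conv_diff)
  have cadd: "c (g + h) k = c g k + c h (\<sigma> g k)" for g h k
  proof (cases "coset_rep k = k")
    case True
    let ?l = "coset_rep (- g + k)"
    have "c g k + c h (\<sigma> g k) = inv t (- k + g + ?l) + inv t (- ?l + h + coset_rep (- h + ?l))"
      using True by (simp add: c_def \<sigma>_def coset_rep_idem)
    also have "\<dots> = inv t ((- k + g + ?l) + (- ?l + h + coset_rep (- h + ?l)))"
      by (rule inv_add[symmetric]) (rule mem)+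
    also have "\<dots> = c (g + h) k"
      using True by (simp add: c_def coset_rep_translate minus_add add.assoc
      del: add_uminus_conv_diff)
    finally show ?thesis by simp
  qed (simp add: c_def \<sigma>_def)
  note glue = unitary_rep_glue[of v \<sigma> c, OF v \<sigma>0 \<sigma>add c0 cadd]
  have rep0: "coset_rep 0 = 0" using rangeI[of t 0] by (simp add: coset_rep_def)
  have \<sigma>g0: "\<sigma> g 0 = 0 \<longleftrightarrow> g \<in> range t" for g
  proof
    assume "\<sigma> g 0 = 0"
    then show "g \<in> range t" using mem[of 0 g] by (simp add: \<sigma>_def rep0)
  next
    assume "g \<in> range t"
    then show "\<sigma> g 0 = 0" using range_uminus[of g] by (simp add: \<sigma>_def rep0 coset_rep_def)
  qed
  have cg0: "c g 0 = inv t g" if "g \<in> range t" for g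
  proof -
    have "coset_rep (- g) = 0" using range_uminus[OF that] by (simp add: coset_rep_def)
    then show ?thesis by (simp add: c_def rep0)
  qed
  show thesis
  proof (rule that[of _ "single_block (0 :: 'g)"])
    show "unitary_rep (\<lambda>g x. glue (\<lambda>k. v (c g k) (block (\<sigma> g k) x)))" by (rule glue(1))
    fix g x y
    have "v h 0 = 0" for h using linear_0[OF unitary_rep_linear[OF v]] .
    then show "glue (\<lambda>k. v (c g k) (block (\<sigma> g k) (single_block (0 :: 'g) x))) \<bullet> single_block (0 :: 'g) y
        = (if g \<in> range t then v (inv t g) x \<bullet> y else 0)"
      unfolding inner_single_block glue(2) by (simp add: block_single_block \<sigma>g0 cg0)
  qed (simp_all add: norm_single_block single_block_scaleC)
qed

end

section \<open>Bounded maps on the group C*-algebra\<close>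

lemma cstar_of_zero: "cstar_of 0 = 0"
  by (simp add: cstar_of_def abs_cstar_zero)

lemma cstar_of_add: "cstar_of (f + h) = cstar_of f + cstar_of h"
  by (simp add: cstar_of_def abs_cstar_add seq_cauchy_const)

lemma cstar_of_mult: "cstar_of (f * h) = cstar_of f * cstar_of h"
  by (simp add: cstar_of_def abs_cstar_mult seq_cauchy_const)

lemma cstar_of_star: "cstar_of (galg_star f) = star (cstar_of f)"
  by (simp add: cstar_of_def star_cstar_def abs_cstar_star seq_cauchy_const)

lemma cstar_of_scale: "cstar_of (Poly_Mapping.single 0 c * f) = c *\<^sub>C cstar_of f"
  by (simp add: cstar_of_def scaleC_cstar_def abs_cstar_scale seq_cauchy_const)

lemma norm_cstar_of: "norm (cstar_of f) = full_norm f"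
  using norm_cstar_of_minus[of f 0] by (simp add: cstar_of_zero)

lemma cstar_of_single: "cstar_of (Poly_Mapping.single g c) = c *\<^sub>C delta g"
  by (simp add: delta_def cstar_of_scale[symmetric] mult_single)

lemma delta_zero: "delta 0 = 1"
  by (simp add: delta_def cstar_of_def abs_cstar_one single_one)

lemma delta_add: "delta (g + h) = delta g * delta h"
  by (simp add: delta_def cstar_of_mult[symmetric] mult_single)

lemma star_delta: "star (delta g) = delta (- g)"
  by (simp add: delta_def cstar_of_star[symmetric] galg_star_single)

lemma norm_delta: "norm (delta g) = 1"
  by (simp add: delta_def norm_cstar_of full_norm_single)

lemma cstar_of_dense: "\<exists>F. (\<lambda>n. cstar_of (F n)) \<longlonglongrightarrow> x"
  by (rule cstar_cases[of x]) (use cstar_of_LIMSEQ in blast)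

lemma cstar_of_approx:
  assumes "e > 0"
  obtains f where "norm (x - cstar_of f) < e"
proof -
  obtain F where F: "(\<lambda>n. cstar_of (F n)) \<longlonglongrightarrow> x" using cstar_of_dense by blast
  obtain n where "norm (cstar_of (F n) - x) < e" using LIMSEQ_D[OF F assms] by blast
  then show thesis by (intro that[of "F n"]) (simp add: norm_minus_commute)
qed

lemma star_zero [simp]: "star (0 :: 'a::cstar_algebra) = 0"
  using star_add[of "0::'a" 0] by simp

lemma star_diff: "star (x - y :: 'a::cstar_algebra) = star x - star y"
  using star_add[of "x - y" y] by simp

lemma norm_star: "norm (star x :: 'a::cstar_algebra) = norm x"
proof -
  have le: "norm y \<le> norm (star y)" for y :: 'a
  proof (cases "y = 0")
    case False
    have "norm y * norm y \<le> norm (star y) * norm y"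
      using norm_mult_ineq[of "star y" y] by (simp add: cstar_identity power2_eq_square)
    then show ?thesis using False by simp
  qed simp
  show ?thesis using le[of x] le[of "star x"] by (simp add: star_star)
qed

lemma bounded_clinear_add: "bounded_clinear f \<Longrightarrow> f (x + y) = f x + f y"
  and bounded_clinear_diff: "bounded_clinear f \<Longrightarrow> f (x - y) = f x - f y"
  and bounded_clinear_zero: "bounded_clinear f \<Longrightarrow> f 0 = 0"
  and bounded_clinear_scaleC: "bounded_clinear f \<Longrightarrow> f (c *\<^sub>C x) = c *\<^sub>C f x"
  and bounded_clinear_tendsto: "bounded_clinear f \<Longrightarrow> (X \<longlonglongrightarrow> z) \<Longrightarrow> (\<lambda>n. f (X n)) \<longlonglongrightarrow> f z"
  by (auto simp: bounded_clinear_def linear_add linear_diff linear_0 bounded_linear.linear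
      intro: bounded_linear.tendsto)

lemma bounded_clinear_ident: "bounded_clinear (\<lambda>x. x)"
  by (simp add: bounded_clinear_def)

lemma bounded_clinear_zero_map: "bounded_clinear (\<lambda>x. 0)"
  by (simp add: bounded_clinear_def scaleC_zero_right)

lemma bounded_clinear_plus:
  "bounded_clinear f \<Longrightarrow> bounded_clinear g \<Longrightarrow> bounded_clinear (\<lambda>x. f x + g x)"
  by (simp add: bounded_clinear_def bounded_linear_add scaleC_add_right)

lemma bounded_clinear_scale: "bounded_clinear f \<Longrightarrow> bounded_clinear (\<lambda>x. c *\<^sub>C f x)"
  by (auto simp: bounded_clinear_def scaleC_scaleC mult.commute
      intro: bounded_linear_compose[OF bounded_linear_scaleC])

lemma bounded_clinear_compose:
  "bounded_clinear f \<Longrightarrow> bounded_clinear g \<Longrightarrow> bounded_clinear (\<lambda>x. f (g x))"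
  by (simp add: bounded_clinear_def bounded_linear_compose)

lemma bounded_clinear_mult_right:
  "bounded_clinear f \<Longrightarrow> bounded_clinear (\<lambda>x. f x * (b :: 'a::cstar_algebra))"
  by (simp add: bounded_clinear_def mult_scaleC_left bounded_linear_mult_const)

lemma bounded_clinear_mult_left:
  "bounded_clinear f \<Longrightarrow> bounded_clinear (\<lambda>x. (b :: 'a::cstar_algebra) * f x)"
  by (simp add: bounded_clinear_def mult_scaleC_right bounded_linear_const_mult)

lemma bounded_clinear_star_conj:
  assumes "bounded_clinear (f :: 'a::cstar_algebra \<Rightarrow> 'b::cstar_algebra)"
  shows "bounded_clinear (\<lambda>x. star (f (star x)))"
proof -
  obtain K where K: "\<And>x. norm (f x) \<le> norm x * K"
    using assms bounded_linear.bounded unfolding bounded_clinear_def by blast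
  have sR: "star (r *\<^sub>R x) = r *\<^sub>R star x" for r and x :: 'a by (simp add: scaleR_scaleC star_scaleC)
  have sR': "star (r *\<^sub>R x) = r *\<^sub>R star x" for r and x :: 'b by (simp add: scaleR_scaleC star_scaleC)
  have fR: "f (r *\<^sub>R x) = r *\<^sub>R f x" for r x
    by (simp add: scaleR_scaleC bounded_clinear_scaleC[OF assms])
  have "bounded_linear (\<lambda>x. star (f (star x)))"
    by (rule bounded_linear_intro[of _ K])
       (use K[of "star x" for x] in
         \<open>simp_all add: star_add bounded_clinear_add[OF assms] sR sR' fR norm_star\<close>)
  then show ?thesis
    by (simp add: bounded_clinear_def star_scaleC bounded_clinear_scaleC[OF assms])
qed

lemmas bounded_clinear_intros = bounded_clinear_ident bounded_clinear_zero_map bounded_clinear_plus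
  bounded_clinear_scale bounded_clinear_mult_right bounded_clinear_mult_left

lemma bounded_clinear_eqI:
  fixes S T :: "'g::group_add cstar \<Rightarrow> 'b::complex_normed_vector"
  assumes S: "bounded_clinear S" and T: "bounded_clinear T" and eq: "\<And>g. S (delta g) = T (delta g)"
  shows "S x = T x"
proof -
  have fin: "S (cstar_of f) = T (cstar_of f)" for f
    by (induction f rule: galg_induct)
       (simp_all add: cstar_of_zero cstar_of_add cstar_of_single eq
         bounded_clinear_zero[OF S] bounded_clinear_zero[OF T] bounded_clinear_add[OF S]
         bounded_clinear_add[OF T] bounded_clinear_scaleC[OF S] bounded_clinear_scaleC[OF T])
  obtain F where F: "(\<lambda>n. cstar_of (F n)) \<longlonglongrightarrow> x" using cstar_of_dense by blast
  have "(\<lambda>n. T (cstar_of (F n))) \<longlonglongrightarrow> S x"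
    using bounded_clinear_tendsto[OF S F] by (simp add: fin)
  then show ?thesis using bounded_clinear_tendsto[OF T F] LIMSEQ_unique by blast
qed

text \<open>
  The linear extension of \<open>\<delta>\<^sub>g \<mapsto> w g\<close> to the group algebra.  Both \<open>\<alpha>\<close> and \<open>L\<close> are of this form, with
  \<open>w g\<close> a group element or zero.
\<close>

definition galg_lift :: "('g \<Rightarrow> 'g \<Rightarrow>\<^sub>0 complex) \<Rightarrow> ('g::group_add \<Rightarrow>\<^sub>0 complex) \<Rightarrow> ('g \<Rightarrow>\<^sub>0 complex)" where
  "galg_lift w f = (\<Sum>g\<in>Poly_Mapping.keys f. Poly_Mapping.single 0 (Poly_Mapping.lookup f g) * w g)"

lemma galg_lift_superset:
  assumes "finite A" "Poly_Mapping.keys f \<subseteq> A"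
  shows "galg_lift w f = (\<Sum>g\<in>A. Poly_Mapping.single 0 (Poly_Mapping.lookup f g) * w g)"
  unfolding galg_lift_def
  by (rule sum.mono_neutral_left) (use assms in \<open>auto simp: in_keys_iff\<close>)

lemma galg_lift_zero: "galg_lift w 0 = 0"
  by (simp add: galg_lift_def)

lemma galg_lift_add: "galg_lift w (f + h) = galg_lift w f + galg_lift w h"
proof -
  let ?A = "Poly_Mapping.keys f \<union> Poly_Mapping.keys h"
  have "galg_lift w (f + h) = (\<Sum>g\<in>?A. Poly_Mapping.single 0 (Poly_Mapping.lookup (f + h) g) * w g)"
    using Poly_Mapping.keys_add[of f h] by (intro galg_lift_superset) auto
  then show ?thesis
    by (simp add: galg_lift_superset[where A = ?A] lookup_add single_add distrib_right sum.distrib)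
qed

lemma galg_lift_single: "galg_lift w (Poly_Mapping.single k c) = Poly_Mapping.single 0 c * w k"
  by (cases "c = 0") (simp_all add: galg_lift_def)

lemma galg_lift_diff: "galg_lift w (f - h) = galg_lift w f - galg_lift w h"
  using galg_lift_add[of w "f - h" h] by simp

lemma galg_lift_scale:
  "galg_lift w (Poly_Mapping.single 0 c * f) = Poly_Mapping.single 0 c * galg_lift w f"
  by (induction f rule: galg_induct)
     (simp_all add: galg_lift_zero distrib_left mult_single galg_lift_add galg_lift_single
       mult.assoc[symmetric])

text \<open>
  The image of an approximating sequence in the group algebra is Cauchy, and its limit does not
  depend on the choice of the sequence, because the map is contractive.
\<close>

lemma galg_lift_extends:
  fixes w :: "'g \<Rightarrow> 'g::group_add \<Rightarrow>\<^sub>0 complex"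
  assumes bound: "\<And>f. full_norm (galg_lift w f) \<le> full_norm f"
  obtains \<Phi> where "bounded_clinear \<Phi>" "\<And>x. norm (\<Phi> x) \<le> norm x"
    "\<And>f. \<Phi> (cstar_of f) = cstar_of (galg_lift w f)"
proof -
  have lim: "\<exists>y. \<forall>F. (\<lambda>n. cstar_of (F n)) \<longlonglongrightarrow> x \<longrightarrow> (\<lambda>n. cstar_of (galg_lift w (F n))) \<longlonglongrightarrow> y" for x
  proof -
    have dist: "norm (cstar_of (galg_lift w f) - cstar_of (galg_lift w h)) \<le>
        norm (cstar_of f - cstar_of h)" for f h
      using bound[of "f - h"] by (simp add: norm_cstar_of_minus galg_lift_diff)
    obtain F where F: "(\<lambda>n. cstar_of (F n)) \<longlonglongrightarrow> x" using cstar_of_dense by blast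
    have "Cauchy (\<lambda>n. cstar_of (galg_lift w (F n)))"
    proof (rule CauchyI)
      fix e :: real assume "e > 0"
      then obtain N where "\<And>m n. m \<ge> N \<Longrightarrow> n \<ge> N \<Longrightarrow> norm (cstar_of (F m) - cstar_of (F n)) < e"
        using CauchyD[OF LIMSEQ_imp_Cauchy[OF F]] by blast
      then show "\<exists>N. \<forall>m\<ge>N. \<forall>n\<ge>N.
          norm (cstar_of (galg_lift w (F m)) - cstar_of (galg_lift w (F n))) < e"
        using dist order_le_less_trans by blast
    qed
    then obtain y where y: "(\<lambda>n. cstar_of (galg_lift w (F n))) \<longlonglongrightarrow> y"
      using Cauchy_convergent convergent_def by blast
    have "(\<lambda>n. cstar_of (galg_lift w (H n))) \<longlonglongrightarrow> y" if H: "(\<lambda>n. cstar_of (H n)) \<longlonglongrightarrow> x" for H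
    proof -
      have "(\<lambda>n. cstar_of (H n) - cstar_of (F n)) \<longlonglongrightarrow> 0" using tendsto_diff[OF H F] by simp
      then have "(\<lambda>n. cstar_of (galg_lift w (H n)) - cstar_of (galg_lift w (F n))) \<longlonglongrightarrow> 0"
        by (rule Lim_null_comparison[OF always_eventually[OF allI[OF dist]] tendsto_norm_zero])
      from tendsto_add[OF this y] show ?thesis by simp
    qed
    then show ?thesis by blast
  qed
  then obtain \<Phi> where \<Phi>: "\<And>x F. (\<lambda>n. cstar_of (F n)) \<longlonglongrightarrow> x \<Longrightarrow>
      (\<lambda>n. cstar_of (galg_lift w (F n))) \<longlonglongrightarrow> \<Phi> x"
    by metis
  show thesis
  proof (rule that[of \<Phi>])
    show norm: "norm (\<Phi> x) \<le> norm x" for x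
    proof -
      obtain F where F: "(\<lambda>n. cstar_of (F n)) \<longlonglongrightarrow> x" using cstar_of_dense by blast
      show ?thesis
        by (rule LIMSEQ_le[OF tendsto_norm[OF \<Phi>[OF F]] tendsto_norm[OF F]])
           (auto simp: norm_cstar_of bound)
    qed
    have add: "\<Phi> (x + y) = \<Phi> x + \<Phi> y" for x y
    proof -
      obtain F where F: "(\<lambda>n. cstar_of (F n)) \<longlonglongrightarrow> x" using cstar_of_dense by blast
      obtain H where H: "(\<lambda>n. cstar_of (H n)) \<longlonglongrightarrow> y" using cstar_of_dense by blast
      have "(\<lambda>n. cstar_of (F n + H n)) \<longlonglongrightarrow> x + y"
        using tendsto_add[OF F H] by (simp add: cstar_of_add)
      from \<Phi>[OF this] tendsto_add[OF \<Phi>[OF F] \<Phi>[OF H]] show ?thesis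
        by (simp add: galg_lift_add cstar_of_add LIMSEQ_unique)
    qed
    have scale: "\<Phi> (c *\<^sub>C x) = c *\<^sub>C \<Phi> x" for c x
    proof -
      obtain F where F: "(\<lambda>n. cstar_of (F n)) \<longlonglongrightarrow> x" using cstar_of_dense by blast
      note s = bounded_linear.tendsto[OF bounded_linear_scaleC[of c]]
      have "(\<lambda>n. cstar_of (Poly_Mapping.single 0 c * F n)) \<longlonglongrightarrow> c *\<^sub>C x"
        using s[OF F] by (simp add: cstar_of_scale)
      from \<Phi>[OF this] s[OF \<Phi>[OF F]] show ?thesis
        by (simp add: galg_lift_scale cstar_of_scale LIMSEQ_unique)
    qed
    show "bounded_clinear \<Phi>"
      unfolding bounded_clinear_def
      by (auto intro!: bounded_linear_intro[of _ 1] simp: add scale scaleR_scaleC norm)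
    show "\<Phi> (cstar_of f) = cstar_of (galg_lift w f)" for f
      using \<Phi>[of "\<lambda>_. f" "cstar_of f"] by (simp add: LIMSEQ_const_iff)
  qed
qed

section \<open>The endomorphism and the transfer operator\<close>

lemma tendsto_star: "(X \<longlonglongrightarrow> x) \<Longrightarrow> (\<lambda>n. star (X n :: 'a::cstar_algebra)) \<longlonglongrightarrow> star x"
  by (simp add: tendsto_iff dist_norm star_diff[symmetric] norm_star)

lemma bounded_clinear_eqI2:
  fixes B B' :: "'g::group_add cstar \<Rightarrow> 'g cstar \<Rightarrow> 'b::complex_normed_vector"
  assumes "\<And>b. bounded_clinear (\<lambda>a. B a b)" "\<And>a. bounded_clinear (B a)"
    and "\<And>b. bounded_clinear (\<lambda>a. B' a b)" "\<And>a. bounded_clinear (B' a)"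
    and eq: "\<And>g h. B (delta g) (delta h) = B' (delta g) (delta h)"
  shows "B a b = B' a b"
proof -
  have "B a (delta h) = B' a (delta h)" for h
    by (rule bounded_clinear_eqI[where S = "\<lambda>a. B a (delta h)" and T = "\<lambda>a. B' a (delta h)"])
       (rule assms)+
  then show ?thesis by (rule bounded_clinear_eqI[OF assms(2) assms(4)])
qed

lemma galg_rep_contraction:
  assumes "unitary_rep u" shows "norm (galg_rep u f x) \<le> full_norm f * norm x"
  using onorm[OF bounded_linear_galg_rep[OF assms], of f x] full_norm_upper[OF assms, of f]
    mult_right_mono[of _ _ "norm x"] norm_ge_zero order_trans by blast

context inj_endo
begin

abbreviation \<alpha> where "\<alpha> \<equiv> alpha t"
abbreviation L where "L \<equiv> transfer_op t"
abbreviation \<nu> where "\<nu> \<equiv> pre_norm t"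

abbreviation "push \<equiv> \<lambda>g. Poly_Mapping.single (t g) (1 :: complex)"
abbreviation "pull \<equiv> \<lambda>g. if g \<in> range t then Poly_Mapping.single (inv t g) (1 :: complex) else 0"

text \<open>
  A unitary representation of \<open>G\<close> composed with \<open>t\<close> is another one.
\<close>

lemma full_norm_push: "full_norm (galg_lift push f) \<le> full_norm f"
proof (rule full_norm_least)
  fix u :: "'g \<Rightarrow> ell2 \<Rightarrow> ell2" assume u: "unitary_rep u"
  have ut: "unitary_rep (\<lambda>g. u (t g))"
    using u by (simp add: unitary_rep_def hom)
  have "galg_rep u (galg_lift push f) x = galg_rep (\<lambda>g. u (t g)) f x" for x
    by (induction f rule: galg_induct)
       (simp_all add: galg_lift_zero galg_lift_add galg_lift_single galg_rep_zero galg_rep_add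
         galg_rep_single mult_single)
  then have "galg_rep u (galg_lift push f) = galg_rep (\<lambda>g. u (t g)) f" by (rule ext)
  then show "onorm (galg_rep u (galg_lift push f)) \<le> full_norm f"
    using full_norm_upper[OF ut] by simp
qed

text \<open>
  The extension of the map on the group algebra has the properties that characterise \<open>\<alpha>\<close>, and a
  bounded linear map is determined by its values on the \<open>\<delta>\<^sub>g\<close>.
\<close>

lemma alpha_props:
  shows bounded_clinear_alpha: "bounded_clinear \<alpha>"
    and alpha_one: "\<alpha> 1 = 1"
    and alpha_mult: "\<alpha> (a * b) = \<alpha> a * \<alpha> b"
    and alpha_star: "\<alpha> (star a) = star (\<alpha> a)"
    and alpha_delta: "\<alpha> (delta g) = delta (t g)"
proof -
  obtain \<Phi> where \<Phi>: "bounded_clinear \<Phi>" "\<And>x. norm (\<Phi> x) \<le> norm x"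
    "\<And>f. \<Phi> (cstar_of f) = cstar_of (galg_lift push f)"
    by (rule galg_lift_extends[of push, OF full_norm_push]) (rule that)
  have \<Phi>d: "\<Phi> (delta g) = delta (t g)" for g
    unfolding delta_def by (simp add: \<Phi>(3) galg_lift_single mult_single)
  have "\<Phi> (a * b) = \<Phi> a * \<Phi> b" for a b
    by (rule bounded_clinear_eqI2[where B = "\<lambda>a b. \<Phi> (a * b)" and B' = "\<lambda>a b. \<Phi> a * \<Phi> b"])
       (auto intro!: bounded_clinear_intros bounded_clinear_compose[OF \<Phi>(1)] \<Phi>(1)
         simp: \<Phi>d delta_add[symmetric] hom)
  moreover have "\<Phi> (star a) = star (\<Phi> a)" for a
  proof -
    have "\<Phi> a = star (\<Phi> (star a))"
      by (rule bounded_clinear_eqI[OF \<Phi>(1) bounded_clinear_star_conj[OF \<Phi>(1)]])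
         (simp add: \<Phi>d star_delta hom_uminus)
    then show ?thesis by (simp add: star_star)
  qed
  moreover have "\<Phi> 1 = 1"
    using \<Phi>d[of 0] by (simp add: delta_zero)
  ultimately have ex: "bounded_clinear \<Phi> \<and> \<Phi> 1 = 1 \<and> (\<forall>a b. \<Phi> (a * b) = \<Phi> a * \<Phi> b) \<and>
     (\<forall>a. \<Phi> (star a) = star (\<Phi> a)) \<and> (\<forall>g. \<Phi> (delta g) = delta (t g))"
    using \<Phi>(1) \<Phi>d by blast
  have "\<alpha> = \<Phi>"
    unfolding alpha_def
  proof (rule the_equality, rule ex)
    fix \<Psi>
    assume "bounded_clinear \<Psi> \<and> \<Psi> 1 = 1 \<and> (\<forall>a b. \<Psi> (a * b) = \<Psi> a * \<Psi> b) \<and>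
      (\<forall>a. \<Psi> (star a) = star (\<Psi> a)) \<and> (\<forall>g. \<Psi> (delta g) = delta (t g))"
    then show "\<Psi> = \<Phi>"
      using bounded_clinear_eqI[OF _ \<Phi>(1), of \<Psi>] \<Phi>d by fastforce
  qed
  with ex show "bounded_clinear \<alpha>" "\<alpha> 1 = 1" "\<alpha> (a * b) = \<alpha> a * \<alpha> b" "\<alpha> (star a) = star (\<alpha> a)"
    "\<alpha> (delta g) = delta (t g)" by simp_all
qed

text \<open>
  The coefficients are linear in \<open>f\<close>, so the case of a single group element decides.  As \<open>pull\<close>
  describes \<open>L\<close>, this turns norm estimates for \<open>L(f)\<close> into Hilbert space estimates for \<open>u\<close>.
\<close>

lemma compress_induced:
  assumes "unitary_rep u" "\<And>c x. \<iota> (c *\<^sub>C x) = c *\<^sub>C \<iota> x"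
    and coeff: "\<And>g x y. u g (\<iota> x) \<bullet> \<iota> y = (if g \<in> range t then v (inv t g) x \<bullet> y else 0)"
    and v: "unitary_rep v"
  shows "galg_rep u f (\<iota> x) \<bullet> \<iota> y = galg_rep v (galg_lift pull f) x \<bullet> y"
proof (induction f rule: galg_induct)
  case zero
  show ?case by (simp add: galg_rep_zero galg_lift_zero)
next
  case (single k c f)
  have "c *\<^sub>C u k (\<iota> x) \<bullet> \<iota> y = u k (\<iota> (c *\<^sub>C x)) \<bullet> \<iota> y"
    by (simp add: assms(2) unitary_rep_scaleC[OF assms(1)])
  also have "\<dots> = galg_rep v (galg_lift pull (Poly_Mapping.single k c)) x \<bullet> y"
    by (simp add: coeff galg_lift_single mult_single galg_rep_single galg_rep_zero
        unitary_rep_scaleC[OF v])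
  finally show ?case
    using single by (simp add: galg_rep_add galg_lift_add galg_rep_single inner_add_left)
qed

text \<open>
  In a representation \<open>v\<close> with induced representation \<open>u\<close>, the coefficient of \<open>L(f* h)\<close> at \<open>x\<close> and \<open>y\<close>
  is the inner product of \<open>u(h) \<iota> x\<close> and \<open>u(f) \<iota> y\<close>, and the square of the norm of \<open>u(f) \<iota> y\<close> is a
  coefficient of \<open>L(f* f)\<close>.  So both bounds are the Cauchy-Schwarz inequality of the Hilbert space on
  which \<open>u\<close> acts.
\<close>

lemma full_norm_pull: "full_norm (galg_lift pull f) \<le> full_norm f"
  and full_norm_pull_Cauchy_Schwarz:
    "full_norm (galg_lift pull (galg_star f * h)) \<le>
      sqrt (full_norm (galg_lift pull (galg_star f * f))) *
      sqrt (full_norm (galg_lift pull (galg_star h * h)))"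
proof -
  let ?L = "galg_lift pull"
  have *: "onorm (galg_rep v (?L f)) \<le> full_norm f \<and>
      onorm (galg_rep v (?L (galg_star f * h))) \<le>
        sqrt (full_norm (?L (galg_star f * f))) * sqrt (full_norm (?L (galg_star h * h)))"
    if v: "unitary_rep v" for v
  proof
    obtain u and \<iota> where u: "unitary_rep u" and \<iota>: "\<And>x. norm (\<iota> x) = norm x"
      "\<And>c x. \<iota> (c *\<^sub>C x) = c *\<^sub>C \<iota> x"
      "\<And>g x y. u g (\<iota> x) \<bullet> \<iota> y = (if g \<in> range t then v (inv t g) x \<bullet> y else 0)"
      by (rule induced_rep[OF v]) (rule that)
    note compress = compress_induced[OF u \<iota>(2,3) v]
    have bound: "onorm T \<le> c" if c: "c \<ge> 0" and T: "\<And>x y. T x \<bullet> y \<le> c * norm x * norm y"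
      for T :: "ell2 \<Rightarrow> ell2" and c
    proof (rule onorm_bound[OF c])
      fix x
      have "norm (T x) * norm (T x) \<le> c * norm x * norm (T x)"
        using T[of x "T x"] by (simp add: power2_norm_eq_inner[symmetric] power2_eq_square)
      then show "norm (T x) \<le> c * norm x"
        using c by (cases "norm (T x) = 0") (auto dest: mult_right_le_imp_le)
    qed
    show "onorm (galg_rep v (?L f)) \<le> full_norm f"
    proof (rule bound[OF full_norm_nonneg])
      fix x y
      have "galg_rep v (?L f) x \<bullet> y \<le> norm (galg_rep u f (\<iota> x)) * norm (\<iota> y)"
        unfolding compress[symmetric] by (rule norm_cauchy_schwarz)
      also have "\<dots> \<le> full_norm f * norm (\<iota> x) * norm (\<iota> y)"
        by (intro mult_right_mono galg_rep_contraction[OF u] norm_ge_zero)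
      finally show "galg_rep v (?L f) x \<bullet> y \<le> full_norm f * norm x * norm y" by (simp add: \<iota>)
    qed
    have column: "norm (galg_rep u f (\<iota> x)) \<le> sqrt (full_norm (?L (galg_star f * f))) * norm x" for f x
    proof (rule power2_le_imp_le)
      have "(norm (galg_rep u f (\<iota> x)))\<^sup>2 = galg_rep u (galg_star f * f) (\<iota> x) \<bullet> \<iota> x"
        by (simp add: power2_norm_eq_inner galg_rep_mult[OF u] galg_rep_inner[OF u] galg_star_star)
      also have "\<dots> \<le> norm (galg_rep v (?L (galg_star f * f)) x) * norm x"
        unfolding compress by (rule norm_cauchy_schwarz)
      also have "\<dots> \<le> full_norm (?L (galg_star f * f)) * norm x * norm x"
        by (intro mult_right_mono galg_rep_contraction[OF v] norm_ge_zero)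
      finally show "(norm (galg_rep u f (\<iota> x)))\<^sup>2 \<le>
          (sqrt (full_norm (?L (galg_star f * f))) * norm x)\<^sup>2"
        by (simp add: power_mult_distrib full_norm_nonneg power2_eq_square[of "norm x"] mult.assoc)
    qed (simp add: full_norm_nonneg)
    show "onorm (galg_rep v (?L (galg_star f * h))) \<le>
        sqrt (full_norm (?L (galg_star f * f))) * sqrt (full_norm (?L (galg_star h * h)))"
    proof (rule bound)
      fix x y
      have "galg_rep v (?L (galg_star f * h)) x \<bullet> y = galg_rep u h (\<iota> x) \<bullet> galg_rep u f (\<iota> y)"
        unfolding compress[symmetric]
        by (simp add: galg_rep_mult[OF u] galg_rep_inner[OF u, of "galg_star f"] galg_star_star)
      also have "\<dots> \<le> norm (galg_rep u h (\<iota> x)) * norm (galg_rep u f (\<iota> y))"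
        by (rule norm_cauchy_schwarz)
      also have "\<dots> \<le> (sqrt (full_norm (?L (galg_star h * h))) * norm x) *
          (sqrt (full_norm (?L (galg_star f * f))) * norm y)"
        by (intro mult_mono column) (simp_all add: full_norm_nonneg)
      finally show "galg_rep v (?L (galg_star f * h)) x \<bullet> y \<le>
          sqrt (full_norm (?L (galg_star f * f))) * sqrt (full_norm (?L (galg_star h * h))) *
          norm x * norm y" by (simp add: mult_ac)
    qed (simp add: full_norm_nonneg)
  qed
  then show "full_norm (?L f) \<le> full_norm f"
    "full_norm (?L (galg_star f * h)) \<le>
      sqrt (full_norm (?L (galg_star f * f))) * sqrt (full_norm (?L (galg_star h * h)))"
    by (blast intro: full_norm_least)+
qed

lemma transfer_props:
  shows bounded_clinear_L: "bounded_clinear L"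
    and L_delta: "L (delta g) = (if g \<in> range t then delta (inv t g) else 0)"
    and L_contraction: "norm (L a) \<le> norm a"
    and L_cstar_of: "L (cstar_of f) = cstar_of (galg_lift pull f)"
proof -
  obtain \<Phi> where \<Phi>: "bounded_clinear \<Phi>" "\<And>x. norm (\<Phi> x) \<le> norm x"
    "\<And>f. \<Phi> (cstar_of f) = cstar_of (galg_lift pull f)"
    by (rule galg_lift_extends[of pull, OF full_norm_pull]) (rule that)
  have \<Phi>d: "\<Phi> (delta g) = (if g \<in> range t then delta (inv t g) else 0)" for g
    unfolding delta_def by (simp add: \<Phi>(3) galg_lift_single mult_single cstar_of_zero)
  have "L = \<Phi>"
    unfolding transfer_op_def
  proof (rule the_equality)
    fix \<Psi>
    assume "bounded_clinear \<Psi> \<and> (\<forall>g. \<Psi> (delta g) = (if g \<in> range t then delta (inv t g) else 0))"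
    then show "\<Psi> = \<Phi>"
      using bounded_clinear_eqI[OF _ \<Phi>(1), of \<Psi>] \<Phi>d by fastforce
  qed (use \<Phi>(1) \<Phi>d in blast)
  then show "bounded_clinear L" "L (delta g) = (if g \<in> range t then delta (inv t g) else 0)"
    "norm (L a) \<le> norm a" "L (cstar_of f) = cstar_of (galg_lift pull f)"
    using \<Phi> \<Phi>d by simp_all
qed

lemmas alpha_add = bounded_clinear_add[OF bounded_clinear_alpha]
  and alpha_diff = bounded_clinear_diff[OF bounded_clinear_alpha]
  and alpha_scaleC = bounded_clinear_scaleC[OF bounded_clinear_alpha]
  and L_add = bounded_clinear_add[OF bounded_clinear_L]
  and L_diff = bounded_clinear_diff[OF bounded_clinear_L]
  and L_zero = bounded_clinear_zero[OF bounded_clinear_L]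
  and L_scaleC = bounded_clinear_scaleC[OF bounded_clinear_L]

text \<open>
  Both sides are bounded and linear once the conjugation is undone, so the \<open>\<delta>\<^sub>g\<close> decide.
\<close>

lemma L_star: "L (star a) = star (L a)"
proof -
  have "L a = star (L (star a))"
    by (rule bounded_clinear_eqI[OF bounded_clinear_L bounded_clinear_star_conj[OF bounded_clinear_L]])
       (auto simp: L_delta star_delta uminus_range_iff hom_uminus[symmetric])
  then show ?thesis by (simp add: star_star)
qed

lemma L_alpha_right: "L (a * \<alpha> b) = L a * b"
proof (rule bounded_clinear_eqI2[where B = "\<lambda>a b. L (a * \<alpha> b)" and B' = "\<lambda>a b. L a * b"])
  fix g h
  have "g + t h \<in> range t \<longleftrightarrow> g \<in> range t"
    using range_add[OF _ range_uminus[OF rangeI], of "g + t h" h] range_add[OF _ rangeI, of g h]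
    by (auto simp: add.assoc simp del: add_uminus_conv_diff)
  then show "L (delta g * \<alpha> (delta h)) = L (delta g) * delta h"
    by (simp add: alpha_delta delta_add[symmetric] L_delta inv_add)
qed (intro bounded_clinear_compose[OF bounded_clinear_L] bounded_clinear_intros
  bounded_clinear_L bounded_clinear_alpha)+

lemma L_alpha_left: "L (\<alpha> b * a) = b * L a"
proof -
  have "L (\<alpha> b * a) = star (L (star a * \<alpha> (star b)))"
    by (simp add: L_star[symmetric] star_mult star_star alpha_star)
  then show ?thesis by (simp add: L_alpha_right L_star star_mult star_star)
qed

section \<open>The seminorm of the fibre\<close>

lemma nu_nonneg [simp]: "\<nu> a \<ge> 0"
  by (simp add: pre_norm_def)

lemma nu_power2: "(\<nu> a)\<^sup>2 = norm (L (star a * a))"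
  by (simp add: pre_norm_def)

lemma L_Cauchy_Schwarz: "norm (L (star a * b)) \<le> \<nu> a * \<nu> b"
proof -
  obtain F where F: "(\<lambda>n. cstar_of (F n)) \<longlonglongrightarrow> a" using cstar_of_dense by blast
  obtain H where H: "(\<lambda>n. cstar_of (H n)) \<longlonglongrightarrow> b" using cstar_of_dense by blast
  note lim = bounded_clinear_tendsto[OF bounded_clinear_L tendsto_mult[OF tendsto_star]]
  have fin: "norm (L (star (cstar_of f) * cstar_of h)) \<le> \<nu> (cstar_of f) * \<nu> (cstar_of h)" for f h
    using full_norm_pull_Cauchy_Schwarz[of f h]
    by (simp add: pre_norm_def cstar_of_star[symmetric] cstar_of_mult[symmetric] L_cstar_of
        norm_cstar_of)
  show ?thesis
    unfolding pre_norm_def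
    by (rule LIMSEQ_le[OF tendsto_norm[OF lim[OF F H]]
          tendsto_mult[OF tendsto_real_sqrt[OF tendsto_norm[OF lim[OF F F]]]
            tendsto_real_sqrt[OF tendsto_norm[OF lim[OF H H]]]]])
       (use fin in \<open>auto simp: pre_norm_def\<close>)
qed

lemma nu_zero [simp]: "\<nu> 0 = 0"
  by (simp add: pre_norm_def L_zero)

lemma nu_scaleC: "\<nu> (c *\<^sub>C a) = cmod c * \<nu> a"
proof -
  have "norm (L (star (c *\<^sub>C a) * (c *\<^sub>C a))) = (cmod c)\<^sup>2 * norm (L (star a * a))"
    by (simp add: star_scaleC mult_scaleC_left mult_scaleC_right L_scaleC norm_scaleC power2_eq_square)
  then show ?thesis by (simp add: pre_norm_def real_sqrt_mult)
qed

lemma nu_minus: "\<nu> (- a) = \<nu> a"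
  using star_diff[of 0 a] by (simp add: pre_norm_def)

lemma nu_minus_commute: "\<nu> (a - b) = \<nu> (b - a)"
  using nu_minus[of "a - b"] by simp

lemma nu_triangle: "\<nu> (a + b) \<le> \<nu> a + \<nu> b"
proof (rule power2_le_imp_le)
  have expand: "L (star (a + b) * (a + b)) =
      L (star a * a) + L (star a * b) + L (star b * a) + L (star b * b)"
    by (simp add: star_add distrib_left distrib_right L_add add.assoc)
  have "(\<nu> (a + b))\<^sup>2 \<le>
      norm (L (star a * a)) + norm (L (star a * b)) + norm (L (star b * a)) + norm (L (star b * b))"
    using norm_triangle_ineq[of "L (star a * a) + L (star a * b) + L (star b * a)" "L (star b * b)"]
      norm_triangle_ineq[of "L (star a * a) + L (star a * b)" "L (star b * a)"]
      norm_triangle_ineq[of "L (star a * a)" "L (star a * b)"]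
    unfolding nu_power2 expand by linarith
  also have "\<dots> \<le> (\<nu> a + \<nu> b)\<^sup>2"
    using L_Cauchy_Schwarz[of a b] L_Cauchy_Schwarz[of b a]
    unfolding power2_sum nu_power2 mult.commute[of "\<nu> b"] by linarith
  finally show "(\<nu> (a + b))\<^sup>2 \<le> (\<nu> a + \<nu> b)\<^sup>2" .
qed simp

lemma nu_triangle_minus: "\<nu> (a - c) \<le> \<nu> (a - b) + \<nu> (b - c)"
  using nu_triangle[of "a - b" "b - c"] by simp

lemma nu_triangle_abs: "\<bar>\<nu> a - \<nu> b\<bar> \<le> \<nu> (a - b)"
  using nu_triangle[of "a - b" b] nu_triangle[of "b - a" a] nu_minus_commute[of a b] by simp

lemma nu_le_norm: "\<nu> a \<le> norm a"
proof (rule power2_le_imp_le)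
  show "(\<nu> a)\<^sup>2 \<le> (norm a)\<^sup>2"
    using L_contraction[of "star a * a"] by (simp add: nu_power2 cstar_identity)
qed simp

lemma nu_mult_alpha: "\<nu> (a * \<alpha> b) \<le> \<nu> a * norm b"
proof (rule power2_le_imp_le)
  have "(\<nu> (a * \<alpha> b))\<^sup>2 = norm (star b * L (star a * a) * b)"
    unfolding nu_power2
    by (simp add: star_mult alpha_star[symmetric] mult.assoc L_alpha_left)
       (simp add: mult.assoc[symmetric] L_alpha_right)
  also have "\<dots> \<le> norm (star b) * norm (L (star a * a)) * norm b"
    by (meson norm_mult_ineq mult_right_mono norm_ge_zero order_trans)
  finally show "(\<nu> (a * \<alpha> b))\<^sup>2 \<le> (\<nu> a * norm b)\<^sup>2"
    by (simp add: norm_star nu_power2[symmetric] power_mult_distrib power2_eq_square mult_ac)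
qed simp

end

section \<open>Norm bounds by iterated squaring\<close>

text \<open>
  Iterating the hypothesis gives \<open>N u\<^sub>0\<^sup>m \<le> N\<^sup>m u\<^sub>n \<le> D (N B)\<^sup>m\<close> for \<open>m = 2\<^sup>n\<close>.  Taking \<open>m\<close>-th roots, the
  constants \<open>D\<close> and \<open>N\<close> disappear in the limit, which is why a bound with an arbitrary \<open>D\<close>
  suffices.
\<close>

lemma doubling_bound:
  fixes u :: "nat \<Rightarrow> real"
  assumes nonneg: "N \<ge> 0" "B \<ge> 0" "\<And>n. u n \<ge> 0"
    and double: "\<And>n. (u n)\<^sup>2 \<le> N * u (Suc n)" and crude: "\<And>n. u n \<le> D * B ^ (2 ^ n)"
  shows "u 0 \<le> N * B"
proof (rule ccontr)
  assume "\<not> u 0 \<le> N * B"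
  then have u0: "u 0 > N * B" by simp
  then have pos: "u 0 > 0" using nonneg mult_nonneg_nonneg[of N B] by linarith
  have N: "N > 0"
  proof (rule ccontr)
    assume "\<not> N > 0"
    then have "N = 0" using nonneg by simp
    then show False using double[of 0] pos by simp
  qed
  have iter: "N * u 0 ^ (2 ^ n) \<le> N ^ (2 ^ n) * u n" for n
  proof (induction n)
    case (Suc n)
    have "N * (N * u 0 ^ (2 ^ Suc n)) = (N * u 0 ^ (2 ^ n))\<^sup>2"
      by (simp add: power_mult_distrib power2_eq_square mult_2 power_add)
    also have "\<dots> \<le> (N ^ (2 ^ n) * u n)\<^sup>2"
      by (rule power_mono[OF Suc]) (use N pos in simp)
    also have "\<dots> = (N ^ (2 ^ n))\<^sup>2 * (u n)\<^sup>2" by (simp add: power_mult_distrib)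
    also have "\<dots> \<le> (N ^ (2 ^ n))\<^sup>2 * (N * u (Suc n))"
      by (rule mult_left_mono[OF double]) simp
    also have "\<dots> = N * (N ^ (2 ^ Suc n) * u (Suc n))"
      by (simp add: power2_eq_square mult_2 power_add)
    finally show ?case using N by (simp only: mult_le_cancel_left_pos)
  qed simp
  have bound: "N * u 0 ^ (2 ^ n) \<le> D * (N * B) ^ (2 ^ n)" for n
  proof -
    have "N * u 0 ^ (2 ^ n) \<le> N ^ (2 ^ n) * (D * B ^ (2 ^ n))"
      by (rule order_trans[OF iter mult_left_mono[OF crude]]) (use N in simp)
    then show ?thesis by (simp add: power_mult_distrib mult_ac)
  qed
  have NB: "N * B > 0"
  proof (rule ccontr)
    assume "\<not> N * B > 0"
    then have "N * B = 0" using nonneg mult_nonneg_nonneg[of N B] by linarith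
    then have "N * u 0 \<le> 0" using bound[of 0] by (simp only: power_0 power_one_right mult_zero_right)
    then show False using N pos by (simp add: mult_le_0_iff)
  qed
  define q where "q = u 0 / (N * B)"
  have q: "q > 1" using u0 NB by (simp add: q_def)
  obtain n where "D / N < q ^ n" using real_arch_pow[OF q] by blast
  also have "q ^ n \<le> q ^ (2 ^ n)" by (rule power_increasing) (use q in auto)
  also have "\<dots> \<le> D / N"
  proof -
    have "N * q ^ (2 ^ n) \<le> D"
      using bound[of n] zero_less_power[OF NB, of "2 ^ n"]
      by (simp add: q_def power_divide pos_divide_le_eq)
    then show ?thesis using N by (simp add: pos_le_divide_eq mult.commute)
  qed
  finally show False by simp
qed

context inj_endo
begin

text \<open>
  For a positive operator \<open>R\<close> on a Hilbert module this is the norm estimate that follows from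
  \<open>\<langle>a, R a\<rangle> \<le> \<parallel>R\<parallel> \<langle>a, a\<rangle>\<close>.  Here \<open>B\<close> only has to control the growth of the powers of \<open>R\<close> at \<open>a\<close>, up
  to a factor \<open>D\<close> that may depend on \<open>a\<close>; so \<open>B\<close> can be taken from a norm other than \<open>\<nu>\<close>.
\<close>

lemma selfadjoint_bound:
  assumes sa: "\<And>x y. L (star (R x) * y) = L (star x * R y)"
    and crude: "\<And>n. norm (L (star a * (R ^^ n) a)) \<le> D * B ^ n" and "B \<ge> 0"
  shows "norm (L (star a * R a)) \<le> (\<nu> a)\<^sup>2 * B"
proof -
  define u where "u n = norm (L (star a * (R ^^ (2 ^ n)) a))" for n
  have pow: "L (star ((R ^^ m) x) * y) = L (star x * (R ^^ m) y)" for m x y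
    by (induction m arbitrary: x y) (simp_all add: sa funpow_swap1)
  have "u 0 \<le> (\<nu> a)\<^sup>2 * B"
  proof (rule doubling_bound[where u = u and D = D])
    fix n
    let ?b = "(R ^^ (2 ^ n)) a"
    have "(\<nu> ?b)\<^sup>2 = u (Suc n)"
      by (simp add: nu_power2 pow u_def mult_2 funpow_add)
    moreover have "(u n)\<^sup>2 \<le> (\<nu> a * \<nu> ?b)\<^sup>2"
      unfolding u_def by (intro power_mono L_Cauchy_Schwarz) simp
    ultimately show "(u n)\<^sup>2 \<le> (\<nu> a)\<^sup>2 * u (Suc n)" by (simp add: power_mult_distrib)
    show "u n \<le> D * B ^ 2 ^ n" unfolding u_def by (rule crude)
  qed (simp_all add: u_def \<open>B \<ge> 0\<close>)
  then show ?thesis by (simp add: u_def)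
qed

text \<open>
  Apply the previous bound to left multiplication by \<open>c* c\<close>, whose powers are controlled by the norm
  of \<open>C*(G)\<close>.
\<close>

lemma nu_mult_left: "\<nu> (c * a) \<le> norm c * \<nu> a"
proof (rule power2_le_imp_le)
  let ?R = "\<lambda>x. (star c * c) * x"
  have pow: "(?R ^^ n) x = (star c * c) ^ n * x" for n x
    by (induction n) (simp_all add: mult.assoc)
  have "norm (L (star a * ?R a)) \<le> (\<nu> a)\<^sup>2 * norm (star c * c)"
  proof (rule selfadjoint_bound[where D = "norm a * norm a"])
    fix n
    have "norm (L (star a * (?R ^^ n) a)) \<le> norm (star a * (?R ^^ n) a)" by (rule L_contraction)
    also have "\<dots> \<le> norm (star a) * (norm ((star c * c) ^ n) * norm a)"
      unfolding pow by (meson norm_mult_ineq mult_left_mono norm_ge_zero order_trans)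
    also have "\<dots> \<le> norm a * (norm (star c * c) ^ n * norm a)"
      unfolding norm_star by (intro mult_left_mono mult_right_mono norm_power_ineq norm_ge_zero)
    finally show "norm (L (star a * (?R ^^ n) a)) \<le> norm a * norm a * norm (star c * c) ^ n"
      by (simp add: mult_ac)
  qed (simp_all add: star_mult star_star mult.assoc)
  then show "(\<nu> (c * a))\<^sup>2 \<le> (norm c * \<nu> a)\<^sup>2"
    by (simp add: nu_power2[of "c * a"] star_mult mult.assoc cstar_identity power_mult_distrib
        mult.commute)
qed simp

end

section \<open>Adjointable maps on the group C*-algebra\<close>

definition adjoint_pair :: "('g::group_add \<Rightarrow> 'g) \<Rightarrow> ('g cstar \<Rightarrow> 'g cstar) \<Rightarrow> ('g cstar \<Rightarrow> 'g cstar) \<Rightarrow> bool"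
  where "adjoint_pair t F F' \<longleftrightarrow>
    (\<forall>a b. transfer_op t (star (F a) * b) = transfer_op t (star a * F' b))"

definition op_bound :: "('g::group_add \<Rightarrow> 'g) \<Rightarrow> ('g cstar \<Rightarrow> 'g cstar) \<Rightarrow> real \<Rightarrow> bool"
  where "op_bound t F C \<longleftrightarrow> (\<forall>a. pre_norm t (F a) \<le> C * pre_norm t a)"

lemma op_boundD: "op_bound t F C \<Longrightarrow> pre_norm t (F a) \<le> C * pre_norm t a"
  by (simp add: op_bound_def)

lemma adjoint_pairD:
  "adjoint_pair t F F' \<Longrightarrow> transfer_op t (star (F a) * b) = transfer_op t (star a * F' b)"
  by (simp add: adjoint_pair_def)

context inj_endo
begin

lemma adjoint_pair_sym:
  assumes "adjoint_pair t F F'" shows "adjoint_pair t F' F"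
  unfolding adjoint_pair_def
proof (intro allI)
  fix a b
  have "L (star (F' a) * b) = star (L (star b * F' a))"
    by (simp add: L_star[symmetric] star_mult star_star)
  also have "\<dots> = star (L (star (F b) * a))"
    by (simp only: adjoint_pairD[OF assms])
  also have "\<dots> = L (star a * F b)"
    by (simp add: L_star[symmetric] star_mult star_star)
  finally show "L (star (F' a) * b) = L (star a * F b)" .
qed

text \<open>
  As for operators on a Hilbert space: \<open>\<nu>(F' b)\<^sup>2 = \<parallel>L((F F' b)* b)\<parallel> \<le> C \<nu>(F' b) \<nu>(b)\<close>.
\<close>

lemma op_bound_adjoint:
  assumes adj: "adjoint_pair t F F'" and F: "op_bound t F C"
  shows "op_bound t F' C"
  unfolding op_bound_def
proof
  fix b
  have "(\<nu> (F' b))\<^sup>2 = norm (L (star (F (F' b)) * b))"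
    by (simp add: nu_power2 adjoint_pairD[OF adj])
  also have "\<dots> \<le> \<nu> (F (F' b)) * \<nu> b" by (rule L_Cauchy_Schwarz)
  also have "\<dots> \<le> C * \<nu> (F' b) * \<nu> b" by (intro mult_right_mono op_boundD[OF F] nu_nonneg)
  finally have le: "\<nu> (F' b) * \<nu> (F' b) \<le> C * \<nu> b * \<nu> (F' b)"
    by (simp add: power2_eq_square mult_ac)
  have "0 \<le> C * \<nu> b" using op_boundD[OF F, of b] nu_nonneg[of "F b"] by linarith
  then show "\<nu> (F' b) \<le> C * \<nu> b"
    using le nu_nonneg[of "F' b"] by (cases "\<nu> (F' b) = 0") (auto simp: mult_le_cancel_right)
qed

end

locale inj_endo_comp = t: inj_endo t + s: inj_endo s for t s :: "'g::{group_add, countable} \<Rightarrow> 'g"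
begin

sublocale ts: inj_endo "t \<circ> s"
  by unfold_locales (simp_all add: t.hom s.hom inj_compose t.inj s.inj)

lemma L_comp: "ts.L a = s.L (t.L a)"
proof (rule bounded_clinear_eqI[OF ts.bounded_clinear_L
      bounded_clinear_compose[OF s.bounded_clinear_L t.bounded_clinear_L]])
  fix g
  show "ts.L (delta g) = s.L (t.L (delta g))"
  proof (cases "g \<in> range t")
    case True
    then obtain h where h: "g = t h" by blast
    have "t h \<in> range (t \<circ> s) \<longleftrightarrow> h \<in> range s"
      using t.inj by (auto dest: injD)
    moreover have "inv (t \<circ> s) (t h) = inv s h" if "h \<in> range s"
      using that ts.inv_t by auto
    ultimately show ?thesis by (simp add: h ts.L_delta t.L_delta s.L_delta)
  next
    case False
    then have "g \<notin> range (t \<circ> s)" by auto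
    with False show ?thesis by (simp add: ts.L_delta t.L_delta s.L_zero)
  qed
qed

text \<open>
  With \<open>c = L\<^sub>t(a* a)\<close> the left-hand side squared is \<open>\<parallel>L\<^sub>s(b* c b)\<parallel>\<close>; left multiplication by \<open>c\<close> is
  bounded by \<open>\<parallel>c\<parallel>\<close> in the seminorm of \<open>s\<close>.
\<close>

lemma nu_comp_mult: "ts.\<nu> (a * t.\<alpha> b) \<le> t.\<nu> a * s.\<nu> b"
proof (rule power2_le_imp_le)
  let ?c = "t.L (star a * a)"
  have "t.L (star (a * t.\<alpha> b) * (a * t.\<alpha> b)) = star b * (?c * b)"
    by (simp add: star_mult t.alpha_star[symmetric] mult.assoc t.L_alpha_left)
       (simp add: mult.assoc[symmetric] t.L_alpha_right)
  then have "(ts.\<nu> (a * t.\<alpha> b))\<^sup>2 = norm (s.L (star b * (?c * b)))"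
    by (simp add: ts.nu_power2 L_comp)
  also have "\<dots> \<le> s.\<nu> b * s.\<nu> (?c * b)" by (rule s.L_Cauchy_Schwarz)
  also have "\<dots> \<le> s.\<nu> b * (norm ?c * s.\<nu> b)" by (intro mult_left_mono s.nu_mult_left s.nu_nonneg)
  finally show "(ts.\<nu> (a * t.\<alpha> b))\<^sup>2 \<le> (t.\<nu> a * s.\<nu> b)\<^sup>2"
    by (simp add: power_mult_distrib t.nu_power2 power2_eq_square[of "s.\<nu> b"] mult_ac)
qed simp

lemma adjoint_pair_comp: "adjoint_pair t F F' \<Longrightarrow> adjoint_pair (t \<circ> s) F F'"
  by (simp add: adjoint_pair_def L_comp)

text \<open>
  The inequality behind the existence of \<open>\<iota>\<close>.  The map \<open>R = F' F\<close> is self-adjoint for the form of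
  \<open>t \<circ> s\<close>, and the growth of its powers there is bounded by their growth in the seminorm of \<open>t\<close>,
  because \<open>L\<^sub>s\<close> is a contraction.
\<close>

lemma op_bound_comp:
  assumes adj: "adjoint_pair t F F'" and F: "op_bound t F C" and "C \<ge> 0"
  shows "op_bound (t \<circ> s) F C"
  unfolding op_bound_def
proof (rule allI, rule power2_le_imp_le)
  fix a
  define R where "R x = F' (F x)" for x
  note adj' = t.adjoint_pair_sym[OF adj]
  have R: "t.\<nu> (R x) \<le> C\<^sup>2 * t.\<nu> x" for x
  proof -
    have "t.\<nu> (R x) \<le> C * t.\<nu> (F x)"
      unfolding R_def by (rule op_boundD[OF t.op_bound_adjoint[OF adj F]])
    also have "\<dots> \<le> C * (C * t.\<nu> x)" by (rule mult_left_mono[OF op_boundD[OF F] \<open>C \<ge> 0\<close>])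
    finally show ?thesis by (simp add: power2_eq_square mult_ac)
  qed
  have Rn: "t.\<nu> ((R ^^ n) a) \<le> (C\<^sup>2) ^ n * t.\<nu> a" for n
  proof (induction n)
    case (Suc n)
    have "t.\<nu> ((R ^^ Suc n) a) \<le> C\<^sup>2 * t.\<nu> ((R ^^ n) a)" using R by simp
    also have "\<dots> \<le> C\<^sup>2 * ((C\<^sup>2) ^ n * t.\<nu> a)" by (rule mult_left_mono[OF Suc]) simp
    finally show ?case by (simp add: mult_ac)
  qed simp
  have "norm (ts.L (star a * R a)) \<le> (ts.\<nu> a)\<^sup>2 * C\<^sup>2"
  proof (rule ts.selfadjoint_bound[where D = "t.\<nu> a * t.\<nu> a"])
    show "ts.L (star (R x) * y) = ts.L (star x * R y)" for x y
      by (simp add: L_comp R_def adjoint_pairD[OF adj] adjoint_pairD[OF adj'])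
    fix n
    have "norm (ts.L (star a * (R ^^ n) a)) \<le> norm (t.L (star a * (R ^^ n) a))"
      by (simp add: L_comp s.L_contraction)
    also have "\<dots> \<le> t.\<nu> a * t.\<nu> ((R ^^ n) a)" by (rule t.L_Cauchy_Schwarz)
    also have "\<dots> \<le> t.\<nu> a * ((C\<^sup>2) ^ n * t.\<nu> a)" by (rule mult_left_mono[OF Rn]) simp
    finally show "norm (ts.L (star a * (R ^^ n) a)) \<le> t.\<nu> a * t.\<nu> a * (C\<^sup>2) ^ n"
      by (simp add: mult_ac)
  qed simp
  moreover have "(ts.\<nu> (F a))\<^sup>2 = norm (ts.L (star a * R a))"
    by (simp add: ts.nu_power2 L_comp R_def adjoint_pairD[OF adj])
  ultimately show "(ts.\<nu> (F a))\<^sup>2 \<le> (C * ts.\<nu> a)\<^sup>2"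
    by (simp add: power_mult_distrib mult.commute)
qed (simp add: \<open>C \<ge> 0\<close>)

end

section \<open>Sequences that are Cauchy for a seminorm\<close>

lemma tendsto_zero_le:
  fixes f g :: "nat \<Rightarrow> real"
  assumes "g \<longlonglongrightarrow> 0" "\<And>n. 0 \<le> f n" "\<And>n. f n \<le> g n"
  shows "f \<longlonglongrightarrow> 0"
  by (rule tendsto_sandwich[OF _ _ tendsto_const assms(1)])
     (use assms in \<open>auto intro: always_eventually\<close>)

text \<open>
  The estimate is the Leibniz rule of a bilinear map that is bounded by \<open>1\<close>.  It is used for the
  inner product of a fibre and for the multiplication of two fibres.
\<close>

lemma seq_cauchy_bilinear:
  fixes \<nu> :: "'a::ab_group_add \<Rightarrow> real" and \<nu>' :: "'b::ab_group_add \<Rightarrow> real"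
    and \<mu> :: "'c::ab_group_add \<Rightarrow> real"
  assumes est: "\<And>x y x' y'. \<mu> (B x y - B x' y') \<le> \<nu> x * \<nu>' (y - y') + \<nu> (x - x') * \<nu>' y'"
    and nonneg: "\<And>x. 0 \<le> \<nu> x" "\<And>y. 0 \<le> \<nu>' y"
    and X: "seq_cauchy \<nu> X" "K > 0" "\<And>n. \<nu> (X n) \<le> K"
    and Y: "seq_cauchy \<nu>' Y" "K' > 0" "\<And>n. \<nu>' (Y n) \<le> K'"
  shows "seq_cauchy \<mu> (\<lambda>n. B (X n) (Y n))"
  unfolding seq_cauchy_def
proof (intro allI impI)
  fix e :: real assume "e > 0"
  then have pos: "e / (2 * K) > 0" "e / (2 * K') > 0" using X(2) Y(2) by simp_all
  obtain N where N: "\<And>m n. m \<ge> N \<Longrightarrow> n \<ge> N \<Longrightarrow> \<nu>' (Y m - Y n) < e / (2 * K)"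
    using seq_cauchyD[OF Y(1) pos(1)] by blast
  obtain N' where N': "\<And>m n. m \<ge> N' \<Longrightarrow> n \<ge> N' \<Longrightarrow> \<nu> (X m - X n) < e / (2 * K')"
    using seq_cauchyD[OF X(1) pos(2)] by blast
  have "\<mu> (B (X m) (Y m) - B (X n) (Y n)) < e" if "m \<ge> max N N'" "n \<ge> max N N'" for m n
  proof -
    have "\<mu> (B (X m) (Y m) - B (X n) (Y n)) \<le>
        \<nu> (X m) * \<nu>' (Y m - Y n) + \<nu> (X m - X n) * \<nu>' (Y n)" by (rule est)
    also have "\<dots> \<le> K * \<nu>' (Y m - Y n) + \<nu> (X m - X n) * K'"
      by (intro add_mono mult_mono X(3) Y(3) less_imp_le[OF X(2)] less_imp_le[OF Y(2)]
          nonneg order_refl)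
    also have "\<dots> < K * (e / (2 * K)) + e / (2 * K') * K'"
      using N[of m n] N'[of m n] that X(2) Y(2)
      by (intro add_strict_mono mult_strict_left_mono mult_strict_right_mono) simp_all
    also have "\<dots> = e" using X(2) Y(2) by simp
    finally show ?thesis .
  qed
  then show "\<exists>N. \<forall>m\<ge>N. \<forall>n\<ge>N. \<mu> (B (X m) (Y m) - B (X n) (Y n)) < e" by blast
qed

lemma bilinear_tendsto_zero:
  fixes \<nu> :: "'a::ab_group_add \<Rightarrow> real" and \<nu>' :: "'b::ab_group_add \<Rightarrow> real"
    and \<mu> :: "'c::ab_group_add \<Rightarrow> real"
  assumes est: "\<And>x y x' y'. \<mu> (B x y - B x' y') \<le> \<nu> x * \<nu>' (y - y') + \<nu> (x - x') * \<nu>' y'"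
    and nonneg: "\<And>z. 0 \<le> \<mu> z" "\<And>x. 0 \<le> \<nu> x" "\<And>y. 0 \<le> \<nu>' y"
    and X: "\<And>n. \<nu> (X n) \<le> K" "(\<lambda>n. \<nu> (X n - X' n)) \<longlonglongrightarrow> 0"
    and Y: "\<And>n. \<nu>' (Y' n) \<le> K'" "(\<lambda>n. \<nu>' (Y n - Y' n)) \<longlonglongrightarrow> 0"
  shows "(\<lambda>n. \<mu> (B (X n) (Y n) - B (X' n) (Y' n))) \<longlonglongrightarrow> 0"
proof (rule tendsto_zero_le)
  have "(\<lambda>n. K * \<nu>' (Y n - Y' n) + \<nu> (X n - X' n) * K') \<longlonglongrightarrow> K * 0 + 0 * K'"
    by (intro tendsto_intros X Y)
  then show "(\<lambda>n. K * \<nu>' (Y n - Y' n) + \<nu> (X n - X' n) * K') \<longlonglongrightarrow> 0" by simp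
  fix n
  have "\<mu> (B (X n) (Y n) - B (X' n) (Y' n)) \<le>
      \<nu> (X n) * \<nu>' (Y n - Y' n) + \<nu> (X n - X' n) * \<nu>' (Y' n)" by (rule est)
  also have "\<dots> \<le> K * \<nu>' (Y n - Y' n) + \<nu> (X n - X' n) * K'"
    by (intro add_mono mult_right_mono mult_left_mono X(1) Y(1) nonneg)
  finally show "\<mu> (B (X n) (Y n) - B (X' n) (Y' n)) \<le>
      K * \<nu>' (Y n - Y' n) + \<nu> (X n - X' n) * K'" .
qed (rule nonneg)

section \<open>The fibres as completions\<close>

context inj_endo
begin

text \<open>
  The operations of a fibre are defined on arbitrarily chosen representatives.  The lemmas
  \<open>madd_cls\<close>, \<open>mscale_cls\<close>, \<open>ract_cls\<close> and \<open>ip_tendsto\<close> show that every Cauchy sequence may be used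
  instead; together with \<open>mdist_tendsto\<close> they reduce statements about the module to statements
  about the terms of sequences in \<open>C*(G)\<close>.
\<close>

abbreviation M where "M \<equiv> fibre t"
abbreviation cls where "cls \<equiv> fibre_class t"
abbreviation \<pi> where "\<pi> a \<equiv> fibre_class t (\<lambda>_. a)"
abbreviation "cauchy \<equiv> seq_cauchy \<nu>"

lemma cauchy_const: "cauchy (\<lambda>n. a)"
  by (simp add: seq_cauchy_def)

lemma nu_cauchy_convergent:
  assumes "cauchy X"
  shows "convergent (\<lambda>n. \<nu> (X n))"
proof (rule Cauchy_convergent, rule metric_CauchyI)
  fix e :: real assume "e > 0"
  with assms obtain N where "\<And>m n. m \<ge> N \<Longrightarrow> n \<ge> N \<Longrightarrow> \<nu> (X m - X n) < e"
    using seq_cauchyD by blast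
  then have "\<forall>m\<ge>N. \<forall>n\<ge>N. dist (\<nu> (X m)) (\<nu> (X n)) < e"
    unfolding dist_real_def using nu_triangle_abs order_le_less_trans by blast
  then show "\<exists>N. \<forall>m\<ge>N. \<forall>n\<ge>N. dist (\<nu> (X m)) (\<nu> (X n)) < e" ..
qed

lemma nu_cauchy_bounded:
  assumes "cauchy X"
  obtains K where "K > 0" "\<And>n. \<nu> (X n) \<le> K"
proof -
  have "Bseq (\<lambda>n. \<nu> (X n))"
    using nu_cauchy_convergent[OF assms] by (rule convergent_imp_Bseq)
  then show thesis using that by (auto simp: Bseq_def)
qed

lemma cauchy_add:
  assumes "cauchy X" "cauchy Y" shows "cauchy (\<lambda>n. X n + Y n)"
  unfolding seq_cauchy_def
proof (intro allI impI)
  fix e :: real assume "e > 0"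
  then have e: "e / 2 > 0" by simp
  obtain N where N: "\<And>m n. m \<ge> N \<Longrightarrow> n \<ge> N \<Longrightarrow> \<nu> (X m - X n) < e / 2"
    using seq_cauchyD[OF assms(1) e] by blast
  obtain N' where N': "\<And>m n. m \<ge> N' \<Longrightarrow> n \<ge> N' \<Longrightarrow> \<nu> (Y m - Y n) < e / 2"
    using seq_cauchyD[OF assms(2) e] by blast
  have "\<nu> (X m + Y m - (X n + Y n)) < e" if "m \<ge> max N N'" "n \<ge> max N N'" for m n
    using nu_triangle[of "X m - X n" "Y m - Y n"] N[of m n] N'[of m n] that
    by (simp add: algebra_simps)
  then show "\<exists>N. \<forall>m\<ge>N. \<forall>n\<ge>N. \<nu> (X m + Y m - (X n + Y n)) < e" by blast
qed

lemma cauchy_lipschitz: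
  assumes "cauchy X" and lip: "\<And>m n. \<nu> (Y m - Y n) \<le> C * \<nu> (X m - X n)"
  shows "cauchy Y"
  unfolding seq_cauchy_def
proof (intro allI impI)
  fix e :: real assume "e > 0"
  then have "e / (\<bar>C\<bar> + 1) > 0" by simp
  then obtain N where N: "\<And>m n. m \<ge> N \<Longrightarrow> n \<ge> N \<Longrightarrow> \<nu> (X m - X n) < e / (\<bar>C\<bar> + 1)"
    using seq_cauchyD[OF assms(1)] by blast
  have "\<nu> (Y m - Y n) < e" if "m \<ge> N" "n \<ge> N" for m n
  proof -
    have "\<nu> (Y m - Y n) \<le> (\<bar>C\<bar> + 1) * \<nu> (X m - X n)"
      by (rule order_trans[OF lip mult_right_mono]) auto
    also have "\<dots> < (\<bar>C\<bar> + 1) * (e / (\<bar>C\<bar> + 1))"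
      by (rule mult_strict_left_mono[OF N[OF that]]) simp
    finally show ?thesis by simp
  qed
  then show "\<exists>N. \<forall>m\<ge>N. \<forall>n\<ge>N. \<nu> (Y m - Y n) < e" by blast
qed

lemma cauchy_scaleC: "cauchy X \<Longrightarrow> cauchy (\<lambda>n. c *\<^sub>C X n)"
proof (rule cauchy_lipschitz[where C = "cmod c"])
  show "\<nu> (c *\<^sub>C X m - c *\<^sub>C X n) \<le> cmod c * \<nu> (X m - X n)" for m n
    using nu_scaleC[of c "X m - X n"] scaleC_add_right[of c "X m - X n" "X n"] by simp
qed

lemma cauchy_mult_alpha: "cauchy X \<Longrightarrow> cauchy (\<lambda>n. X n * \<alpha> b)"
  by (rule cauchy_lipschitz[where C = "norm b"])
     (use nu_mult_alpha in \<open>simp_all add: left_diff_distrib[symmetric] mult.commute\<close>)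

lemma cauchy_diff: "cauchy X \<Longrightarrow> cauchy Y \<Longrightarrow> cauchy (\<lambda>n. X n - Y n)"
proof -
  assume X: "cauchy X" and Y: "cauchy Y"
  have "cauchy (\<lambda>n. - Y n)"
    by (rule cauchy_lipschitz[OF Y, where C = 1]) (simp add: nu_minus_commute[of "Y n" "Y m" for m n])
  from cauchy_add[OF X this] show ?thesis by simp
qed

lemma equiv_nu_refl: "cauchy X \<Longrightarrow> seq_equiv \<nu> X X"
  by (simp add: seq_equiv_def)

lemma equiv_nu_sym: "seq_equiv \<nu> X Y \<Longrightarrow> seq_equiv \<nu> Y X"
  by (simp add: seq_equiv_def nu_minus_commute)

lemma equiv_nu_trans:
  assumes "seq_equiv \<nu> X Y" "seq_equiv \<nu> Y Z"
  shows "seq_equiv \<nu> X Z"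
proof -
  have "(\<lambda>n. \<nu> (X n - Y n)) \<longlonglongrightarrow> 0" "(\<lambda>n. \<nu> (Y n - Z n)) \<longlonglongrightarrow> 0"
    using assms by (simp_all add: seq_equiv_def)
  from tendsto_add[OF this] have "(\<lambda>n. \<nu> (X n - Y n) + \<nu> (Y n - Z n)) \<longlonglongrightarrow> 0" by simp
  then have "(\<lambda>n. \<nu> (X n - Z n)) \<longlonglongrightarrow> 0"
    by (rule tendsto_zero_le) (auto intro: nu_triangle_minus)
  then show ?thesis using assms by (simp add: seq_equiv_def)
qed

lemma cls_eqI: "seq_equiv \<nu> X Y \<Longrightarrow> cls X = cls Y"
  unfolding fibre_class_def using equiv_nu_trans equiv_nu_sym by blast

lemma cls_eqI':
  "cauchy X \<Longrightarrow> cauchy Y \<Longrightarrow> (\<lambda>n. \<nu> (X n - Y n)) \<longlonglongrightarrow> 0 \<Longrightarrow> cls X = cls Y"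
  by (simp add: cls_eqI seq_equiv_def)

lemma fibre_rep_cls:
  assumes "cauchy X"
  shows "seq_equiv \<nu> (fibre_rep (cls X)) X"
proof -
  have "X \<in> cls X" by (simp add: fibre_class_def equiv_nu_refl[OF assms])
  then have "fibre_rep (cls X) \<in> cls X" unfolding fibre_rep_def by (rule someI[where P = "\<lambda>Y. Y \<in> cls X"])
  then show ?thesis by (simp add: fibre_class_def equiv_nu_sym)
qed

lemma cauchy_fibre_rep: "cauchy X \<Longrightarrow> cauchy (fibre_rep (cls X))"
  using fibre_rep_cls by (simp add: seq_equiv_def)

lemma cls_carrier: "cauchy X \<Longrightarrow> cls X \<in> mcarrier M"
  by (simp add: fibre_def)

lemma pi_carrier: "\<pi> a \<in> mcarrier M"
  by (rule cls_carrier[OF cauchy_const])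

lemma carrierE:
  assumes "\<xi> \<in> mcarrier M"
  obtains X where "cauchy X" "\<xi> = cls X"
  using assms by (auto simp: fibre_def)

lemma madd_cls:
  assumes "cauchy X" "cauchy Y"
  shows "madd M (cls X) (cls Y) = cls (\<lambda>n. X n + Y n)"
proof -
  let ?X = "fibre_rep (cls X)" and ?Y = "fibre_rep (cls Y)"
  have "(\<lambda>n. \<nu> (?X n - X n)) \<longlonglongrightarrow> 0" "(\<lambda>n. \<nu> (?Y n - Y n)) \<longlonglongrightarrow> 0"
    using fibre_rep_cls[OF assms(1)] fibre_rep_cls[OF assms(2)] by (simp_all add: seq_equiv_def)
  from tendsto_add[OF this] have lim: "(\<lambda>n. \<nu> (?X n - X n) + \<nu> (?Y n - Y n)) \<longlonglongrightarrow> 0" by simp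
  have "\<nu> (?X n + ?Y n - (X n + Y n)) \<le> \<nu> (?X n - X n) + \<nu> (?Y n - Y n)" for n
    using nu_triangle[of "?X n - X n" "?Y n - Y n"] by (simp add: algebra_simps)
  then have "(\<lambda>n. \<nu> (?X n + ?Y n - (X n + Y n))) \<longlonglongrightarrow> 0"
    by (rule tendsto_zero_le[OF lim nu_nonneg])
  then have "cls (\<lambda>n. ?X n + ?Y n) = cls (\<lambda>n. X n + Y n)"
    by (intro cls_eqI' cauchy_add cauchy_fibre_rep assms)
  then show ?thesis by (simp add: fibre_def)
qed

lemma cls_lipschitz_eqI:
  assumes "seq_equiv \<nu> X Y" "cauchy X'" "cauchy Y'" "\<And>n. \<nu> (X' n - Y' n) \<le> C * \<nu> (X n - Y n)"
  shows "cls X' = cls Y'"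
proof (rule cls_eqI'[OF assms(2,3)])
  have "(\<lambda>n. C * \<nu> (X n - Y n)) \<longlonglongrightarrow> 0"
    using tendsto_mult_left[of "\<lambda>n. \<nu> (X n - Y n)" 0 _ C] assms(1) by (simp add: seq_equiv_def)
  then show "(\<lambda>n. \<nu> (X' n - Y' n)) \<longlonglongrightarrow> 0"
    by (rule tendsto_zero_le) (simp_all add: assms(4))
qed

lemma mscale_cls:
  assumes "cauchy X"
  shows "mscale M c (cls X) = cls (\<lambda>n. c *\<^sub>C X n)"
proof -
  have "\<nu> (c *\<^sub>C x - c *\<^sub>C y) \<le> cmod c * \<nu> (x - y)" for x y
    using nu_scaleC[of c "x - y"] scaleC_add_right[of c "x - y" y] by simp
  then have "cls (\<lambda>n. c *\<^sub>C fibre_rep (cls X) n) = cls (\<lambda>n. c *\<^sub>C X n)"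
    by (intro cls_lipschitz_eqI[OF fibre_rep_cls[OF assms]] cauchy_scaleC assms
        cauchy_fibre_rep)
  then show ?thesis by (simp add: fibre_def)
qed

lemma ract_cls:
  assumes "cauchy X"
  shows "ract M (cls X) b = cls (\<lambda>n. X n * \<alpha> b)"
proof -
  have "\<nu> (x * \<alpha> b - y * \<alpha> b) \<le> norm b * \<nu> (x - y)" for x y
    using nu_mult_alpha[of "x - y" b] by (simp add: left_diff_distrib mult.commute)
  then have "cls (\<lambda>n. fibre_rep (cls X) n * \<alpha> b) = cls (\<lambda>n. X n * \<alpha> b)"
    by (intro cls_lipschitz_eqI[OF fibre_rep_cls[OF assms]] cauchy_mult_alpha assms
        cauchy_fibre_rep)
  then show ?thesis by (simp add: fibre_def)
qed

lemma form_diff_bound: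
  "norm (L (star a * b) - L (star a' * b')) \<le> \<nu> a * \<nu> (b - b') + \<nu> (a - a') * \<nu> b'"
proof -
  have eq: "L (star a * b) - L (star a' * b') = L (star a * (b - b')) + L (star (a - a') * b')"
    by (simp add: star_diff right_diff_distrib left_diff_distrib L_diff)
  show ?thesis
    unfolding eq
    using norm_triangle_ineq[of "L (star a * (b - b'))" "L (star (a - a') * b')"]
      L_Cauchy_Schwarz[of a "b - b'"] L_Cauchy_Schwarz[of "a - a'" b'] by linarith
qed

lemma form_convergent:
  assumes X: "cauchy X" and Y: "cauchy Y"
  shows "convergent (\<lambda>n. L (star (X n) * Y n))"
proof -
  obtain K where K: "K > 0" "\<And>n. \<nu> (X n) \<le> K" by (rule nu_cauchy_bounded[OF X]) (rule that)
  obtain K' where K': "K' > 0" "\<And>n. \<nu> (Y n) \<le> K'" by (rule nu_cauchy_bounded[OF Y]) (rule that)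
  have "seq_cauchy norm (\<lambda>n. L (star (X n) * Y n))"
    by (rule seq_cauchy_bilinear[where B = "\<lambda>x y. L (star x * y)", OF form_diff_bound _ _ X K Y K'])
       simp_all
  then have "Cauchy (\<lambda>n. L (star (X n) * Y n))"
    by (simp add: seq_cauchy_def Cauchy_iff)
  then show ?thesis by (rule Cauchy_convergent)
qed

lemma ip_tendsto:
  assumes X: "cauchy X" and Y: "cauchy Y"
  shows "(\<lambda>n. L (star (X n) * Y n)) \<longlonglongrightarrow> ip M (cls X) (cls Y)"
proof -
  let ?X = "fibre_rep (cls X)" and ?Y = "fibre_rep (cls Y)"
  have lim: "(\<lambda>n. L (star (?X n) * ?Y n)) \<longlonglongrightarrow> ip M (cls X) (cls Y)"
    using form_convergent[OF cauchy_fibre_rep[OF X] cauchy_fibre_rep[OF Y]]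
    by (simp add: fibre_def convergent_LIMSEQ_iff)
  obtain K where K: "K > 0" "\<And>n. \<nu> (X n) \<le> K" by (rule nu_cauchy_bounded[OF X]) (rule that)
  obtain K' where K': "K' > 0" "\<And>n. \<nu> (?Y n) \<le> K'"
    by (rule nu_cauchy_bounded[OF cauchy_fibre_rep[OF Y]]) (rule that)
  have z: "(\<lambda>n. \<nu> (X n - ?X n)) \<longlonglongrightarrow> 0" "(\<lambda>n. \<nu> (Y n - ?Y n)) \<longlonglongrightarrow> 0"
    using equiv_nu_sym[OF fibre_rep_cls[OF X]] equiv_nu_sym[OF fibre_rep_cls[OF Y]]
    by (simp_all add: seq_equiv_def)
  have "(\<lambda>n. norm (L (star (X n) * Y n) - L (star (?X n) * ?Y n))) \<longlonglongrightarrow> 0"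
    by (rule bilinear_tendsto_zero[where B = "\<lambda>x y. L (star x * y)",
          OF form_diff_bound _ _ _ K(2) z(1) K'(2) z(2)]) simp_all
  then have "(\<lambda>n. L (star (X n) * Y n) - L (star (?X n) * ?Y n)) \<longlonglongrightarrow> 0"
    by (rule tendsto_norm_zero_cancel)
  from tendsto_add[OF this lim] show ?thesis by simp
qed

lemma mnorm_tendsto:
  assumes "cauchy X"
  shows "(\<lambda>n. \<nu> (X n)) \<longlonglongrightarrow> mnorm M (cls X)"
  unfolding pre_norm_def mnorm_def
  by (intro tendsto_real_sqrt tendsto_norm ip_tendsto assms)

lemma mdist_tendsto:
  assumes "cauchy X" "cauchy Y"
  shows "(\<lambda>n. \<nu> (X n - Y n)) \<longlonglongrightarrow> mdist M (cls X) (cls Y)"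
proof -
  have neg: "(- 1) *\<^sub>C y = - y" for y :: "'g cstar"
    using scaleR_scaleC[of "- 1" y] by simp
  have "madd M (cls X) (mscale M (- 1) (cls Y)) = cls (\<lambda>n. X n - Y n)"
    using assms cauchy_scaleC[OF assms(2), of "- 1"]
    by (simp add: mscale_cls madd_cls neg)
  then show ?thesis
    unfolding mdist_def using mnorm_tendsto[OF cauchy_diff[OF assms]] by simp
qed

lemma mnorm_nonneg: "0 \<le> mnorm M \<xi>"
  by (simp add: mnorm_def)

lemma mnorm_pi: "mnorm M (\<pi> a) = \<nu> a"
  using mnorm_tendsto[OF cauchy_const, of a] by (simp add: LIMSEQ_const_iff)

lemma mdist_pi: "mdist M (\<pi> a) (\<pi> b) = \<nu> (a - b)"
  using mdist_tendsto[OF cauchy_const cauchy_const, of a b] by (simp add: LIMSEQ_const_iff)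

lemma mdist_nonneg: "0 \<le> mdist M \<xi> \<eta>"
  by (simp add: mdist_def mnorm_nonneg)

lemma mdist_commute: "cauchy X \<Longrightarrow> cauchy Y \<Longrightarrow> mdist M (cls X) (cls Y) = mdist M (cls Y) (cls X)"
  using mdist_tendsto[of X Y] mdist_tendsto[of Y X] LIMSEQ_unique
  unfolding nu_minus_commute[of "X n" "Y n" for n] by blast

lemma mdist_triangle:
  assumes "\<xi> \<in> mcarrier M" "\<eta> \<in> mcarrier M" "\<zeta> \<in> mcarrier M"
  shows "mdist M \<xi> \<zeta> \<le> mdist M \<xi> \<eta> + mdist M \<eta> \<zeta>"
proof -
  obtain X where X: "cauchy X" "\<xi> = cls X" by (rule carrierE[OF assms(1)]) (rule that)
  obtain Y where Y: "cauchy Y" "\<eta> = cls Y" by (rule carrierE[OF assms(2)]) (rule that)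
  obtain Z where Z: "cauchy Z" "\<zeta> = cls Z" by (rule carrierE[OF assms(3)]) (rule that)
  show ?thesis
    unfolding X Y Z
    by (rule LIMSEQ_le[OF mdist_tendsto[OF X(1) Z(1)]
          tendsto_add[OF mdist_tendsto[OF X(1) Y(1)] mdist_tendsto[OF Y(1) Z(1)]]])
       (auto intro: nu_triangle_minus)
qed

lemma mdist_zero_iff:
  assumes "cauchy X" "cauchy Y"
  shows "mdist M (cls X) (cls Y) = 0 \<longleftrightarrow> cls X = cls Y"
proof
  assume "mdist M (cls X) (cls Y) = 0"
  then show "cls X = cls Y"
    using mdist_tendsto[OF assms] by (intro cls_eqI' assms) simp
next
  assume "cls X = cls Y"
  then show "mdist M (cls X) (cls Y) = 0"
    using mdist_tendsto[OF assms(2,2)] by (simp add: LIMSEQ_const_iff)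
qed

lemma pi_dense:
  assumes X: "cauchy X"
  shows "(\<lambda>n. mdist M (cls X) (\<pi> (X n))) \<longlonglongrightarrow> 0"
proof (rule LIMSEQ_I)
  fix e :: real assume "e > 0"
  then have "e / 2 > 0" by simp
  then obtain N where N: "\<And>m n. m \<ge> N \<Longrightarrow> n \<ge> N \<Longrightarrow> \<nu> (X m - X n) < e / 2"
    using seq_cauchyD[OF X] by blast
  have "mdist M (cls X) (\<pi> (X n)) \<le> e / 2" if "n \<ge> N" for n
    by (rule LIMSEQ_le_const2[OF mdist_tendsto[OF X cauchy_const]])
       (use N that less_imp_le in blast)
  then show "\<exists>N. \<forall>n\<ge>N. norm (mdist M (cls X) (\<pi> (X n)) - 0) < e"
    using mdist_nonneg \<open>e > 0\<close> by (auto intro!: exI[of _ N] simp: abs_of_nonneg) (smt (verit) field_sum_of_halves)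
qed

lemma ip_diff_bound:
  assumes "cauchy X" "cauchy Y" "cauchy Z"
  shows "norm (ip M (cls X) (cls Z) - ip M (cls Y) (cls Z)) \<le>
    mdist M (cls X) (cls Y) * mnorm M (cls Z)"
proof (rule LIMSEQ_le)
  show "(\<lambda>n. norm (L (star (X n) * Z n) - L (star (Y n) * Z n))) \<longlonglongrightarrow>
      norm (ip M (cls X) (cls Z) - ip M (cls Y) (cls Z))"
    by (intro tendsto_norm tendsto_diff ip_tendsto assms)
  show "(\<lambda>n. \<nu> (X n - Y n) * \<nu> (Z n)) \<longlonglongrightarrow> mdist M (cls X) (cls Y) * mnorm M (cls Z)"
    by (intro tendsto_mult mdist_tendsto mnorm_tendsto assms)
  show "\<exists>N. \<forall>n\<ge>N. norm (L (star (X n) * Z n) - L (star (Y n) * Z n)) \<le> \<nu> (X n - Y n) * \<nu> (Z n)"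
    using form_diff_bound[of "X n" "Z n" "Y n" "Z n" for n] by simp
qed

lemma ip_nondegenerate:
  assumes X: "cauchy X" and Y: "cauchy Y"
    and eq: "\<And>\<eta>. \<eta> \<in> mcarrier M \<Longrightarrow> ip M (cls X) \<eta> = ip M (cls Y) \<eta>"
  shows "cls X = cls Y"
proof (rule cls_eqI'[OF X Y])
  let ?Z = "\<lambda>n. X n - Y n"
  have Z: "cauchy ?Z" by (rule cauchy_diff[OF X Y])
  have "(\<lambda>n. L (star (X n) * ?Z n) - L (star (Y n) * ?Z n)) \<longlonglongrightarrow>
      ip M (cls X) (cls ?Z) - ip M (cls Y) (cls ?Z)"
    by (intro tendsto_diff ip_tendsto X Y Z)
  then have "(\<lambda>n. L (star (?Z n) * ?Z n)) \<longlonglongrightarrow> 0"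
    by (simp add: eq cls_carrier Z L_diff[symmetric] left_diff_distrib[symmetric] star_diff[symmetric])
  then have "(\<lambda>n. sqrt (norm (L (star (?Z n) * ?Z n)))) \<longlonglongrightarrow> sqrt (norm (0 :: 'g cstar))"
    by (intro tendsto_real_sqrt tendsto_norm)
  then show "(\<lambda>n. \<nu> (X n - Y n)) \<longlonglongrightarrow> 0" by (simp add: pre_norm_def)
qed

text \<open>
  The image of \<open>C*(G)\<close> is dense, \<open>\<langle>S \<xi>, \<eta>\<rangle> = \<langle>\<xi>, S' \<eta>\<rangle>\<close> is continuous in \<open>\<xi>\<close>, and these inner products
  determine \<open>S \<xi>\<close>.
\<close>

lemma adjointable_eqI:
  assumes S: "S \<in> adjointable M" and T: "T \<in> adjointable M" and eq: "\<And>a. S (\<pi> a) = T (\<pi> a)"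
  shows "S = T"
proof (rule PiE_ext)
  show ST: "S \<in> mcarrier M \<rightarrow>\<^sub>E mcarrier M" "T \<in> mcarrier M \<rightarrow>\<^sub>E mcarrier M"
    using S T by (simp_all add: adjointable_def)
  fix \<xi> assume \<xi>: "\<xi> \<in> mcarrier M"
  obtain X where X: "cauchy X" "\<xi> = cls X" by (rule carrierE[OF \<xi>]) (rule that)
  have lim: "(\<lambda>n. ip M (R (\<pi> (X n))) \<eta>) \<longlonglongrightarrow> ip M (R \<xi>) \<eta>"
    if R: "R \<in> adjointable M" and \<eta>: "\<eta> \<in> mcarrier M" for R \<eta>
  proof -
    obtain R' where R': "R' \<in> mcarrier M \<rightarrow>\<^sub>E mcarrier M"
      "\<And>x y. x \<in> mcarrier M \<Longrightarrow> y \<in> mcarrier M \<Longrightarrow> ip M (R x) y = ip M x (R' y)"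
      using R by (auto simp: adjointable_def)
    have "R' \<eta> \<in> mcarrier M" using R'(1) \<eta> by auto
    then obtain Z where Z: "cauchy Z" "R' \<eta> = cls Z" using carrierE by blast
    have "(\<lambda>n. mdist M (\<pi> (X n)) (cls X) * mnorm M (cls Z)) \<longlonglongrightarrow> 0 * mnorm M (cls Z)"
      using pi_dense[OF X(1)] unfolding mdist_commute[OF X(1) cauchy_const]
      by (intro tendsto_mult tendsto_const)
    then have "(\<lambda>n. mdist M (\<pi> (X n)) (cls X) * mnorm M (cls Z)) \<longlonglongrightarrow> 0" by simp
    then have "(\<lambda>n. ip M (\<pi> (X n)) (cls Z) - ip M (cls X) (cls Z)) \<longlonglongrightarrow> 0"
      by (rule Lim_null_comparison[rotated])
         (intro always_eventually allI ip_diff_bound cauchy_const X Z)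
    then have "(\<lambda>n. ip M (\<pi> (X n)) (cls Z)) \<longlonglongrightarrow> ip M (cls X) (cls Z)"
      using LIM_zero_iff by blast
    then show ?thesis by (simp add: R'(2) pi_carrier \<xi> \<eta> Z(2) X(2)[symmetric])
  qed
  have "ip M (S \<xi>) \<eta> = ip M (T \<xi>) \<eta>" if "\<eta> \<in> mcarrier M" for \<eta>
    using lim[OF S that] lim[OF T that] LIMSEQ_unique unfolding eq by blast
  moreover have "S \<xi> \<in> mcarrier M" "T \<xi> \<in> mcarrier M" using ST \<xi> by auto
  ultimately show "S \<xi> = T \<xi>" using ip_nondegenerate carrierE by metis
qed

end

section \<open>Extending maps from the group C*-algebra to the fibres\<close>

text \<open>
  Sequences of bounded adjointable maps that are Cauchy in the operator norm.  A sequence is needed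
  since an operator on the fibre need not preserve the image of \<open>C*(G)\<close>; the operators of interest
  are limits of operators that do.
\<close>

definition op_cauchy :: "('g::group_add \<Rightarrow> 'g) \<Rightarrow> (nat \<Rightarrow> 'g cstar \<Rightarrow> 'g cstar) \<Rightarrow> bool" where
  "op_cauchy t F \<longleftrightarrow>
    (\<forall>n. linear (F n) \<and> (\<exists>F'. linear F' \<and> adjoint_pair t (F n) F') \<and> (\<exists>C. op_bound t (F n) C)) \<and>
    (\<forall>e>0. \<exists>N. \<forall>m\<ge>N. \<forall>n\<ge>N. op_bound t (\<lambda>a. F m a - F n a) e)"

text \<open>
  The limit of the maps \<open>F n\<close>, as an operator on the fibre.  Applying \<open>F n\<close> to the \<open>n\<close>-th term of a
  representative forms both limits at once and yields a Cauchy sequence in \<open>C*(G)\<close> again.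
\<close>

definition ext_op :: "('g::group_add \<Rightarrow> 'g) \<Rightarrow> (nat \<Rightarrow> 'g cstar \<Rightarrow> 'g cstar) \<Rightarrow>
    'g fibre_elem \<Rightarrow> 'g fibre_elem" where
  "ext_op t F = (\<lambda>\<xi>\<in>mcarrier (fibre t). fibre_class t (\<lambda>n. F n (fibre_rep \<xi> n)))"

context inj_endo
begin

text \<open>
  Beyond the index where all differences are bounded by \<open>1\<close>, the bounds can grow by \<open>1\<close> at most; the
  finitely many earlier ones are absorbed by their sum.
\<close>

lemma op_cauchy_bounded:
  assumes F: "op_cauchy t F"
  obtains C where "C > 0" "\<And>n. op_bound t (F n) C"
proof -
  obtain c where c: "\<And>n. op_bound t (F n) (c n)" using F unfolding op_cauchy_def by metis
  obtain N where N: "\<And>m n. m \<ge> N \<Longrightarrow> n \<ge> N \<Longrightarrow> op_bound t (\<lambda>a. F m a - F n a) 1"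
    using F unfolding op_cauchy_def by (metis zero_less_one)
  define C where "C = (\<Sum>k\<le>N. \<bar>c k\<bar>) + 1"
  have sum: "\<bar>c k\<bar> \<le> C - 1" if "k \<le> N" for k
    unfolding C_def using member_le_sum[of k "{..N}" "\<lambda>k. \<bar>c k\<bar>"] that by simp
  have "\<nu> (F n a) \<le> C * \<nu> a" for n a
  proof (cases "n \<le> N")
    case True
    have "\<nu> (F n a) \<le> c n * \<nu> a" by (rule op_boundD[OF c])
    also have "\<dots> \<le> C * \<nu> a" by (rule mult_right_mono) (use sum[OF True] in auto)
    finally show ?thesis .
  next
    case False
    have "\<nu> (F n a) \<le> \<nu> (F n a - F N a) + \<nu> (F N a)"
      using nu_triangle[of "F n a - F N a" "F N a"] by simp
    also have "\<dots> \<le> 1 * \<nu> a + c N * \<nu> a"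
      by (intro add_mono op_boundD[OF N] op_boundD[OF c]) (use False in auto)
    also have "\<dots> = (1 + c N) * \<nu> a" by (simp add: distrib_right)
    also have "\<dots> \<le> C * \<nu> a" by (rule mult_right_mono) (use sum[of N] in auto)
    finally show ?thesis .
  qed
  moreover have "C > 0" unfolding C_def by (simp add: sum_nonneg add_nonneg_pos)
  ultimately show thesis using that by (simp add: op_bound_def)
qed

lemma op_cauchy_diff: "op_cauchy t F \<Longrightarrow> F n (a - b) = F n a - F n b"
  by (simp add: op_cauchy_def linear_diff)

lemma op_cauchy_apply:
  assumes F: "op_cauchy t F" and X: "cauchy X"
  shows "cauchy (\<lambda>n. F n (X n))"
  unfolding seq_cauchy_def
proof (intro allI impI)
  fix e :: real assume "e > 0"
  obtain C where C: "C > 0" "\<And>n. op_bound t (F n) C" by (rule op_cauchy_bounded[OF F]) (rule that)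
  obtain K where K: "K > 0" "\<And>n. \<nu> (X n) \<le> K" by (rule nu_cauchy_bounded[OF X]) (rule that)
  have pos: "e / (2 * K) > 0" "e / (2 * C) > 0" using \<open>e > 0\<close> K(1) C(1) by simp_all
  obtain N where N: "\<And>m n. m \<ge> N \<Longrightarrow> n \<ge> N \<Longrightarrow> op_bound t (\<lambda>a. F m a - F n a) (e / (2 * K))"
    using F pos(1) unfolding op_cauchy_def by metis
  obtain N' where N': "\<And>m n. m \<ge> N' \<Longrightarrow> n \<ge> N' \<Longrightarrow> \<nu> (X m - X n) < e / (2 * C)"
    using seq_cauchyD[OF X pos(2)] by blast
  have "\<nu> (F m (X m) - F n (X n)) < e" if "m \<ge> max N N'" "n \<ge> max N N'" for m n
  proof -
    have "\<nu> (F m (X m) - F n (X n)) \<le> \<nu> (F m (X m) - F n (X m)) + \<nu> (F n (X m - X n))"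
      using nu_triangle[of "F m (X m) - F n (X m)" "F n (X m) - F n (X n)"]
      by (simp add: op_cauchy_diff[OF F])
    also have "\<dots> \<le> e / (2 * K) * \<nu> (X m) + C * \<nu> (X m - X n)"
      by (intro add_mono op_boundD[OF N] op_boundD[OF C(2)]) (use that in auto)
    also have "\<dots> < e / (2 * K) * K + C * (e / (2 * C))"
      by (intro add_le_less_mono mult_left_mono mult_strict_left_mono N' K C)
         (use that pos in auto)
    also have "\<dots> = e" using K(1) C(1) by simp
    finally show ?thesis .
  qed
  then show "\<exists>N. \<forall>m\<ge>N. \<forall>n\<ge>N. \<nu> (F m (X m) - F n (X n)) < e" by blast
qed

lemma ext_op_cls:
  assumes F: "op_cauchy t F" and X: "cauchy X"
  shows "ext_op t F (cls X) = cls (\<lambda>n. F n (X n))"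
proof -
  obtain C where C: "C > 0" "\<And>n. op_bound t (F n) C" by (rule op_cauchy_bounded[OF F]) (rule that)
  have "cls (\<lambda>n. F n (fibre_rep (cls X) n)) = cls (\<lambda>n. F n (X n))"
    by (rule cls_lipschitz_eqI[OF fibre_rep_cls[OF X], where C = C])
       (use op_boundD[OF C(2)] in
         \<open>simp_all add: op_cauchy_apply[OF F] cauchy_fibre_rep X op_cauchy_diff[OF F, symmetric]\<close>)
  then show ?thesis by (simp add: ext_op_def cls_carrier X)
qed

lemma ext_op_carrier: "op_cauchy t F \<Longrightarrow> ext_op t F \<in> mcarrier M \<rightarrow>\<^sub>E mcarrier M"
proof (rule PiE_I)
  fix \<xi> assume F: "op_cauchy t F" and "\<xi> \<in> mcarrier M"
  then obtain X where X: "cauchy X" "\<xi> = cls X" using carrierE by blast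
  then show "ext_op t F \<xi> \<in> mcarrier M"
    by (simp add: ext_op_cls[OF F] cls_carrier op_cauchy_apply[OF F])
qed (simp add: ext_op_def)

lemma op_cauchy_adjoint:
  assumes F: "op_cauchy t F"
  obtains F' where "op_cauchy t F'" "\<And>n. adjoint_pair t (F n) (F' n)"
proof -
  obtain F' where F': "\<And>n. linear (F' n)" "\<And>n. adjoint_pair t (F n) (F' n)"
    using F unfolding op_cauchy_def by metis
  have diff: "adjoint_pair t (\<lambda>a. F m a - F n a) (\<lambda>a. F' m a - F' n a)" for m n
    using F'(2)[of m] F'(2)[of n]
    by (simp add: adjoint_pair_def star_diff left_diff_distrib right_diff_distrib L_diff)
  have "op_cauchy t F'"
    unfolding op_cauchy_def
  proof (intro conjI allI impI)
    fix n
    show "linear (F' n)" by (rule F')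
    show "\<exists>G. linear G \<and> adjoint_pair t (F' n) G"
      using F adjoint_pair_sym[OF F'(2)] unfolding op_cauchy_def by blast
    show "\<exists>C. op_bound t (F' n) C"
      using F op_bound_adjoint[OF F'(2)] unfolding op_cauchy_def by blast
  next
    fix e :: real assume "e > 0"
    then show "\<exists>N. \<forall>m\<ge>N. \<forall>n\<ge>N. op_bound t (\<lambda>a. F' m a - F' n a) e"
      using F op_bound_adjoint[OF diff] unfolding op_cauchy_def by metis
  qed
  then show thesis using that F'(2) by blast
qed

lemma ext_op_adjointable:
  assumes F: "op_cauchy t F"
  shows "ext_op t F \<in> adjointable M"
proof -
  obtain F' where F': "op_cauchy t F'" "\<And>n. adjoint_pair t (F n) (F' n)"
    by (rule op_cauchy_adjoint[OF F]) (rule that)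
  have "ip M (ext_op t F \<xi>) \<eta> = ip M \<xi> (ext_op t F' \<eta>)"
    if \<xi>: "\<xi> \<in> mcarrier M" and \<eta>: "\<eta> \<in> mcarrier M" for \<xi> \<eta>
  proof -
    obtain X where X: "cauchy X" "\<xi> = cls X" by (rule carrierE[OF \<xi>]) (rule that)
    obtain Y where Y: "cauchy Y" "\<eta> = cls Y" by (rule carrierE[OF \<eta>]) (rule that)
    have "(\<lambda>n. L (star (F n (X n)) * Y n)) \<longlonglongrightarrow> ip M (ext_op t F \<xi>) \<eta>"
      unfolding X(2) Y(2) ext_op_cls[OF F X(1)] by (rule ip_tendsto[OF op_cauchy_apply[OF F X(1)] Y(1)])
    moreover have "(\<lambda>n. L (star (X n) * F' n (Y n))) \<longlonglongrightarrow> ip M \<xi> (ext_op t F' \<eta>)"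
      unfolding X(2) Y(2) ext_op_cls[OF F'(1) Y(1)] by (rule ip_tendsto[OF X(1) op_cauchy_apply[OF F'(1) Y(1)]])
    ultimately show ?thesis
      by (simp add: adjoint_pairD[OF F'(2)] LIMSEQ_unique)
  qed
  then show ?thesis
    unfolding adjointable_def using ext_op_carrier F F'(1) by blast
qed

lemma op_cauchy_compose:
  assumes F: "op_cauchy t F" and H: "op_cauchy t H"
  shows "op_cauchy t (\<lambda>n a. F n (H n a))"
    and "compose (mcarrier M) (ext_op t F) (ext_op t H) = ext_op t (\<lambda>n a. F n (H n a))"
proof -
  obtain F' where F': "op_cauchy t F'" "\<And>n. adjoint_pair t (F n) (F' n)"
    by (rule op_cauchy_adjoint[OF F]) (rule that)
  obtain H' where H': "op_cauchy t H'" "\<And>n. adjoint_pair t (H n) (H' n)"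
    by (rule op_cauchy_adjoint[OF H]) (rule that)
  obtain C where C: "C > 0" "\<And>n. op_bound t (F n) C" by (rule op_cauchy_bounded[OF F]) (rule that)
  obtain D where D: "D > 0" "\<And>n. op_bound t (H n) D" by (rule op_cauchy_bounded[OF H]) (rule that)
  have lin: "linear (\<lambda>a. G n (K n a))" if "op_cauchy t G" "op_cauchy t K" for G K n
    using that linear_compose[of "K n" "G n"] by (simp add: op_cauchy_def o_def)
  show FH: "op_cauchy t (\<lambda>n a. F n (H n a))"
    unfolding op_cauchy_def
  proof (intro conjI allI impI)
    fix n
    show "linear (\<lambda>a. F n (H n a))" by (rule lin[OF F H])
    show "\<exists>G. linear G \<and> adjoint_pair t (\<lambda>a. F n (H n a)) G"
      using lin[OF H'(1) F'(1)] F'(2)[of n] H'(2)[of n] by (auto simp: adjoint_pair_def)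
    have "\<nu> (F n (H n a)) \<le> C * (D * \<nu> a)" for a
      using order_trans[OF op_boundD[OF C(2)] mult_left_mono[OF op_boundD[OF D(2)]]] C(1) by simp
    then show "\<exists>E. op_bound t (\<lambda>a. F n (H n a)) E"
      by (intro exI[of _ "C * D"]) (simp add: op_bound_def mult.assoc)
  next
    fix e :: real assume e: "e > 0"
    have pos: "e / (2 * D) > 0" "e / (2 * C) > 0" using e C(1) D(1) by simp_all
    obtain N where N: "\<And>m n. m \<ge> N \<Longrightarrow> n \<ge> N \<Longrightarrow> op_bound t (\<lambda>a. F m a - F n a) (e / (2 * D))"
      using F pos(1) unfolding op_cauchy_def by metis
    obtain N' where N': "\<And>m n. m \<ge> N' \<Longrightarrow> n \<ge> N' \<Longrightarrow> op_bound t (\<lambda>a. H m a - H n a) (e / (2 * C))"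
      using H pos(2) unfolding op_cauchy_def by metis
    have "\<nu> (F m (H m a) - F n (H n a)) \<le> e * \<nu> a" if "m \<ge> max N N'" "n \<ge> max N N'" for m n a
    proof -
      have "\<nu> (F m (H m a) - F n (H n a)) \<le>
          \<nu> (F m (H m a) - F n (H m a)) + \<nu> (F n (H m a - H n a))"
        using nu_triangle[of "F m (H m a) - F n (H m a)" "F n (H m a) - F n (H n a)"]
        by (simp add: op_cauchy_diff[OF F])
      also have "\<dots> \<le> e / (2 * D) * \<nu> (H m a) + C * \<nu> (H m a - H n a)"
        by (intro add_mono op_boundD[OF N] op_boundD[OF C(2)]) (use that in auto)
      also have "\<dots> \<le> e / (2 * D) * (D * \<nu> a) + C * (e / (2 * C) * \<nu> a)"
        by (intro add_mono mult_left_mono op_boundD[OF N'] op_boundD[OF D(2)])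
           (use that pos C(1) in auto)
      also have "\<dots> = e * \<nu> a" using C(1) D(1) by simp
      finally show ?thesis .
    qed
    then show "\<exists>N. \<forall>m\<ge>N. \<forall>n\<ge>N. op_bound t (\<lambda>a. F m (H m a) - F n (H n a)) e"
      unfolding op_bound_def by blast
  qed
  show "compose (mcarrier M) (ext_op t F) (ext_op t H) = ext_op t (\<lambda>n a. F n (H n a))"
  proof (rule extensionalityI[of _ "mcarrier M"])
    fix \<xi> assume \<xi>: "\<xi> \<in> mcarrier M"
    obtain X where X: "cauchy X" "\<xi> = cls X" by (rule carrierE[OF \<xi>]) (rule that)
    have "ext_op t F (ext_op t H \<xi>) = ext_op t (\<lambda>n a. F n (H n a)) \<xi>"
      unfolding X(2)
      by (simp add: ext_op_cls F H FH X(1) op_cauchy_apply[OF H])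
    then show "compose (mcarrier M) (ext_op t F) (ext_op t H) \<xi> = ext_op t (\<lambda>n a. F n (H n a)) \<xi>"
      by (simp add: compose_eq \<xi>)
  qed (simp_all add: ext_op_def compose_extensional)
qed

lemma ext_op_approx:
  assumes F: "op_cauchy t F" and FN: "op_cauchy t (\<lambda>_. F N)" and \<xi>: "\<xi> \<in> mcarrier M"
    and e: "\<And>m. m \<ge> N \<Longrightarrow> op_bound t (\<lambda>a. F m a - F N a) e"
  shows "mdist M (ext_op t F \<xi>) (ext_op t (\<lambda>_. F N) \<xi>) \<le> e * mnorm M \<xi>"
proof -
  obtain X where X: "cauchy X" "\<xi> = cls X" by (rule carrierE[OF \<xi>]) (rule that)
  show ?thesis
    unfolding X(2) ext_op_cls[OF F X(1)] ext_op_cls[OF FN X(1)]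
  proof (rule LIMSEQ_le)
    show "(\<lambda>n. \<nu> (F n (X n) - F N (X n))) \<longlonglongrightarrow> mdist M (cls (\<lambda>n. F n (X n))) (cls (\<lambda>n. F N (X n)))"
      by (intro mdist_tendsto op_cauchy_apply[OF F] op_cauchy_apply[OF FN] X)
    show "(\<lambda>n. e * \<nu> (X n)) \<longlonglongrightarrow> e * mnorm M (cls X)"
      by (intro tendsto_mult_left mnorm_tendsto X)
    show "\<exists>N'. \<forall>n\<ge>N'. \<nu> (F n (X n) - F N (X n)) \<le> e * \<nu> (X n)"
      using op_boundD[OF e] by blast
  qed
qed

end

section \<open>Elementary operators\<close>

text \<open>
  The map that induces the rank-one operator with entries \<open>\<pi>(\<delta>\<^sub>g)\<close> and \<open>\<pi>(\<delta>\<^sub>h)\<close> on the fibre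
  (\<open>ext_op_rank_one\<close>).  Defined on \<open>C*(G)\<close>, it can be read on several fibres.
\<close>

definition elem_op :: "('g::group_add \<Rightarrow> 'g) \<Rightarrow> 'g \<Rightarrow> 'g \<Rightarrow> 'g cstar \<Rightarrow> 'g cstar" where
  "elem_op t g h = (\<lambda>x. delta g * alpha t (transfer_op t (delta (- h) * x)))"

inductive_set elem_span :: "('g::group_add \<Rightarrow> 'g) \<Rightarrow> ('g cstar \<Rightarrow> 'g cstar) set" for t where
  zero: "(\<lambda>x. 0) \<in> elem_span t"
| elem: "elem_op t g h \<in> elem_span t"
| add: "F \<in> elem_span t \<Longrightarrow> H \<in> elem_span t \<Longrightarrow> (\<lambda>x. F x + H x) \<in> elem_span t"
| scale: "F \<in> elem_span t \<Longrightarrow> (\<lambda>x. c *\<^sub>C F x) \<in> elem_span t"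

lemma elem_span_composition:
  assumes elem: "\<And>g h g' h'. (\<lambda>x. elem_op t g h (elem_op t' g' h' x)) \<in> elem_span t''"
    and clinear: "\<And>g h. bounded_clinear (elem_op t g h)"
    and F: "F \<in> elem_span t" and H: "H \<in> elem_span t'"
  shows "(\<lambda>x. F (H x)) \<in> elem_span t''"
  using F
proof induction
  case (elem g h)
  show ?case
    using H by induction
      (auto simp: bounded_clinear_zero[OF clinear] bounded_clinear_add[OF clinear]
        bounded_clinear_scaleC[OF clinear] intro: elem_span.intros assms(1))
qed (auto intro: elem_span.intros)

context inj_endo
begin

lemma bounded_clinear_elem_op: "bounded_clinear (elem_op t g h)"
  unfolding elem_op_def
  by (intro bounded_clinear_mult_left bounded_clinear_compose[OF bounded_clinear_alpha]
      bounded_clinear_compose[OF bounded_clinear_L] bounded_clinear_ident)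

lemma bounded_clinear_elem_span: "F \<in> elem_span t \<Longrightarrow> bounded_clinear F"
  by (induction rule: elem_span.induct) (auto intro: bounded_clinear_intros bounded_clinear_elem_op)

lemma linear_elem_span: "F \<in> elem_span t \<Longrightarrow> linear F"
  using bounded_clinear_elem_span bounded_linear.linear unfolding bounded_clinear_def by blast

text \<open>
  Right linearity of the induced operator, which lets it pass through the multiplication
  \<open>\<pi>\<^sub>p(a) \<pi>\<^sub>s(b) = \<pi>\<^bsub>ps\<^esub>(a \<alpha>\<^sub>p(b))\<close>.
\<close>

lemma elem_span_alpha: "F \<in> elem_span t \<Longrightarrow> F (x * \<alpha> b) = F x * \<alpha> b"
proof (induction rule: elem_span.induct)
  case (elem g h)
  then show ?case
    by (simp add: elem_op_def mult.assoc[symmetric] L_alpha_right)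
       (simp add: alpha_mult mult.assoc)
qed (simp_all add: distrib_right mult_scaleC_left)

lemma adjoint_pair_elem_op: "adjoint_pair t (elem_op t g h) (elem_op t h g)"
  unfolding adjoint_pair_def
proof (intro allI)
  fix a b
  have "star (L (delta (- h) * a)) = L (star a * delta h)"
    by (simp add: L_star[symmetric] star_mult star_delta)
  then show "L (star (elem_op t g h a) * b) = L (star a * elem_op t h g b)"
    by (simp add: elem_op_def star_mult alpha_star[symmetric] star_delta mult.assoc L_alpha_left)
       (simp add: mult.assoc[symmetric] L_alpha_right)
qed

lemma elem_span_adjoint: "F \<in> elem_span t \<Longrightarrow> \<exists>F'\<in>elem_span t. adjoint_pair t F F'"
proof (induction rule: elem_span.induct)
  case zero
  show ?case by (rule bexI[OF _ elem_span.zero]) (simp add: adjoint_pair_def)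
next
  case (elem g h)
  show ?case using adjoint_pair_elem_op elem_span.elem by blast
next
  case (add F H)
  then obtain F' H' where "F' \<in> elem_span t" "adjoint_pair t F F'" "H' \<in> elem_span t"
    "adjoint_pair t H H'" by blast
  then show ?case
    by (intro bexI[of _ "\<lambda>x. F' x + H' x"] elem_span.add)
       (simp_all add: adjoint_pair_def star_add distrib_left distrib_right L_add)
next
  case (scale F c)
  then obtain F' where "F' \<in> elem_span t" "adjoint_pair t F F'" by blast
  then show ?case
    by (intro bexI[of _ "\<lambda>x. cnj c *\<^sub>C F' x"] elem_span.scale)
       (simp_all add: adjoint_pair_def star_scaleC mult_scaleC_left mult_scaleC_right L_scaleC)
qed

lemma elem_span_bounded: "F \<in> elem_span t \<Longrightarrow> \<exists>C. op_bound t F C"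
proof (induction rule: elem_span.induct)
  case zero
  show ?case by (rule exI[of _ 0]) (simp add: op_bound_def)
next
  case (elem g h)
  have delta: "\<nu> (delta k) \<le> 1" for k using nu_le_norm[of "delta k"] by (simp add: norm_delta)
  have "\<nu> (elem_op t g h x) \<le> 1 * \<nu> x" for x
  proof -
    have "\<nu> (elem_op t g h x) \<le> \<nu> (delta g) * norm (L (delta (- h) * x))"
      unfolding elem_op_def by (rule nu_mult_alpha)
    also have "\<dots> \<le> 1 * (\<nu> (delta h) * \<nu> x)"
      using L_Cauchy_Schwarz[of "delta h" x] delta
      by (intro mult_mono) (simp_all add: star_delta)
    also have "\<dots> \<le> 1 * \<nu> x" using mult_right_mono[OF delta[of h], of "\<nu> x"] by simp
    finally show ?thesis .
  qed
  then show ?case unfolding op_bound_def by blast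
next
  case (add F H)
  then obtain C D where C: "op_bound t F C" and D: "op_bound t H D" by blast
  have "\<nu> (F a + H a) \<le> (C + D) * \<nu> a" for a
    using nu_triangle[of "F a" "H a"] op_boundD[OF C, of a] op_boundD[OF D, of a]
    by (simp add: distrib_right)
  then show ?case unfolding op_bound_def by blast
next
  case (scale F c)
  then obtain C where C: "op_bound t F C" by blast
  have "\<nu> (c *\<^sub>C F a) \<le> (cmod c * C) * \<nu> a" for a
    unfolding nu_scaleC mult.assoc by (rule mult_left_mono[OF op_boundD[OF C]]) simp
  then show ?case unfolding op_bound_def by blast
qed

lemma op_cauchy_elem_span:
  assumes "\<And>n. F n \<in> elem_span t"
    and "\<And>e. e > 0 \<Longrightarrow> \<exists>N. \<forall>m\<ge>N. \<forall>n\<ge>N. op_bound t (\<lambda>a. F m a - F n a) e"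
  shows "op_cauchy t F"
  unfolding op_cauchy_def
  using assms linear_elem_span elem_span_adjoint elem_span_bounded by metis

lemma op_cauchy_const: "F \<in> elem_span t \<Longrightarrow> op_cauchy t (\<lambda>_. F)"
  by (rule op_cauchy_elem_span) (auto simp: op_bound_def)

section \<open>Compact operators\<close>

lemma ext_op_eqI:
  assumes F: "op_cauchy t F" and T: "\<And>X. cauchy X \<Longrightarrow> T (cls X) = cls (\<lambda>n. F n (X n))"
  shows "(\<lambda>\<mu>\<in>mcarrier M. T \<mu>) = ext_op t F"
proof (rule extensionalityI[of _ "mcarrier M"])
  fix \<xi> assume \<xi>: "\<xi> \<in> mcarrier M"
  obtain X where X: "cauchy X" "\<xi> = cls X" by (rule carrierE[OF \<xi>]) (rule that)
  then show "(\<lambda>\<mu>\<in>mcarrier M. T \<mu>) \<xi> = ext_op t F \<xi>"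
    using \<xi> by (simp add: ext_op_cls[OF F] T)
qed (simp_all add: ext_op_def)

lemma ext_op_rank_one:
  "rank_one M (\<pi> (delta g)) (\<pi> (delta h)) = ext_op t (\<lambda>_. elem_op t g h)"
  unfolding rank_one_def
proof (rule ext_op_eqI[OF op_cauchy_const[OF elem_span.elem]])
  fix X assume X: "cauchy X"
  let ?b = "ip M (\<pi> (delta h)) (cls X)"
  have lim: "(\<lambda>n. L (delta (- h) * X n)) \<longlonglongrightarrow> ?b"
    using ip_tendsto[OF cauchy_const X, of "delta h"] by (simp add: star_delta)
  have "cls (\<lambda>n. delta g * \<alpha> ?b) = cls (\<lambda>n. elem_op t g h (X n))"
  proof (rule cls_eqI'[OF cauchy_const op_cauchy_apply[OF op_cauchy_const[OF elem_span.elem] X]])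
    have "(\<lambda>n. \<nu> (delta g) * norm (?b - L (delta (- h) * X n))) \<longlonglongrightarrow> \<nu> (delta g) * norm (?b - ?b)"
      by (intro tendsto_intros lim)
    then have "(\<lambda>n. \<nu> (delta g) * norm (?b - L (delta (- h) * X n))) \<longlonglongrightarrow> 0" by simp
    then show "(\<lambda>n. \<nu> (delta g * \<alpha> ?b - elem_op t g h (X n))) \<longlonglongrightarrow> 0"
    proof (rule tendsto_zero_le)
      show "\<nu> (delta g * \<alpha> ?b - elem_op t g h (X n)) \<le>
          \<nu> (delta g) * norm (?b - L (delta (- h) * X n))" for n
        unfolding elem_op_def right_diff_distrib[symmetric] alpha_diff[symmetric]
        by (rule nu_mult_alpha)
    qed simp
  qed
  then show "ract M (\<pi> (delta g)) ?b = cls (\<lambda>n. elem_op t g h (X n))"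
    by (simp add: ract_cls cauchy_const)
qed

lemma ext_op_rank_one_span: "F \<in> elem_span t \<Longrightarrow> ext_op t (\<lambda>_. F) \<in> rank_one_span M"
proof (induction rule: elem_span.induct)
  case zero
  have "(\<lambda>\<mu>\<in>mcarrier M. mzero M) = ext_op t (\<lambda>_ _. 0)"
    by (rule ext_op_eqI[OF op_cauchy_const[OF elem_span.zero]]) (simp add: fibre_def)
  then show ?case using rank_one_span.zero by metis
next
  case (elem g h)
  show ?case
    unfolding ext_op_rank_one[symmetric] by (intro rank_one_span.rank_one pi_carrier)
next
  case (add F H)
  note oc = op_cauchy_const[OF add(1)] op_cauchy_const[OF add(2)]
  have "(\<lambda>\<mu>\<in>mcarrier M. madd M (ext_op t (\<lambda>_. F) \<mu>) (ext_op t (\<lambda>_. H) \<mu>)) =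
      ext_op t (\<lambda>_ x. F x + H x)"
    by (rule ext_op_eqI[OF op_cauchy_const[OF elem_span.add[OF add(1,2)]]])
       (simp add: ext_op_cls oc madd_cls op_cauchy_apply[OF oc(1)] op_cauchy_apply[OF oc(2)])
  then show ?case using rank_one_span.add[OF add(3,4)] by metis
next
  case (scale F c)
  note oc = op_cauchy_const[OF scale(1)]
  have "(\<lambda>\<mu>\<in>mcarrier M. mscale M c (ext_op t (\<lambda>_. F) \<mu>)) = ext_op t (\<lambda>_ x. c *\<^sub>C F x)"
    by (rule ext_op_eqI[OF op_cauchy_const[OF elem_span.scale[OF scale(1)]]])
       (simp add: ext_op_cls oc mscale_cls op_cauchy_apply[OF oc])
  then show ?case using rank_one_span.scale[OF scale(2), of c] by metis
qed

lemma ext_op_compact: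
  assumes elem: "\<And>n. F n \<in> elem_span t" and F: "op_cauchy t F"
  shows "ext_op t F \<in> compacts M"
  unfolding compacts_def
proof (intro CollectI conjI allI impI)
  show "ext_op t F \<in> adjointable M" by (rule ext_op_adjointable[OF F])
  fix e :: real assume "e > 0"
  then obtain N where N: "\<And>m n. m \<ge> N \<Longrightarrow> n \<ge> N \<Longrightarrow> op_bound t (\<lambda>a. F m a - F n a) e"
    using F unfolding op_cauchy_def by metis
  show "\<exists>S\<in>rank_one_span M. \<forall>\<mu>\<in>mcarrier M. mdist M (ext_op t F \<mu>) (S \<mu>) \<le> e * mnorm M \<mu>"
  proof (intro bexI[of _ "ext_op t (\<lambda>_. F N)"] ballI)
    show "ext_op t (\<lambda>_. F N) \<in> rank_one_span M" by (rule ext_op_rank_one_span[OF elem])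
    show "mdist M (ext_op t F \<mu>) (ext_op t (\<lambda>_. F N) \<mu>) \<le> e * mnorm M \<mu>"
      if "\<mu> \<in> mcarrier M" for \<mu>
      by (rule ext_op_approx[OF F op_cauchy_const[OF elem] that N]) auto
  qed
qed

lemma elem_span_galg:
  "(\<lambda>x. cstar_of f * \<alpha> (L (star (cstar_of h) * x))) \<in> elem_span t"
proof -
  have "(\<lambda>x. delta g * \<alpha> (L (star (cstar_of h) * x))) \<in> elem_span t" for g
  proof (induction h rule: galg_induct)
    case zero
    show ?case
      using elem_span.zero
      by (simp add: cstar_of_zero L_zero bounded_clinear_zero[OF bounded_clinear_alpha])
  next
    case (single k v h)
    have "delta g * \<alpha> (L (star (cstar_of (Poly_Mapping.single k v + h)) * x)) =
        cnj v *\<^sub>C elem_op t g k x + delta g * \<alpha> (L (star (cstar_of h) * x))" for x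
      by (simp add: cstar_of_add cstar_of_single star_add star_scaleC star_delta distrib_right
          mult_scaleC_left L_add L_scaleC alpha_add alpha_scaleC distrib_left mult_scaleC_right
          elem_op_def)
    then show ?case
      using elem_span.add[OF elem_span.scale[OF elem_span.elem] single] by simp
  qed
  note delta = this
  show ?thesis
  proof (induction f rule: galg_induct)
    case zero
    show ?case using elem_span.zero by (simp add: cstar_of_zero)
  next
    case (single k v f)
    then show ?case
      using elem_span.add[OF elem_span.scale[OF delta] single]
      by (simp add: cstar_of_add cstar_of_single distrib_right mult_scaleC_left)
  qed
qed

lemma galg_dense:
  assumes "\<xi> \<in> mcarrier M" "e > 0"
  obtains f where "mdist M \<xi> (\<pi> (cstar_of f)) < e"
proof -
  obtain X where X: "cauchy X" "\<xi> = cls X" by (rule carrierE[OF assms(1)]) (rule that)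
  have "e / 2 > 0" using assms(2) by simp
  then obtain n where n: "mdist M \<xi> (\<pi> (X n)) < e / 2"
    using eventually_happens'[OF sequentially_bot order_tendstoD(2)[OF pi_dense[OF X(1)]]]
    unfolding X(2) by blast
  obtain f where "norm (X n - cstar_of f) < e / 2"
    using cstar_of_approx[OF \<open>e / 2 > 0\<close>] by blast
  then have "mdist M (\<pi> (X n)) (\<pi> (cstar_of f)) < e / 2"
    unfolding mdist_pi using nu_le_norm order_le_less_trans by blast
  then show thesis
    using n mdist_triangle[OF assms(1) pi_carrier pi_carrier, of "cstar_of f" "X n"]
    by (intro that[of f]) linarith
qed

lemma ract_carrier: "\<xi> \<in> mcarrier M \<Longrightarrow> ract M \<xi> b \<in> mcarrier M"
  by (elim carrierE) (simp add: ract_cls cls_carrier cauchy_mult_alpha)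

lemma madd_carrier: "\<xi> \<in> mcarrier M \<Longrightarrow> \<eta> \<in> mcarrier M \<Longrightarrow> madd M \<xi> \<eta> \<in> mcarrier M"
  by (elim carrierE) (simp add: madd_cls cls_carrier cauchy_add)

lemma mscale_carrier: "\<xi> \<in> mcarrier M \<Longrightarrow> mscale M c \<xi> \<in> mcarrier M"
  by (elim carrierE) (simp add: mscale_cls cls_carrier cauchy_scaleC)

lemma mdist_madd_pi:
  assumes "\<xi> \<in> mcarrier M" "\<eta> \<in> mcarrier M"
  shows "mdist M (madd M \<xi> \<eta>) (\<pi> (x + y)) \<le> mdist M \<xi> (\<pi> x) + mdist M \<eta> (\<pi> y)"
proof -
  obtain X where X: "cauchy X" "\<xi> = cls X" by (rule carrierE[OF assms(1)]) (rule that)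
  obtain Y where Y: "cauchy Y" "\<eta> = cls Y" by (rule carrierE[OF assms(2)]) (rule that)
  show ?thesis
    unfolding X(2) Y(2) madd_cls[OF X(1) Y(1)]
  proof (rule LIMSEQ_le[OF mdist_tendsto[OF cauchy_add[OF X(1) Y(1)] cauchy_const]
        tendsto_add[OF mdist_tendsto[OF X(1) cauchy_const] mdist_tendsto[OF Y(1) cauchy_const]]])
    show "\<exists>N. \<forall>n\<ge>N. \<nu> (X n + Y n - (x + y)) \<le> \<nu> (X n - x) + \<nu> (Y n - y)"
      using nu_triangle[of "X n - x" "Y n - y" for n] by (simp add: algebra_simps)
  qed
qed

lemma mdist_mscale_pi:
  assumes "\<xi> \<in> mcarrier M"
  shows "mdist M (mscale M c \<xi>) (\<pi> (c *\<^sub>C x)) = cmod c * mdist M \<xi> (\<pi> x)"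
proof -
  obtain X where X: "cauchy X" "\<xi> = cls X" by (rule carrierE[OF assms(1)]) (rule that)
  have "\<nu> (c *\<^sub>C X n - c *\<^sub>C x) = cmod c * \<nu> (X n - x)" for n
    using nu_scaleC[of c "X n - x"] scaleC_add_right[of c "X n - x" x] by simp
  then show ?thesis
    unfolding X(2) mscale_cls[OF X(1)]
    using mdist_tendsto[OF cauchy_scaleC[OF X(1)] cauchy_const, of c "c *\<^sub>C x"]
      tendsto_mult_left[OF mdist_tendsto[OF X(1) cauchy_const], of "cmod c" x] LIMSEQ_unique
    by simp
qed

lemma mdist_ract_pi:
  assumes "\<xi> \<in> mcarrier M"
  shows "mdist M (ract M \<xi> b) (\<pi> (y * \<alpha> c)) \<le> mdist M \<xi> (\<pi> y) * norm b + \<nu> y * norm (b - c)"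
proof -
  obtain X where X: "cauchy X" "\<xi> = cls X" by (rule carrierE[OF assms(1)]) (rule that)
  have le: "\<nu> (X n * \<alpha> b - y * \<alpha> c) \<le> \<nu> (X n - y) * norm b + \<nu> y * norm (b - c)" for n
  proof -
    have eq: "X n * \<alpha> b - y * \<alpha> c = (X n - y) * \<alpha> b + y * \<alpha> (b - c)"
      by (simp add: left_diff_distrib right_diff_distrib alpha_diff)
    show ?thesis
      unfolding eq
      using nu_triangle[of "(X n - y) * \<alpha> b" "y * \<alpha> (b - c)"] nu_mult_alpha[of "X n - y" b]
        nu_mult_alpha[of y "b - c"] by linarith
  qed
  show ?thesis
    unfolding X(2) ract_cls[OF X(1)]
    by (rule LIMSEQ_le[OF mdist_tendsto[OF cauchy_mult_alpha[OF X(1)] cauchy_const]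
          tendsto_add[OF tendsto_mult_right[OF mdist_tendsto[OF X(1) cauchy_const]] tendsto_const]])
       (use le in blast)
qed

lemma ip_Cauchy_Schwarz:
  assumes "\<xi> \<in> mcarrier M" "\<eta> \<in> mcarrier M"
  shows "norm (ip M \<xi> \<eta>) \<le> mnorm M \<xi> * mnorm M \<eta>"
proof -
  obtain X where X: "cauchy X" "\<xi> = cls X" by (rule carrierE[OF assms(1)]) (rule that)
  obtain Y where Y: "cauchy Y" "\<eta> = cls Y" by (rule carrierE[OF assms(2)]) (rule that)
  show ?thesis
    unfolding X(2) Y(2)
    by (rule LIMSEQ_le[OF tendsto_norm[OF ip_tendsto[OF X(1) Y(1)]]
          tendsto_mult[OF mnorm_tendsto[OF X(1)] mnorm_tendsto[OF Y(1)]]])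
       (auto intro: L_Cauchy_Schwarz)
qed

lemma ip_pi: "ip M (\<pi> a) (\<pi> b) = L (star a * b)"
  using ip_tendsto[OF cauchy_const cauchy_const, of a b] by (simp add: LIMSEQ_const_iff)

text \<open>
  Replace the entries by elements of the group algebra.  The error has one part for each entry; the
  second one is weighted with the seminorm of \<open>f\<close>, so \<open>f\<close> is chosen before \<open>h\<close>.
\<close>

lemma rank_one_approx:
  assumes \<xi>: "\<xi> \<in> mcarrier M" and \<eta>: "\<eta> \<in> mcarrier M" and e: "e > 0"
  obtains F where "F \<in> elem_span t"
    "\<And>a. mdist M (rank_one M \<xi> \<eta> (\<pi> a)) (\<pi> (F a)) \<le> e * \<nu> a"
proof -
  have pos: "e / (2 * (mnorm M \<eta> + 1)) > 0"
    using e mnorm_nonneg[of \<eta>] by simp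
  obtain f where f: "mdist M \<xi> (\<pi> (cstar_of f)) < e / (2 * (mnorm M \<eta> + 1))"
    by (rule galg_dense[OF \<xi> pos]) (rule that)
  have pos': "e / (2 * (\<nu> (cstar_of f) + 1)) > 0"
    using e by (intro divide_pos_pos mult_pos_pos add_nonneg_pos nu_nonneg) simp_all
  obtain h where h: "mdist M \<eta> (\<pi> (cstar_of h)) < e / (2 * (\<nu> (cstar_of f) + 1))"
    by (rule galg_dense[OF \<eta> pos']) (rule that)
  define F where "F = (\<lambda>x. cstar_of f * \<alpha> (L (star (cstar_of h) * x)))"
  have "mdist M (rank_one M \<xi> \<eta> (\<pi> a)) (\<pi> (F a)) \<le> e * \<nu> a" for a
  proof -
    obtain Y where Y: "cauchy Y" "\<eta> = cls Y" by (rule carrierE[OF \<eta>]) (rule that)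
    let ?b = "ip M \<eta> (\<pi> a)" and ?c = "L (star (cstar_of h) * a)"
    have b: "norm ?b \<le> mnorm M \<eta> * \<nu> a"
      using ip_Cauchy_Schwarz[OF \<eta> pi_carrier] by (simp add: mnorm_pi)
    have c: "norm (?b - ?c) \<le> mdist M \<eta> (\<pi> (cstar_of h)) * \<nu> a"
      using ip_diff_bound[OF Y(1) cauchy_const cauchy_const, of a "cstar_of h"]
      by (simp add: ip_pi mnorm_pi Y(2))
    have "mdist M (rank_one M \<xi> \<eta> (\<pi> a)) (\<pi> (F a)) \<le>
        mdist M \<xi> (\<pi> (cstar_of f)) * norm ?b + \<nu> (cstar_of f) * norm (?b - ?c)"
      using mdist_ract_pi[OF \<xi>] by (simp add: rank_one_def pi_carrier F_def)
    also have "\<dots> \<le> e / (2 * (mnorm M \<eta> + 1)) * (mnorm M \<eta> * \<nu> a) +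
        \<nu> (cstar_of f) * (e / (2 * (\<nu> (cstar_of f) + 1)) * \<nu> a)"
      by (intro add_mono mult_mono mult_left_mono b
          order_trans[OF c mult_right_mono] less_imp_le[OF f] less_imp_le[OF h]
          nu_nonneg norm_ge_zero less_imp_le[OF pos] order_refl)
    also have "\<dots> \<le> e / 2 * \<nu> a + e / 2 * \<nu> a"
    proof -
      have frac: "e / (2 * (k + 1)) * k \<le> e / 2" if "k \<ge> 0" for k :: real
        using that e by (simp add: field_simps)
      show ?thesis
        using add_mono[OF mult_right_mono[OF frac[OF mnorm_nonneg[of \<eta>]] nu_nonneg[of a]]
            mult_right_mono[OF frac[OF nu_nonneg[of "cstar_of f"]] nu_nonneg[of a]]]
        by (simp only: mult_ac)
    qed
    also have "\<dots> = e * \<nu> a" by simp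
    finally show ?thesis .
  qed
  then show thesis using that[of F] elem_span_galg by (simp add: F_def)
qed

text \<open>
  Errors are compared on the images of \<open>C*(G)\<close> only.  The first conjunct is carried along for the
  induction, since the module operations are controlled on the carrier only.
\<close>

lemma rank_one_span_approx:
  assumes "S \<in> rank_one_span M"
  shows "S \<in> mcarrier M \<rightarrow> mcarrier M \<and>
    (\<forall>e>0. \<exists>F\<in>elem_span t. \<forall>a. mdist M (S (\<pi> a)) (\<pi> (F a)) \<le> e * \<nu> a)"
  using assms
proof induction
  case zero
  have "mzero M = \<pi> 0" by (simp add: fibre_def)
  then show ?case
    using elem_span.zero by (auto simp: pi_carrier mdist_pi intro!: bexI[of _ "\<lambda>x. 0"])
next
  case (rank_one \<xi> \<eta>)
  have "\<exists>F\<in>elem_span t. \<forall>a. mdist M (rank_one M \<xi> \<eta> (\<pi> a)) (\<pi> (F a)) \<le> e * \<nu> a" if "e > 0" for e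
    by (rule rank_one_approx[OF rank_one that]) blast
  moreover have "rank_one M \<xi> \<eta> \<in> mcarrier M \<rightarrow> mcarrier M"
    using rank_one by (auto simp: rank_one_def ract_carrier)
  ultimately show ?case by blast
next
  case (add S T)
  then have ST: "S (\<pi> a) \<in> mcarrier M" "T (\<pi> a) \<in> mcarrier M" for a
    using pi_carrier by auto
  have "\<exists>F\<in>elem_span t. \<forall>a. mdist M ((\<lambda>\<mu>\<in>mcarrier M. madd M (S \<mu>) (T \<mu>)) (\<pi> a)) (\<pi> (F a)) \<le> e * \<nu> a"
    if "e > 0" for e
  proof -
    have "e / 2 > 0" using that by simp
    then obtain F H where F: "F \<in> elem_span t" "\<And>a. mdist M (S (\<pi> a)) (\<pi> (F a)) \<le> e / 2 * \<nu> a"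
      and H: "H \<in> elem_span t" "\<And>a. mdist M (T (\<pi> a)) (\<pi> (H a)) \<le> e / 2 * \<nu> a"
      using add.IH by meson
    have "mdist M (madd M (S (\<pi> a)) (T (\<pi> a))) (\<pi> (F a + H a)) \<le> e * \<nu> a" for a
      using mdist_madd_pi[OF ST, of a a "F a" "H a"] F(2)[of a] H(2)[of a] by simp
    then show ?thesis
      by (intro bexI[of _ "\<lambda>x. F x + H x"] elem_span.add F H) (simp add: pi_carrier)
  qed
  with add show ?case by (auto simp: madd_carrier Pi_iff)
next
  case (scale S c)
  then have S: "S (\<pi> a) \<in> mcarrier M" for a using pi_carrier by auto
  have "\<exists>F\<in>elem_span t. \<forall>a. mdist M ((\<lambda>\<mu>\<in>mcarrier M. mscale M c (S \<mu>)) (\<pi> a)) (\<pi> (F a)) \<le> e * \<nu> a"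
    if "e > 0" for e
  proof -
    have pos: "e / (cmod c + 1) > 0" using that by (simp add: add_nonneg_pos)
    then obtain F where F: "F \<in> elem_span t" "\<And>a. mdist M (S (\<pi> a)) (\<pi> (F a)) \<le> e / (cmod c + 1) * \<nu> a"
      using scale.IH by meson
    have "mdist M (mscale M c (S (\<pi> a))) (\<pi> (c *\<^sub>C F a)) \<le> e * \<nu> a" for a
    proof -
      have "mdist M (mscale M c (S (\<pi> a))) (\<pi> (c *\<^sub>C F a)) \<le> (cmod c + 1) * (e / (cmod c + 1) * \<nu> a)"
        unfolding mdist_mscale_pi[OF S]
        by (intro mult_mono F mdist_nonneg) auto
      also have "\<dots> = e * \<nu> a" using norm_ge_zero[of c] by (simp add: add_nonneg_eq_0_iff)
      finally show ?thesis .
    qed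
    then show ?thesis
      by (intro bexI[of _ "\<lambda>x. c *\<^sub>C F x"] elem_span.scale F) (simp add: pi_carrier)
  qed
  with scale show ?case by (auto simp: mscale_carrier Pi_iff)
qed

text \<open>
  If \<open>F n\<close> is within \<open>1/(n+1)\<close> of \<open>T\<close> on the image of \<open>C*(G)\<close>, then \<open>F\<close> is Cauchy in the operator norm
  and converges to \<open>T\<close> there.  This determines \<open>T\<close>, because \<open>T\<close> is adjointable.
\<close>

lemma compact_ext_op:
  assumes T: "T \<in> compacts M"
  obtains F where "\<And>n. F n \<in> elem_span t" "op_cauchy t F" "T = ext_op t F"
proof -
  have TM: "T (\<pi> a) \<in> mcarrier M" for a
    using T pi_carrier by (auto simp: compacts_def adjointable_def)
  have "\<exists>F\<in>elem_span t. \<forall>a. mdist M (T (\<pi> a)) (\<pi> (F a)) \<le> e * \<nu> a" if "e > 0" for e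
  proof -
    have "e / 2 > 0" using that by simp
    then obtain S where S: "S \<in> rank_one_span M"
      "\<And>\<mu>. \<mu> \<in> mcarrier M \<Longrightarrow> mdist M (T \<mu>) (S \<mu>) \<le> e / 2 * mnorm M \<mu>"
      using T unfolding compacts_def by blast
    obtain F where F: "F \<in> elem_span t" "\<And>a. mdist M (S (\<pi> a)) (\<pi> (F a)) \<le> e / 2 * \<nu> a"
      using rank_one_span_approx[OF S(1)] \<open>e / 2 > 0\<close> by blast
    have "mdist M (T (\<pi> a)) (\<pi> (F a)) \<le> e * \<nu> a" for a
    proof -
      have "S (\<pi> a) \<in> mcarrier M" using rank_one_span_approx[OF S(1)] pi_carrier by auto
      from mdist_triangle[OF TM this pi_carrier, of a "F a"] show ?thesis
        using S(2)[OF pi_carrier, of a] F(2)[of a] distrib_right[of "e / 2" "e / 2" "\<nu> a"]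
        unfolding mnorm_pi field_sum_of_halves by linarith
    qed
    with F(1) show ?thesis by blast
  qed
  then have "\<forall>n. \<exists>F\<in>elem_span t. \<forall>a. mdist M (T (\<pi> a)) (\<pi> (F a)) \<le> inverse (real (Suc n)) * \<nu> a"
    by simp
  then obtain F where F: "\<And>n. F n \<in> elem_span t"
    "\<And>n a. mdist M (T (\<pi> a)) (\<pi> (F n a)) \<le> inverse (real (Suc n)) * \<nu> a"
    by metis
  have oc: "op_cauchy t F"
  proof (rule op_cauchy_elem_span[OF F(1)])
    fix e :: real assume "e > 0"
    then obtain N where N: "inverse (real (Suc N)) < e / 2"
      using reals_Archimedean[of "e / 2"] by auto
    have "\<nu> (F m a - F n a) \<le> e * \<nu> a" if "m \<ge> N" "n \<ge> N" for m n a
    proof -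
      have inv: "inverse (real (Suc k)) \<le> e / 2" if "k \<ge> N" for k
        using N le_imp_inverse_le[of "real (Suc N)" "real (Suc k)"] that by linarith
      obtain Z where Z: "cauchy Z" "T (\<pi> a) = cls Z" by (rule carrierE[OF TM[of a]]) (rule that)
      have "\<nu> (F m a - F n a) \<le> mdist M (T (\<pi> a)) (\<pi> (F m a)) + mdist M (T (\<pi> a)) (\<pi> (F n a))"
        using mdist_triangle[OF pi_carrier TM pi_carrier, of "F m a" "F n a" a]
          mdist_commute[OF Z(1) cauchy_const, of "F m a"] by (simp add: mdist_pi Z(2))
      also have "\<dots> \<le> e / 2 * \<nu> a + e / 2 * \<nu> a"
        by (intro add_mono order_trans[OF F(2) mult_right_mono] inv that nu_nonneg)
      also have "\<dots> = e * \<nu> a" by simp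
      finally show ?thesis .
    qed
    then show "\<exists>N. \<forall>m\<ge>N. \<forall>n\<ge>N. op_bound t (\<lambda>a. F m a - F n a) e"
      unfolding op_bound_def by blast
  qed
  have "T = ext_op t F"
  proof (rule adjointable_eqI[OF _ ext_op_adjointable[OF oc]])
    show "T \<in> adjointable M" using T by (simp add: compacts_def)
    fix a
    let ?W = "\<lambda>n. F n a"
    have W: "cauchy ?W" by (rule op_cauchy_apply[OF oc cauchy_const])
    obtain Z where Z: "cauchy Z" "T (\<pi> a) = cls Z" by (rule carrierE[OF TM[of a]]) (rule that)
    have "(\<lambda>n. inverse (real (Suc n)) * \<nu> a + mdist M (cls ?W) (\<pi> (?W n))) \<longlonglongrightarrow> 0 * \<nu> a + 0"
      by (intro tendsto_add tendsto_mult_right LIMSEQ_inverse_real_of_nat pi_dense[OF W])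
    moreover have "mdist M (cls Z) (cls ?W) \<le>
        inverse (real (Suc n)) * \<nu> a + mdist M (cls ?W) (\<pi> (?W n))" for n
      using mdist_triangle[OF cls_carrier[OF Z(1)] pi_carrier cls_carrier[OF W], of "?W n"]
        F(2)[of a n] mdist_commute[OF W cauchy_const, of "?W n"] by (simp add: Z(2))
    ultimately have "mdist M (cls Z) (cls ?W) \<le> 0"
      by (intro LIMSEQ_le_const) auto
    then have "mdist M (cls Z) (cls ?W) = 0" using mdist_nonneg by (intro antisym)
    then show "T (\<pi> a) = ext_op t F (\<pi> a)"
      by (simp add: Z(2) ext_op_cls[OF oc cauchy_const] mdist_zero_iff[OF Z(1) W])
  qed
  then show thesis using that F(1) oc by blast
qed

section \<open>Products of elementary operators\<close>

lemma elem_op_delta: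
  "elem_op t g h (delta k) = (if - h + k \<in> range t then delta (g + (- h + k)) else 0)"
  by (auto simp: elem_op_def delta_add[symmetric] L_delta alpha_delta
      bounded_clinear_zero[OF bounded_clinear_alpha])

lemma range_add_left_iff: "a \<in> range t \<Longrightarrow> a + b \<in> range t \<longleftrightarrow> b \<in> range t"
  using range_add[of "- a" "a + b"] range_add[of a b] range_uminus[of a] by auto

end

text \<open>
  The product keeps the \<open>\<delta>\<^sub>k\<close> whose index \<open>k\<close> meets a coset condition for \<open>t2\<close> and one for \<open>t1\<close>, and
  translates them all on the left by the same element.  Once some \<open>k0\<close> meets both conditions, the
  others that do are those in \<open>k0 + range t3\<close>.
\<close>

lemma elem_op_composition:
  assumes "inj_endo t1" "inj_endo t2" "inj_endo t3" and int: "range t1 \<inter> range t2 = range t3"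
  shows "(\<lambda>x. elem_op t1 g h (elem_op t2 g' h' x)) \<in> elem_span t3"
proof -
  interpret t1: inj_endo t1 by fact
  interpret t2: inj_endo t2 by fact
  interpret t3: inj_endo t3 by fact
  let ?C = "\<lambda>x. elem_op t1 g h (elem_op t2 g' h' x)"
  let ?P = "\<lambda>k. - h' + k \<in> range t2 \<and> - h + (g' + (- h' + k)) \<in> range t1"
  have C: "bounded_clinear ?C"
    by (rule bounded_clinear_compose[OF t1.bounded_clinear_elem_op t2.bounded_clinear_elem_op])
  have Cd: "?C (delta k) = (if ?P k then delta (g + (- h + (g' + (- h' + k)))) else 0)" for k
    by (simp add: t1.elem_op_delta t2.elem_op_delta bounded_clinear_zero[OF t1.bounded_clinear_elem_op])
  show ?thesis
  proof (cases "\<exists>k. ?P k")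
    case False
    then have "\<not> ?P k" for k by blast
    then have "?C x = 0" for x
      by (intro bounded_clinear_eqI[OF C bounded_clinear_zero_map, of x]) (simp only: Cd if_False)
    then have "?C = (\<lambda>x. 0)" by (rule ext)
    then show ?thesis using elem_span.zero by metis
  next
    case True
    then obtain k0 where k0: "?P k0" by blast
    have P: "?P k \<longleftrightarrow> - k0 + k \<in> range t3" for k
    proof -
      have "- h' + k = (- h' + k0) + (- k0 + k)"
        "- h + (g' + (- h' + k)) = (- h + (g' + (- h' + k0))) + (- k0 + k)"
        by (simp_all add: add.assoc del: add_uminus_conv_diff)
      then show ?thesis
        using k0 t1.range_add_left_iff t2.range_add_left_iff int by (metis IntE IntI)
    qed
    let ?g = "g + (- h + (g' + (- h' + k0)))"
    have "?C = elem_op t3 ?g k0"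
    proof
      fix x
      show "?C x = elem_op t3 ?g k0 x"
      proof (rule bounded_clinear_eqI[OF C t3.bounded_clinear_elem_op])
        show "?C (delta k) = elem_op t3 ?g k0 (delta k)" for k
          unfolding Cd P t3.elem_op_delta
          by (simp add: add.assoc del: add_uminus_conv_diff)
      qed
    qed
    then show ?thesis using elem_span.elem by metis
  qed
qed

section \<open>Extending operators along the multiplication\<close>

context inj_endo_comp
begin

lemma op_cauchy_comp:
  assumes F: "op_cauchy t F"
  shows "op_cauchy (t \<circ> s) F"
proof -
  obtain F' where F': "op_cauchy t F'" "\<And>n. adjoint_pair t (F n) (F' n)"
    by (rule t.op_cauchy_adjoint[OF F]) (rule that)
  obtain C where C: "C > 0" "\<And>n. op_bound t (F n) C"
    by (rule t.op_cauchy_bounded[OF F]) (rule that)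
  show ?thesis
    unfolding op_cauchy_def
  proof (intro conjI allI impI)
    fix n
    show "linear (F n)" using F by (simp add: op_cauchy_def)
    show "\<exists>F'. linear F' \<and> adjoint_pair (t \<circ> s) (F n) F'"
      using F adjoint_pair_comp unfolding op_cauchy_def by blast
    show "\<exists>C. op_bound (t \<circ> s) (F n) C"
      using op_bound_comp[OF F'(2) C(2)] C(1) by auto
  next
    fix e :: real assume "e > 0"
    moreover have "adjoint_pair t (\<lambda>a. F m a - F n a) (\<lambda>a. F' m a - F' n a)" for m n
      using F'(2)[of m] F'(2)[of n]
      by (simp add: adjoint_pair_def star_diff left_diff_distrib right_diff_distrib t.L_diff)
    ultimately show "\<exists>N. \<forall>m\<ge>N. \<forall>n\<ge>N. op_bound (t \<circ> s) (\<lambda>a. F m a - F n a) e"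
      using F op_bound_comp unfolding op_cauchy_def by (meson less_imp_le)
  qed
qed

lemma nu_comp_mult_diff:
  "ts.\<nu> (x * t.\<alpha> y - x' * t.\<alpha> y') \<le> t.\<nu> x * s.\<nu> (y - y') + t.\<nu> (x - x') * s.\<nu> y'"
proof -
  have eq: "x * t.\<alpha> y - x' * t.\<alpha> y' = x * t.\<alpha> (y - y') + (x - x') * t.\<alpha> y'"
    by (simp add: t.alpha_diff right_diff_distrib left_diff_distrib)
  show ?thesis
    unfolding eq
    using ts.nu_triangle[of "x * t.\<alpha> (y - y')" "(x - x') * t.\<alpha> y'"]
      nu_comp_mult[of x "y - y'"] nu_comp_mult[of "x - x'" y'] by linarith
qed

lemma cauchy_comp_mult:
  assumes X: "t.cauchy X" and Y: "s.cauchy Y"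
  shows "ts.cauchy (\<lambda>n. X n * t.\<alpha> (Y n))"
proof -
  obtain K where K: "K > 0" "\<And>n. t.\<nu> (X n) \<le> K"
    by (rule t.nu_cauchy_bounded[OF X]) (rule that)
  obtain K' where K': "K' > 0" "\<And>n. s.\<nu> (Y n) \<le> K'"
    by (rule s.nu_cauchy_bounded[OF Y]) (rule that)
  show ?thesis
    by (rule seq_cauchy_bilinear[where B = "\<lambda>x y. x * t.\<alpha> y", OF nu_comp_mult_diff _ _ X K Y K'])
       simp_all
qed

text \<open>
  The Leibniz estimate for \<open>(x, y) \<mapsto> x \<alpha>\<^sub>t(y)\<close> makes the difference of the two sequences a null
  sequence, so the multiplication of fibres may be computed on any representatives.
\<close>

lemma mult_rep_cls:
  assumes X: "t.cauchy X" and Y: "s.cauchy Y"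
  shows "ts.cls (\<lambda>n. fibre_rep (t.cls X) n * t.\<alpha> (fibre_rep (s.cls Y) n)) =
    ts.cls (\<lambda>n. X n * t.\<alpha> (Y n))"
proof -
  note X' = t.cauchy_fibre_rep[OF X] and Y' = s.cauchy_fibre_rep[OF Y]
  obtain K where K: "K > 0" "\<And>n. t.\<nu> (fibre_rep (t.cls X) n) \<le> K"
    by (rule t.nu_cauchy_bounded[OF X']) (rule that)
  obtain K' where K': "K' > 0" "\<And>n. s.\<nu> (Y n) \<le> K'"
    by (rule s.nu_cauchy_bounded[OF Y]) (rule that)
  have z: "(\<lambda>n. t.\<nu> (fibre_rep (t.cls X) n - X n)) \<longlonglongrightarrow> 0"
    "(\<lambda>n. s.\<nu> (fibre_rep (s.cls Y) n - Y n)) \<longlonglongrightarrow> 0"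
    using t.fibre_rep_cls[OF X] s.fibre_rep_cls[OF Y] by (simp_all add: seq_equiv_def)
  show ?thesis
    by (rule ts.cls_eqI'[OF cauchy_comp_mult[OF X' Y'] cauchy_comp_mult[OF X Y]
          bilinear_tendsto_zero[where B = "\<lambda>x y. x * t.\<alpha> y",
            OF nu_comp_mult_diff ts.nu_nonneg t.nu_nonneg s.nu_nonneg K(2) z(1) K'(2) z(2)]])
qed

end

context algebraic_dynamical_system
begin

lemma inj_endo: "inj_endo (\<theta> p)"
  by unfold_locales (rule theta_hom theta_inj)+

lemma inj_endo_comp: "inj_endo_comp (\<theta> p) (\<theta> s)"
  by (simp add: inj_endo_comp_def inj_endo)

text \<open>
  The same sequence of maps on \<open>C*(G)\<close>, read on the fibre of \<open>p * s\<close>, has the property that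
  characterises \<open>\<iota>\<close>, by right linearity of its terms.  It is the only adjointable operator to do so
  because \<open>\<pi>\<^bsub>ps\<^esub>(a) = \<pi>\<^sub>p(a) \<pi>\<^sub>s(1)\<close>, so that its values on the image of \<open>C*(G)\<close> are prescribed.
\<close>

lemma iota_ext_op:
  assumes elem: "\<And>n. F n \<in> elem_span (\<theta> p)" and F: "op_cauchy (\<theta> p) F"
  shows "op_cauchy (\<theta> (p * s)) F"
    and "iota (ads_product_system \<theta>) p (p * s) (ext_op (\<theta> p) F) = ext_op (\<theta> (p * s)) F"
proof -
  interpret c: inj_endo_comp "\<theta> p" "\<theta> s" by (rule inj_endo_comp)
  let ?A = "ads_product_system \<theta>"
  have fib: "fib ?A q = fibre (\<theta> q)" for q by (simp add: ads_product_system_def)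
  have mul: "mul ?A p s (c.t.cls X) (c.s.cls Y) = c.ts.cls (\<lambda>n. X n * c.t.\<alpha> (Y n))"
    if "c.t.cauchy X" "c.s.cauchy Y" for X Y
    using c.mult_rep_cls[OF that] by (simp add: ads_product_system_def theta_mult)
  have Fr: "op_cauchy (\<theta> p \<circ> \<theta> s) F" by (rule c.op_cauchy_comp[OF F])
  then show "op_cauchy (\<theta> (p * s)) F" by (simp add: theta_mult)
  have ext_mul: "ext_op (\<theta> p \<circ> \<theta> s) F (mul ?A p s \<xi> \<eta>) = mul ?A p s (ext_op (\<theta> p) F \<xi>) \<eta>"
    if \<xi>: "\<xi> \<in> mcarrier c.t.M" and \<eta>: "\<eta> \<in> mcarrier c.s.M" for \<xi> \<eta>
  proof -
    obtain X where X: "c.t.cauchy X" "\<xi> = c.t.cls X" by (rule c.t.carrierE[OF \<xi>]) (rule that)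
    obtain Y where Y: "c.s.cauchy Y" "\<eta> = c.s.cls Y" by (rule c.s.carrierE[OF \<eta>]) (rule that)
    show ?thesis
      unfolding X(2) Y(2) mul[OF X(1) Y(1)] c.t.ext_op_cls[OF F X(1)]
        mul[OF c.t.op_cauchy_apply[OF F X(1)] Y(1)]
        c.ts.ext_op_cls[OF Fr c.cauchy_comp_mult[OF X(1) Y(1)]] c.t.elem_span_alpha[OF elem] ..
  qed
  have pi_mul: "mul ?A p s (c.t.\<pi> a) (c.s.\<pi> 1) = c.ts.\<pi> a" for a
    using mul[OF c.t.cauchy_const c.s.cauchy_const, of a 1] by (simp add: c.t.alpha_one)
  have "iota ?A p (p * s) (ext_op (\<theta> p) F) = ext_op (\<theta> p \<circ> \<theta> s) F"
    unfolding iota_def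
  proof (rule the_equality, intro conjI allI impI ballI)
    show "ext_op (\<theta> p \<circ> \<theta> s) F \<in> adjointable (fib ?A (p * s))"
      using c.ts.ext_op_adjointable[OF Fr] by (simp add: fib theta_mult)
    fix s' \<xi> \<eta>
    assume "p * s = p * s'" and \<xi>: "\<xi> \<in> mcarrier (fib ?A p)" and \<eta>: "\<eta> \<in> mcarrier (fib ?A s')"
    then have "s' = s" using left_cancel by metis
    then show "ext_op (\<theta> p \<circ> \<theta> s) F (mul ?A p s' \<xi> \<eta>) = mul ?A p s' (ext_op (\<theta> p) F \<xi>) \<eta>"
      using \<xi> \<eta> ext_mul by (simp add: fib)
  next
    fix S
    assume S: "S \<in> adjointable (fib ?A (p * s)) \<and> (\<forall>s'. p * s = p * s' \<longrightarrow>
      (\<forall>\<xi>\<in>mcarrier (fib ?A p). \<forall>\<eta>\<in>mcarrier (fib ?A s').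
        S (mul ?A p s' \<xi> \<eta>) = mul ?A p s' (ext_op (\<theta> p) F \<xi>) \<eta>))"
    show "S = ext_op (\<theta> p \<circ> \<theta> s) F"
    proof (rule c.ts.adjointable_eqI)
      show "S \<in> adjointable c.ts.M" using S by (simp add: fib theta_mult)
      show "ext_op (\<theta> p \<circ> \<theta> s) F \<in> adjointable c.ts.M" by (rule c.ts.ext_op_adjointable[OF Fr])
      fix a
      have "S (mul ?A p s (c.t.\<pi> a) (c.s.\<pi> 1)) = mul ?A p s (ext_op (\<theta> p) F (c.t.\<pi> a)) (c.s.\<pi> 1)"
        using S c.t.pi_carrier c.s.pi_carrier by (simp add: fib)
      then show "S (c.ts.\<pi> a) = ext_op (\<theta> p \<circ> \<theta> s) F (c.ts.\<pi> a)"
        using ext_mul[OF c.t.pi_carrier c.s.pi_carrier, of a 1] by (simp add: pi_mul)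
    qed
  qed
  then show "iota ?A p (p * s) (ext_op (\<theta> p) F) = ext_op (\<theta> (p * s)) F"
    by (simp add: theta_mult)
qed

end

section \<open>Compact alignment\<close>

theorem proposition7p8:
  fixes \<theta> :: "'p::{right_LCM_monoid, countable} \<Rightarrow> 'g::{group_add, countable} \<Rightarrow> 'g"
  assumes "algebraic_dynamical_system \<theta>"
  shows "compactly_aligned (ads_product_system \<theta>)"
  unfolding compactly_aligned_def
proof (intro allI impI ballI)
  interpret algebraic_dynamical_system \<theta> by (rule assms)
  fix p q r S T
  let ?A = "ads_product_system \<theta>"
  assume int: "range ((*) p) \<inter> range ((*) q) = range ((*) r)"
    and S: "S \<in> compacts (fib ?A p)" and T: "T \<in> compacts (fib ?A q)"
  interpret p: inj_endo "\<theta> p" by (rule inj_endo)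
  interpret q: inj_endo "\<theta> q" by (rule inj_endo)
  interpret r: inj_endo "\<theta> r" by (rule inj_endo)
  have "r \<in> range ((*) r)" using rangeI[of "(*) r" 1] by simp
  with int obtain s s' where r: "r = p * s" "r = q * s'" by blast
  obtain F where F: "\<And>n. F n \<in> elem_span (\<theta> p)" "op_cauchy (\<theta> p) F" "S = ext_op (\<theta> p) F"
    by (rule p.compact_ext_op[of S]) (use S in \<open>auto simp: ads_product_system_def intro: that\<close>)
  obtain H where H: "\<And>n. H n \<in> elem_span (\<theta> q)" "op_cauchy (\<theta> q) H" "T = ext_op (\<theta> q) H"
    by (rule q.compact_ext_op[of T]) (use T in \<open>auto simp: ads_product_system_def intro: that\<close>)
  note F' = iota_ext_op[OF F(1,2), of s, folded r(1)]
  note H' = iota_ext_op[OF H(1,2), of s', folded r(2)]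
  have "(\<lambda>x. F n (H n x)) \<in> elem_span (\<theta> r)" for n
    by (rule elem_span_composition[OF elem_op_composition[OF inj_endo inj_endo inj_endo
            theta_inter[OF int]] p.bounded_clinear_elem_op F(1) H(1)])
  from r.ext_op_compact[OF this r.op_cauchy_compose(1)[OF F'(1) H'(1)]]
  show "compose (mcarrier (fib ?A r)) (iota ?A p r S) (iota ?A q r T) \<in> compacts (fib ?A r)"
    unfolding F(3) H(3) F'(2) H'(2)
    by (simp add: ads_product_system_def r.op_cauchy_compose(2)[OF F'(1) H'(1)])
qed

end
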